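(* Let $\mathfrak g=\mathfrak g(A)$ with $A$ a symmetrizable generalized Cartan matrix, let $\lambda_q$ be an integral weight, and let $V$ be a highest weight $U_q(\mathfrak g)$-module of highest weight $\lambda_q$. Put $I^p_V=I_{L(\lambda_q)}\setminus I_V$. The following are equivalent: (1) $\operatorname{wt}V=\operatorname{wt}M(\lambda_q,I_V)$. (2) $\operatorname{wt}_{I^p_V}V=q^{-\mathbb Z^{\geqslant0}\pi_{I^p_V}}\lambda_q$. In particular, if $V$ is simple, or more generally $|I^p_V|\leqslant1$, then $\operatorname{wt}V=\operatorname{wt}M(\lambda_q,I_V)$.
   Context: Let $A=(a_{ij})_{i,j\in I}$ be a symmetrizable generalized Cartan matrix, $D=\operatorname{diag}(d_i)$ with $d_i\in\mathbb Z^{>0}$ and $DA$ symmetric, $(\mathfrak h,\{\alpha_i\},\{\check\alpha_i\})$ a realization of $A$, and $\mathfrak g=\mathfrak g(A)$ the Kac--Moody algebra. Fix a lattice $P^\vee\subset\mathfrak h$ with $\mathbb Z$-basis consisting of the $\check\alpha_i$ ($i\in I$) and elements $\check\beta_l$ ($1\le l\le|I|-\operatorname{rk}A$), with $P^\vee\otimes_{\mathbb Z}\mathbb C\simeq\mathfrak h$ and $(\check\beta_l,\alpha_i)\in\mathbb Z$; $P=\{\lambda\in\mathfrak h^*:(P^\vee,\lambda)\subset\mathbb Z\}$. $U_q(\mathfrak g)$ is the $\mathbb C(q)$-algebra ($q$ an indeterminate) generated by $e_i,f_i$ ($i\in I$), $q^h$ ($h\in P^\vee$) with relations $q^0=1$,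 $q^hq^{h'}=q^{h+h'}$, $q^he_iq^{-h}=q^{(h,\alpha_i)}e_i$, $q^hf_iq^{-h}=q^{-(h,\alpha_i)}f_i$, $[e_i,f_j]=\delta_{ij}\frac{K_i-K_i^{-1}}{q_i-q_i^{-1}}$ with $K_i=q^{d_i\check\alpha_i}$, $q_i=q^{d_i}$, and the quantum Serre relations. A weight is a $\mathbb C(q)$-algebra homomorphism $\mu_q:\mathbb C(q)[q^{P^\vee}]\to\mathbb C(q)$; it is integral if it is of the form $q^\mu$, $\mu\in P$, with $q^\mu(q^h)=q^{(h,\mu)}$; weights are multiplied by $(\mu_q\nu_q)(q^h)=\mu_q(q^h)\nu_q(q^h)$. $V_{\mu_q}=\{v:q^hv=\mu_q(q^h)v\ \forall h\in P^\vee\}$ and $\operatorname{wt}V=\{\mu_q:V_{\mu_q}\ne0\}$. A highest weight module of highest weight $\lambda_q$ is generated by a nonzero vector of $V_{\lambda_q}$ killed by all $e_i$; $M(\lambda_q)$ and $L(\lambda_q)$ are the Verma and simple such modules. The integrability of $V$ is $I_V=\{i\in I:\dim\mathbb C(q)[f_i]V_{\lambda_q}<\infty\}$. For $J\subset I_{L(\lambda_q)}$ and $\lambda_q=q^\lambda$, the parabolic Verma module $M(\lambda_q,J)$ is the quotient of $M(\lambda_q)$ by the submodule generated by $f_j^{n_j+1}M(\lambda_q)_{\lambda_q}$, $j\in J$, where $n_j=(\check\alpha_j,\lambda)\in\mathbb Z^{\geqslant0}$. For $J\subset I$: $\pi_J=\{\alpha_j:j\in J\}$; $\mathbb Z^{\geqslant0}\pi_J$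 is the set of its nonnegative integer combinations; $q^{-\mathbb Z^{\geqslant0}\pi_J}\lambda_q=\{q^{-\nu}\lambda_q:\nu\in\mathbb Z^{\geqslant0}\pi_J\}$; and $\operatorname{wt}_JV=\operatorname{wt}V\cap q^{-\mathbb Z^{\geqslant0}\pi_J}\lambda_q$, equivalently the weights of the submodule for the Levi subalgebra $U_q(\mathfrak l_J)$ generated by $V_{\lambda_q}$. *)

theory Defs
  imports
    "HOL-Analysis.Cartesian_Space"
    "HOL-Computational_Algebra.Fraction_Field"
    "HOL-Computational_Algebra.Polynomial"
    "HOL-Library.Poly_Mapping"
    "HOL-Algebra.QuotRing"
    "HOL-Algebra.Module"
    "HOL-Algebra.Algebraic_Closure_Type"
begin

section \<open>Left modules over a ring\<close>

text \<open>
  The locale \<^locale>\<open>Module.module\<close> of HOL-Algebra insists on a commutative ring of scalars.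
  We reuse its record type and its (ring-independent) notion of \<^const>\<open>submodule\<close>.
  The fields \<^const>\<open>monoid.mult\<close> and \<^const>\<open>one\<close> of a module record carry no information.
\<close>

locale left_module = R?: ring R + M?: abelian_group M
  for R :: "('a, 'm) ring_scheme" (structure) and M :: "('a, 'b, 'n) module_scheme" (structure) +
  assumes smult_closed [simp, intro]:
      "\<lbrakk>a \<in> carrier R; x \<in> carrier M\<rbrakk> \<Longrightarrow> a \<odot>\<^bsub>M\<^esub> x \<in> carrier M"
    and smult_l_distr:
      "\<lbrakk>a \<in> carrier R; b \<in> carrier R; x \<in> carrier M\<rbrakk> \<Longrightarrow>
        (a \<oplus>\<^bsub>R\<^esub> b) \<odot>\<^bsub>M\<^esub> x = a \<odot>\<^bsub>M\<^esub> x \<oplus>\<^bsub>M\<^esub> b \<odot>\<^bsub>M\<^esub> x"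
    and smult_r_distr:
      "\<lbrakk>a \<in> carrier R; x \<in> carrier M; y \<in> carrier M\<rbrakk> \<Longrightarrow>
        a \<odot>\<^bsub>M\<^esub> (x \<oplus>\<^bsub>M\<^esub> y) = a \<odot>\<^bsub>M\<^esub> x \<oplus>\<^bsub>M\<^esub> a \<odot>\<^bsub>M\<^esub> y"
    and smult_assoc1:
      "\<lbrakk>a \<in> carrier R; b \<in> carrier R; x \<in> carrier M\<rbrakk> \<Longrightarrow>
        (a \<otimes>\<^bsub>R\<^esub> b) \<odot>\<^bsub>M\<^esub> x = a \<odot>\<^bsub>M\<^esub> (b \<odot>\<^bsub>M\<^esub> x)"
    and smult_one [simp]: "x \<in> carrier M \<Longrightarrow> \<one>\<^bsub>R\<^esub> \<odot>\<^bsub>M\<^esub> x = x"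

definition regular_module :: "('a, 'm) ring_scheme \<Rightarrow> ('a, 'a) module" where
  "regular_module R =
     \<lparr>carrier = carrier R, monoid.mult = monoid.mult R, one = one R, zero = zero R, add = add R,
      module.smult = monoid.mult R\<rparr>"

definition gen_submodule ::
    "('a, 'm) ring_scheme \<Rightarrow> ('a, 'b, 'n) module_scheme \<Rightarrow> 'b set \<Rightarrow> 'b set" where
  "gen_submodule R M S = \<Inter>{N. submodule N R M \<and> S \<subseteq> N}"

definition quot_module :: "('a, 'b, 'n) module_scheme \<Rightarrow> 'b set \<Rightarrow> ('a, 'b set) module" where
  "quot_module M N =
     \<lparr>carrier = a_rcosets\<^bsub>M\<^esub> N, monoid.mult = undefined, one = undefined, zero = N, add = set_add M,
      module.smult = (\<lambda>r C. \<Union>x\<in>C. N +>\<^bsub>M\<^esub> (r \<odot>\<^bsub>M\<^esub> x))\<rparr>"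

definition simple_module :: "('a, 'm) ring_scheme \<Rightarrow> ('a, 'b, 'n) module_scheme \<Rightarrow> bool" where
  "simple_module R M \<longleftrightarrow> carrier M \<noteq> {\<zero>\<^bsub>M\<^esub>} \<and>
     (\<forall>N. submodule N R M \<longrightarrow> N = {\<zero>\<^bsub>M\<^esub>} \<or> N = carrier M)"


section \<open>Kac--Moody data\<close>

text \<open>
  The index set \<open>I\<close> is the type \<open>'i\<close>. The lattice is an abstract abelian group \<open>'p\<close> together with
  an embedding \<open>emb\<close> into the Cartan subalgebra, which is the type \<open>'h\<close> with scalar
  multiplication \<open>cscale\<close>. Elements of the dual of the Cartan subalgebra are functions
  \<open>'h \<Rightarrow> complex\<close> that are linear. Only \<open>beta l\<close> with \<open>l < |I| - rk A\<close> matters.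
\<close>

record ('i::finite, 'p, 'h) km_datum =
  cartan :: "int ^ 'i ^ 'i"
  symm :: "'i \<Rightarrow> nat"
  cscale :: "complex \<Rightarrow> 'h \<Rightarrow> 'h"
  root :: "'i \<Rightarrow> 'h \<Rightarrow> complex"
  emb :: "'p \<Rightarrow> 'h"
  coroot :: "'i \<Rightarrow> 'p"
  beta :: "nat \<Rightarrow> 'p"

definition gcm :: "int ^ 'i ^ 'i \<Rightarrow> bool" where
  "gcm A \<longleftrightarrow> (\<forall>i. A $ i $ i = 2) \<and> (\<forall>i j. i \<noteq> j \<longrightarrow> A $ i $ j \<le> 0) \<and>
     (\<forall>i j. A $ i $ j = 0 \<longrightarrow> A $ j $ i = 0)"

definition symmetrized_by :: "int ^ 'i ^ 'i \<Rightarrow> ('i \<Rightarrow> nat) \<Rightarrow> bool" where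
  "symmetrized_by A d \<longleftrightarrow> (\<forall>i. 0 < d i) \<and> (\<forall>i j. int (d i) * A $ i $ j = int (d j) * A $ j $ i)"

definition corank :: "int ^ 'i ^ 'i \<Rightarrow> nat" where
  "corank A = CARD('i) - rank (\<chi> i j. complex_of_int (A $ i $ j))"

definition dual_space :: "('i::finite, 'p, 'h::ab_group_add) km_datum \<Rightarrow> ('h \<Rightarrow> complex) set" where
  "dual_space D = {f. Vector_Spaces.linear (cscale D) (*) f}"

definition realization :: "('i::finite, 'p, 'h::ab_group_add) km_datum \<Rightarrow> bool" where
  "realization D \<longleftrightarrow>
     vector_space (cscale D) \<and>
     vector_space.dim (cscale D) (UNIV :: 'h set) = CARD('i) + corank (cartan D) \<and>
     (\<forall>i. root D i \<in> dual_space D) \<and>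
     (\<forall>c. (\<forall>x. (\<Sum>i\<in>UNIV. c i * root D i x) = 0) \<longrightarrow> (\<forall>i. c i = 0)) \<and>
     inj (\<lambda>i. emb D (coroot D i)) \<and>
     \<not> module.dependent (cscale D) (range (\<lambda>i. emb D (coroot D i))) \<and>
     (\<forall>i j. root D j (emb D (coroot D i)) = of_int (cartan D $ i $ j))"

text \<open>
  The coroots and the \<open>beta l\<close> form a basis of \<open>'h\<close> over the complex numbers, and the image of
  \<open>emb\<close> is the set of their integral combinations. So they form an integral basis of the lattice,
  and extending scalars from the lattice to the complex numbers yields \<open>'h\<close>.
\<close>

definition lattice_basis :: "('i::finite, 'p, 'h) km_datum \<Rightarrow> 'i + nat \<Rightarrow> 'h" where
  "lattice_basis D = case_sum (\<lambda>i. emb D (coroot D i)) (\<lambda>l. emb D (beta D l))"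

definition lattice_index :: "('i::finite, 'p, 'h) km_datum \<Rightarrow> ('i + nat) set" where
  "lattice_index D = range Inl \<union> Inr ` {..<corank (cartan D)}"

definition coweight_lattice ::
    "('i::finite, 'p::ab_group_add, 'h::ab_group_add) km_datum \<Rightarrow> bool" where
  "coweight_lattice D \<longleftrightarrow>
     additive (emb D) \<and> inj (emb D) \<and>
     inj_on (lattice_basis D) (lattice_index D) \<and>
     \<not> module.dependent (cscale D) (lattice_basis D ` lattice_index D) \<and>
     module.span (cscale D) (lattice_basis D ` lattice_index D) = UNIV \<and>
     range (emb D) =
       {\<Sum>b\<in>lattice_index D. cscale D (of_int (m b)) (lattice_basis D b) | m. True} \<and>
     (\<forall>i. \<forall>l<corank (cartan D). root D i (emb D (beta D l)) \<in> \<int>)"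

definition km_data ::
    "('i::finite, 'p::ab_group_add, 'h::ab_group_add) km_datum \<Rightarrow> bool" where
  "km_data D \<longleftrightarrow> gcm (cartan D) \<and> symmetrized_by (cartan D) (symm D) \<and>
     realization D \<and> coweight_lattice D"

definition weight_lattice :: "('i::finite, 'p, 'h::ab_group_add) km_datum \<Rightarrow> ('h \<Rightarrow> complex) set" where
  "weight_lattice D = {lam \<in> dual_space D. \<forall>h. lam (emb D h) \<in> \<int>}"

text \<open>The pairing of a lattice element with a function taking integral values on the lattice.\<close>

definition pairing :: "('i::finite, 'p, 'h) km_datum \<Rightarrow> 'p \<Rightarrow> ('h \<Rightarrow> complex) \<Rightarrow> int" where
  "pairing D h lam = \<lfloor>Re (lam (emb D h))\<rfloor>"


section \<open>The quantum group\<close>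

type_synonym kq = "complex poly fract"

definition qq :: kq where
  "qq = Fract [:0, 1:] 1"

definition qint :: "kq \<Rightarrow> nat \<Rightarrow> kq" where
  "qint x n = (x ^ n - inverse x ^ n) / (x - inverse x)"

definition qfact :: "kq \<Rightarrow> nat \<Rightarrow> kq" where
  "qfact x n = (\<Prod>k=1..n. qint x k)"

definition qbinom :: "kq \<Rightarrow> nat \<Rightarrow> nat \<Rightarrow> kq" where
  "qbinom x n k = qfact x n / (qfact x k * qfact x (n - k))"

text \<open>
  Words form the free monoid, written additively so that \<open>'g word \<Rightarrow>\<^sub>0 kq\<close>, with the
  convolution product, is the free associative algebra on \<open>'g\<close>.
\<close>

datatype 'g word = Word (letters: "'g list")

instantiation word :: (type) monoid_add
begin

definition zero_word :: "'a word" where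
  "0 = Word []"

definition plus_word :: "'a word \<Rightarrow> 'a word \<Rightarrow> 'a word" where
  "u + v = Word (letters u @ letters v)"

instance
  by standard (simp_all add: zero_word_def plus_word_def)

end

datatype ('i, 'p) qgen = GE 'i | GF 'i | GK 'p

type_synonym ('i, 'p) falg = "('i, 'p) qgen word \<Rightarrow>\<^sub>0 kq"

definition gen :: "'g \<Rightarrow> 'g word \<Rightarrow>\<^sub>0 kq" where
  "gen g = Poly_Mapping.single (Word [g]) 1"

definition scalar :: "kq \<Rightarrow> 'm::monoid_add \<Rightarrow>\<^sub>0 kq" where
  "scalar c = Poly_Mapping.single 0 c"

text \<open>The lattice element \<open>d\<^sub>i\<close> times the coroot \<open>i\<close>, so that \<open>q\<close> to this power is \<open>K\<^sub>i\<close>.\<close>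

definition scaled_coroot :: "('i::finite, 'p::ab_group_add, 'h) km_datum \<Rightarrow> 'i \<Rightarrow> 'p" where
  "scaled_coroot D i = (\<Sum>k<symm D i. coroot D i)"

definition q_index :: "('i::finite, 'p, 'h) km_datum \<Rightarrow> 'i \<Rightarrow> kq" where
  "q_index D i = qq ^ symm D i"

definition serre ::
    "('i::finite, 'p, 'h) km_datum \<Rightarrow> ('i \<Rightarrow> ('i, 'p) falg) \<Rightarrow> 'i \<Rightarrow> 'i \<Rightarrow> ('i, 'p) falg" where
  "serre D x i j =
     (let m = nat (1 - cartan D $ i $ j) in
      \<Sum>k\<le>m. scalar ((- 1) ^ k * qbinom (q_index D i) m k) * x i ^ (m - k) * x j * x i ^ k)"

inductive_set relators ::
    "('i::finite, 'p::ab_group_add, 'h::ab_group_add) km_datum \<Rightarrow> ('i, 'p) falg set"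
  for D :: "('i::finite, 'p, 'h) km_datum" where
    K_zero: "gen (GK 0) - 1 \<in> relators D"
  | K_add: "gen (GK (h + h')) - gen (GK h) * gen (GK h') \<in> relators D"
  | K_E: "gen (GK h) * gen (GE i) * gen (GK (- h))
      - scalar (qq powi pairing D h (root D i)) * gen (GE i) \<in> relators D"
  | K_F: "gen (GK h) * gen (GF i) * gen (GK (- h))
      - scalar (qq powi (- pairing D h (root D i))) * gen (GF i) \<in> relators D"
  | E_F: "gen (GE i) * gen (GF j) - gen (GF j) * gen (GE i)
      - (if i = j
         then scalar (1 / (q_index D i - inverse (q_index D i)))
              * (gen (GK (scaled_coroot D i)) - gen (GK (- scaled_coroot D i)))
         else 0) \<in> relators D"
  | serre_E: "i \<noteq> j \<Longrightarrow> serre D (\<lambda>i. gen (GE i)) i j \<in> relators D"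
  | serre_F: "i \<noteq> j \<Longrightarrow> serre D (\<lambda>i. gen (GF i)) i j \<in> relators D"

definition relator_ideal ::
    "('i::finite, 'p::ab_group_add, 'h::ab_group_add) km_datum \<Rightarrow> ('i, 'p) falg set" where
  "relator_ideal D = genideal ring_of_type_algebra (relators D)"

type_synonym ('i, 'p) uq = "('i, 'p) falg set"

definition Uq :: "('i::finite, 'p::ab_group_add, 'h::ab_group_add) km_datum \<Rightarrow> ('i, 'p) uq ring" where
  "Uq D = ring_of_type_algebra Quot relator_ideal D"

definition uq_class ::
    "('i::finite, 'p::ab_group_add, 'h::ab_group_add) km_datum \<Rightarrow> ('i, 'p) falg \<Rightarrow> ('i, 'p) uq" where
  "uq_class D x = relator_ideal D +>\<^bsub>ring_of_type_algebra\<^esub> x"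

definition UE :: "('i::finite, 'p::ab_group_add, 'h::ab_group_add) km_datum \<Rightarrow> 'i \<Rightarrow> ('i, 'p) uq" where
  "UE D i = uq_class D (gen (GE i))"

definition UF :: "('i::finite, 'p::ab_group_add, 'h::ab_group_add) km_datum \<Rightarrow> 'i \<Rightarrow> ('i, 'p) uq" where
  "UF D i = uq_class D (gen (GF i))"

definition UK :: "('i::finite, 'p::ab_group_add, 'h::ab_group_add) km_datum \<Rightarrow> 'p \<Rightarrow> ('i, 'p) uq" where
  "UK D h = uq_class D (gen (GK h))"

definition Uscal :: "('i::finite, 'p::ab_group_add, 'h::ab_group_add) km_datum \<Rightarrow> kq \<Rightarrow> ('i, 'p) uq" where
  "Uscal D c = uq_class D (scalar c)"


section \<open>Weights\<close>

text \<open>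
  The group algebra of the lattice is \<open>'p \<Rightarrow>\<^sub>0 kq\<close>. A weight is an algebra homomorphism
  from it to the ground field.
\<close>

type_synonym 'p weight = "('p \<Rightarrow>\<^sub>0 kq) \<Rightarrow> kq"

definition gexp :: "'p \<Rightarrow> 'p \<Rightarrow>\<^sub>0 kq" where
  "gexp h = Poly_Mapping.single h 1"

definition weights :: "'p::ab_group_add weight set" where
  "weights = {mu. mu 1 = 1 \<and> (\<forall>x y. mu (x + y) = mu x + mu y) \<and>
     (\<forall>x y. mu (x * y) = mu x * mu y) \<and> (\<forall>c x. mu (scalar c * x) = c * mu x)}"

definition linear_ext :: "('p \<Rightarrow> kq) \<Rightarrow> 'p weight" where
  "linear_ext f x = (\<Sum>h\<in>Poly_Mapping.keys x. Poly_Mapping.lookup x h * f h)"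

definition wt_mult :: "'p weight \<Rightarrow> 'p weight \<Rightarrow> 'p weight" where
  "wt_mult mu nu = linear_ext (\<lambda>h. mu (gexp h) * nu (gexp h))"

definition integral_wt :: "('i::finite, 'p, 'h) km_datum \<Rightarrow> ('h \<Rightarrow> complex) \<Rightarrow> 'p weight" where
  "integral_wt D lam = linear_ext (\<lambda>h. qq powi pairing D h lam)"

definition wt_space ::
    "('i::finite, 'p::ab_group_add, 'h::ab_group_add) km_datum \<Rightarrow> (('i, 'p) uq, 'v, 'n) module_scheme \<Rightarrow>
     'p weight \<Rightarrow> 'v set" where
  "wt_space D V mu =
     {v \<in> carrier V. \<forall>h. UK D h \<odot>\<^bsub>V\<^esub> v = Uscal D (mu (gexp h)) \<odot>\<^bsub>V\<^esub> v}"

definition wt ::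
    "('i::finite, 'p::ab_group_add, 'h::ab_group_add) km_datum \<Rightarrow> (('i, 'p) uq, 'v, 'n) module_scheme \<Rightarrow>
     'p weight set" where
  "wt D V = {mu \<in> weights. wt_space D V mu \<noteq> {\<zero>\<^bsub>V\<^esub>}}"

definition nonneg_span :: "('i::finite, 'p, 'h) km_datum \<Rightarrow> 'i set \<Rightarrow> ('h \<Rightarrow> complex) set" where
  "nonneg_span D J = {\<lambda>x. \<Sum>j\<in>J. of_nat (n j) * root D j x | n :: 'i \<Rightarrow> nat. True}"

definition wt_cone :: "('i::finite, 'p, 'h) km_datum \<Rightarrow> 'i set \<Rightarrow> 'p weight \<Rightarrow> 'p weight set" where
  "wt_cone D J mu = {wt_mult (integral_wt D (\<lambda>x. - nu x)) mu | nu. nu \<in> nonneg_span D J}"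

definition wt_J ::
    "('i::finite, 'p::ab_group_add, 'h::ab_group_add) km_datum \<Rightarrow> (('i, 'p) uq, 'v, 'n) module_scheme \<Rightarrow>
     'p weight \<Rightarrow> 'i set \<Rightarrow> 'p weight set" where
  "wt_J D V mu J = wt D V \<inter> wt_cone D J mu"


section \<open>Highest weight modules\<close>

definition highest_weight_module ::
    "('i::finite, 'p::ab_group_add, 'h::ab_group_add) km_datum \<Rightarrow> (('i, 'p) uq, 'v, 'n) module_scheme \<Rightarrow>
     'p weight \<Rightarrow> bool" where
  "highest_weight_module D V mu \<longleftrightarrow> left_module (Uq D) V \<and>
     (\<exists>v \<in> wt_space D V mu. v \<noteq> \<zero>\<^bsub>V\<^esub> \<and> (\<forall>i. UE D i \<odot>\<^bsub>V\<^esub> v = \<zero>\<^bsub>V\<^esub>) \<and>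
        gen_submodule (Uq D) V {v} = carrier V)"

definition lin_span ::
    "('i::finite, 'p::ab_group_add, 'h::ab_group_add) km_datum \<Rightarrow> (('i, 'p) uq, 'v, 'n) module_scheme \<Rightarrow>
     'v set \<Rightarrow> 'v set" where
  "lin_span D V S = \<Inter>{W. subgroup W (add_monoid V) \<and>
     (\<forall>c. \<forall>w\<in>W. Uscal D c \<odot>\<^bsub>V\<^esub> w \<in> W) \<and> S \<subseteq> W}"

text \<open>
  The space \<open>kq[f\<^sub>i] V\<^sub>\<mu>\<close> is spanned by the vectors \<open>f\<^sub>i\<^sup>n v\<close> with \<open>v\<close> in the weight space.
\<close>

definition integrability ::
    "('i::finite, 'p::ab_group_add, 'h::ab_group_add) km_datum \<Rightarrow> (('i, 'p) uq, 'v, 'n) module_scheme \<Rightarrow>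
     'p weight \<Rightarrow> 'i set" where
  "integrability D V mu =
     {i. \<exists>B \<subseteq> carrier V. finite B \<and>
        lin_span D V {(UF D i [^]\<^bsub>Uq D\<^esub> n) \<odot>\<^bsub>V\<^esub> v | (n::nat) v. v \<in> wt_space D V mu}
          = lin_span D V B}"

definition verma ::
    "('i::finite, 'p::ab_group_add, 'h::ab_group_add) km_datum \<Rightarrow> 'p weight \<Rightarrow>
     (('i, 'p) uq, ('i, 'p) uq set) module" where
  "verma D mu =
     quot_module (regular_module (Uq D))
       (gen_submodule (Uq D) (regular_module (Uq D))
         (range (UE D) \<union> range (\<lambda>h. UK D h \<ominus>\<^bsub>Uq D\<^esub> Uscal D (mu (gexp h)))))"

text \<open>The quotient of the Verma module by the sum of all its proper submodules.\<close>

definition simple_hw ::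
    "('i::finite, 'p::ab_group_add, 'h::ab_group_add) km_datum \<Rightarrow> 'p weight \<Rightarrow>
     (('i, 'p) uq, ('i, 'p) uq set set) module" where
  "simple_hw D mu =
     quot_module (verma D mu)
       (gen_submodule (Uq D) (verma D mu)
         (\<Union>{N. submodule N (Uq D) (verma D mu) \<and> N \<noteq> carrier (verma D mu)}))"

text \<open>
  The parabolic Verma module of highest weight \<open>integral_wt D lam\<close>, meaningful for \<open>lam\<close> in the
  weight lattice and \<open>J\<close> contained in the integrability of the simple module, where all pairings
  of \<open>lam\<close> with the coroots in \<open>J\<close> are nonnegative.
\<close>

definition parabolic_verma ::
    "('i::finite, 'p::ab_group_add, 'h::ab_group_add) km_datum \<Rightarrow> ('h \<Rightarrow> complex) \<Rightarrow> 'i set \<Rightarrow>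
     (('i, 'p) uq, ('i, 'p) uq set set) module" where
  "parabolic_verma D lam J =
     (let M = verma D (integral_wt D lam) in
      quot_module M
        (gen_submodule (Uq D) M
          {(UF D j [^]\<^bsub>Uq D\<^esub> (nat (pairing D (coroot D j) lam) + 1)) \<odot>\<^bsub>M\<^esub> v | j v.
             j \<in> J \<and> v \<in> wt_space D M (integral_wt D lam)}))"

definition I_p ::
    "('i::finite, 'p::ab_group_add, 'h::ab_group_add) km_datum \<Rightarrow> (('i, 'p) uq, 'v, 'n) module_scheme \<Rightarrow>
     'p weight \<Rightarrow> 'i set" where
  "I_p D V mu = integrability D (simple_hw D mu) mu - integrability D V mu"

end

theory Submission
  imports Defs
begin

text \<open>
  A highest weight module is the quotient of the free algebra by a left ideal \<open>L\<close> containing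
  \<open>relators * x\<close>, the \<open>e\<^sub>i\<close> and the \<open>q\<^sup>h - \<lambda>\<^sub>q(q\<^sup>h)\<close>. Its weights are the \<open>\<lambda> - \<Sum> \<nu>\<^sub>i \<alpha>\<^sub>i\<close> for which some
  word in the \<open>f\<^sub>i\<close> with content \<open>\<nu>\<close> is not in \<open>L\<close>. Let \<open>I\<close> be the integrability of \<open>V\<close>.

  For (2) to (1), vectors on which \<open>f\<^sub>j\<close> is nilpotent form a submodule, so \<open>f\<^sub>j\<close> with
  \<open>(\<lambda>, \<alpha>\<^sub>j\<^sup>v) < 0\<close> is injective on the simple quotient. A word \<open>w\<close> in these \<open>f\<^sub>j\<close> can therefore be
  undone by a word \<open>u\<close> in the same \<open>e\<^sub>j\<close>, and \<open>u\<close> commutes with every word \<open>x\<close> in the remaining \<open>f\<^sub>i\<close>: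
  \<open>u x w = x u w\<close> is a multiple of \<open>x\<close>, so \<open>x w\<close> is not in \<open>L\<close> if \<open>x\<close> is not. Thus all of
  \<open>\<lambda> - \<int>\<^sub>\<ge>\<^sub>0 \<pi>\<close> off \<open>I\<close> are weights of \<open>V\<close>. The other weights of the parabolic Verma module are
  reached by simple reflections in \<open>I\<close> and, for \<open>I\<close>-dominant weights, by Kac's argument on maximal
  weights, which becomes a computation with the symmetrized Cartan matrix.

  For (1) to (2), one needs that the parabolic Verma module has the weights \<open>\<lambda> - \<int>\<^sub>\<ge>\<^sub>0 \<pi>\<close> off \<open>I\<close>. The
  free Verma module on words carries an action in which the quantum Serre elements in the \<open>f\<^sub>i\<close> commute
  with all \<open>e\<^sub>k\<close>, and evaluating words in a quantum torus separates those weights from the relations.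
\<close>

section \<open>Free algebras and q-numbers\<close>

text \<open>The modules to be compared (\<open>V\<close>, Verma, parabolic, simple) have different
  carrier types, whereas their ideals share one type, so that quotient maps become inclusions. The
  delicate direction is to show that enough words survive, without a triangular decomposition to
  start from. Upper bounds come from spanning (\<open>fspan\<close>); lower bounds come from
  explicit functionals on words. On the free module over words only the Serre relations in the f_i
  can fail, and the functionals killing these and the parabolic relations are closed under the
  action. A quantum torus supplies one functional that detects all words with letters off
  \<open>J\<close> at once: letters commute up to powers of q, so a Serre element collapses to an
  alternating q-binomial sum at one of its zeros, and putting the letters of \<open>J\<close> to 0
  disposes of the parabolic relations. Symmetrizability enters twice: as q_i^a_ij = q_j^a_ji on the
  quantum side, and as the symmetric form behind the maximal weight argument.\<close>

lemma scalar_add: "scalar (a + b) = scalar a + scalar b"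
  by (simp add: scalar_def single_add)

lemma scalar_mult: "scalar (a * b) = scalar a * scalar b"
  by (simp add: scalar_def mult_single)

lemma scalar_0 [simp]: "scalar 0 = 0"
  by (simp add: scalar_def)

lemma scalar_1 [simp]: "scalar 1 = 1"
  by (simp add: scalar_def)

lemma scalar_minus: "scalar (- a) = - scalar a"
  by (simp add: scalar_def single_uminus)

lemma scalar_diff: "scalar (a - b) = scalar a - scalar b"
  by (simp add: scalar_def single_diff)

lemma poly_mapping_sum_induct [case_names zero single add]:
  assumes "P 0" and "\<And>k c. P (Poly_Mapping.single k c)"
    and "\<And>x y. P x \<Longrightarrow> P y \<Longrightarrow> P (x + y)"
  shows "P x"
proof (induction x rule: update_induct)
  case const
  show ?case by fact
next
  case (update f a b)
  have "Poly_Mapping.update a b f = f + Poly_Mapping.single a b"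
    using update(1)
    by (intro poly_mapping_eqI) (auto simp: lookup_update lookup_add lookup_single in_keys_iff when_def)
  with update assms show ?case by simp
qed

lemma scalar_commute: "scalar c * x = x * scalar c"
proof (induction x rule: poly_mapping_sum_induct)
  case (single k d)
  show ?case by (simp add: scalar_def mult_single mult.commute)
qed (simp_all add: algebra_simps)

lemma mult_scalar_left: "y * (scalar c * x) = scalar c * (y * x)"
  by (metis scalar_commute mult.assoc)

lemma single_Word: "Poly_Mapping.single (Word ws) c = scalar c * prod_list (map gen ws)"
proof -
  have "Poly_Mapping.single (Word ws) 1 = prod_list (map gen ws)"
  proof (induction ws)
    case Nil
    show ?case by (simp flip: zero_word_def)
  next
    case (Cons a ws)
    have "Poly_Mapping.single (Word (a # ws)) (1::kq) =
        Poly_Mapping.single (Word [a]) 1 * Poly_Mapping.single (Word ws) 1"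
      by (simp add: mult_single plus_word_def)
    with Cons show ?case by (simp add: gen_def)
  qed
  moreover have "Poly_Mapping.single (Word ws) c = scalar c * Poly_Mapping.single (Word ws) 1"
    by (simp add: scalar_def mult_single)
  ultimately show ?thesis by simp
qed

text \<open>Words grow at their left end, so a claim about left multiplication need only be checked
  on generators. This is the shape needed for left ideals and module actions.\<close>

lemma falg_induct [case_names one add scalar gen]:
  assumes "P 1" and "\<And>x y. P x \<Longrightarrow> P y \<Longrightarrow> P (x + y)"
    and "\<And>c x. P x \<Longrightarrow> P (scalar c * x)" and "\<And>g x. P x \<Longrightarrow> P (gen g * x)"
  shows "P x"
proof (induction x rule: poly_mapping_sum_induct)
  case zero
  show ?case using assms(1) assms(3)[of 1 0] by simp
next
  case (single k c)
  obtain ws where "k = Word ws" by (cases k)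
  moreover have "P (prod_list (map gen ws))"
    by (induction ws) (simp_all add: assms)
  ultimately show ?case by (simp add: single_Word assms(3))
qed (rule assms(2))

text \<open>The universal property of the free algebra. The target is merely a ring, so its algebra
  structure is carried by \<open>s\<close>, which \<open>scalar_map\<close> requires to be a central
  ring homomorphism.\<close>

definition extend_hom :: "(kq \<Rightarrow> 'r::ring_1) \<Rightarrow> ('g \<Rightarrow> 'r) \<Rightarrow> ('g word \<Rightarrow>\<^sub>0 kq) \<Rightarrow> 'r" where
  "extend_hom s g x =
     (\<Sum>w\<in>Poly_Mapping.keys x. s (Poly_Mapping.lookup x w) * prod_list (map g (letters w)))"

locale scalar_map =
  fixes s :: "kq \<Rightarrow> 'r::ring_1"
  assumes s_add: "s (a + b) = s a + s b"
    and s_mult: "s (a * b) = s a * s b"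
    and s_one: "s 1 = 1"
    and s_central: "s a * r = r * s a"
begin

lemma s_zero: "s 0 = 0"
  using s_add[of 0 0] by simp

lemma s_minus: "s (- a) = - s a"
  using s_add[of a "- a"] s_zero by (simp add: eq_neg_iff_add_eq_0 add.commute)

lemma s_sum: "s (\<Sum>k\<in>A. f k) = (\<Sum>k\<in>A. s (f k))"
  by (induction A rule: infinite_finite_induct) (simp_all add: s_zero s_add)

lemma s_left: "r * (s a * t) = s a * (r * t)"
  by (metis s_central mult.assoc)

end

locale algebra_map = scalar_map s for s :: "kq \<Rightarrow> 'r::ring_1" +
  fixes g :: "'g \<Rightarrow> 'r"
begin

abbreviation "\<rho> \<equiv> extend_hom s g"

lemma hom_superset:
  assumes "finite A" "Poly_Mapping.keys x \<subseteq> A"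
  shows "\<rho> x = (\<Sum>w\<in>A. s (Poly_Mapping.lookup x w) * prod_list (map g (letters w)))"
  unfolding extend_hom_def using assms
  by (intro sum.mono_neutral_left) (auto simp: in_keys_iff s_zero)

lemma hom_zero: "\<rho> 0 = 0"
  by (simp add: extend_hom_def)

lemma hom_add: "\<rho> (x + y) = \<rho> x + \<rho> y"
proof -
  let ?A = "Poly_Mapping.keys x \<union> Poly_Mapping.keys y"
  have "Poly_Mapping.keys (x + y) \<subseteq> ?A"
    by (rule keys_add)
  then show ?thesis
    by (simp add: hom_superset[of ?A] lookup_add s_add distrib_right sum.distrib)
qed

lemma hom_single: "\<rho> (Poly_Mapping.single w c) = s c * prod_list (map g (letters w))"
  by (subst hom_superset[of "{w}"]) auto

lemma hom_mult: "\<rho> (x * y) = \<rho> x * \<rho> y"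
proof (induction x rule: poly_mapping_sum_induct)
  case (single u a)
  show ?case
  proof (induction y rule: poly_mapping_sum_induct)
    case (single v b)
    have "s (a * b) * (p * r) = s a * p * (s b * r)" for p r
      by (metis s_mult s_central mult.assoc)
    then show ?case
      by (simp add: mult_single hom_single plus_word_def)
  qed (simp_all add: hom_zero hom_add algebra_simps)
qed (simp_all add: hom_zero hom_add algebra_simps)

lemma hom_scalar: "\<rho> (scalar c) = s c"
  by (simp add: scalar_def hom_single zero_word_def)

lemma hom_gen: "\<rho> (gen a) = g a"
  by (simp add: gen_def hom_single s_one)

lemma hom_one: "\<rho> 1 = 1"
  using hom_scalar[of 1] by (simp add: s_one)

lemma hom_uminus: "\<rho> (- x) = - \<rho> x"
  using hom_add[of x "- x"] hom_zero by (simp add: eq_neg_iff_add_eq_0 add.commute)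

lemma hom_diff: "\<rho> (x - y) = \<rho> x - \<rho> y"
  using hom_add[of x "- y"] by (simp add: hom_uminus)

lemma hom_sum: "\<rho> (\<Sum>a\<in>A. f a) = (\<Sum>a\<in>A. \<rho> (f a))"
  by (induction A rule: infinite_finite_induct) (simp_all add: hom_zero hom_add)

lemma hom_power: "\<rho> (x ^ n) = \<rho> x ^ n"
  by (induction n) (simp_all add: hom_one hom_mult)

lemmas hom_simps = hom_zero hom_add hom_mult hom_scalar hom_gen hom_one hom_diff hom_sum hom_power

end

section \<open>q-numbers and q-binomial coefficients\<close>

lemma qq_power: "qq ^ n = Fract (monom 1 n) 1"
proof (induction n)
  case 0
  show ?case by (simp add: One_fract_def)
next
  case (Suc n)
  have "[:0, 1:] * monom 1 n = (monom 1 (Suc n) :: complex poly)"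
    by (simp add: monom_Suc)
  with Suc show ?case by (simp add: qq_def)
qed

lemma qq_neq_0 [simp]: "qq \<noteq> 0"
  by (simp add: qq_def Zero_fract_def eq_fract)

lemma qq_power_eq_1_iff: "qq ^ n = 1 \<longleftrightarrow> n = 0"
proof -
  have "qq ^ n = 1 \<longleftrightarrow> monom 1 n = (1 :: complex poly)"
    by (simp add: qq_power One_fract_def eq_fract)
  also have "\<dots> \<longleftrightarrow> n = 0"
    by (metis degree_monom_eq degree_1 monom_0 one_pCons zero_neq_one monom_eq_1)
  finally show ?thesis .
qed

text \<open>The property of \<open>q_index D i\<close> on which the q-identities rest. It is stable
  under inversion, so each identity is available for \<open>x\<close> and
  \<open>inverse x\<close>.\<close>

definition nonroot :: "kq \<Rightarrow> bool" where
  "nonroot x \<longleftrightarrow> x \<noteq> 0 \<and> (\<forall>n>0. x ^ n \<noteq> 1)"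

lemma nonroot_qq_power: "0 < d \<Longrightarrow> nonroot (qq ^ d)"
  by (auto simp: nonroot_def qq_power_eq_1_iff simp flip: power_mult)

lemma nonroot_inverse: "nonroot x \<Longrightarrow> nonroot (inverse x)"
  by (auto simp: nonroot_def power_inverse)

lemma nonroot_powi_eq_1:
  assumes "nonroot x" shows "x powi n = 1 \<longleftrightarrow> n = 0"
proof (cases n rule: int_cases2)
  case (nonneg k)
  then show ?thesis using assms by (auto simp: nonroot_def)
next
  case (nonpos k)
  then show ?thesis using assms by (auto simp: nonroot_def power_int_minus)
qed

lemma nonroot_powi_inj:
  assumes "nonroot x" shows "x powi m = x powi n \<longleftrightarrow> m = n"
proof -
  have "x \<noteq> 0" using assms by (simp add: nonroot_def)
  then have "x powi m = x powi n \<longleftrightarrow> x powi (m - n) = 1"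
    by (simp add: power_int_diff)
  with nonroot_powi_eq_1[OF assms] show ?thesis by simp
qed

text \<open>Extends \<open>qint\<close> to integers: the Cartan part of [e_i, f_i] acts on a weight
  vector by the q-number of a pairing, which may be negative.\<close>

definition qnum :: "kq \<Rightarrow> int \<Rightarrow> kq" where
  "qnum x n = (x powi n - x powi (- n)) / (x - inverse x)"

lemma qint_eq_qnum: "qint x n = qnum x (int n)"
  by (simp add: qint_def qnum_def power_int_minus power_inverse)

lemma qnum_0 [simp]: "qnum x 0 = 0"
  by (simp add: qnum_def)

lemma nonroot_diff_inverse:
  assumes "nonroot x" shows "x - inverse x \<noteq> 0"
  using nonroot_powi_inj[OF assms, of 1 "-1"] by (simp add: power_int_minus)

lemma qnum_eq_0_iff:
  assumes "nonroot x" shows "qnum x n = 0 \<longleftrightarrow> n = 0"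
  using nonroot_diff_inverse[OF assms] nonroot_powi_inj[OF assms, of n "- n"]
  by (auto simp: qnum_def)

lemma qnum_1: "nonroot x \<Longrightarrow> qnum x 1 = 1"
  using nonroot_diff_inverse[of x] by (simp add: qnum_def power_int_minus)

text \<open>With \<open>M\<close> and \<open>P\<close> for x^m and x^p this is [m+1][p-m] +
  [p-2(m+1)] = [m+2][p-m-1], freed of integer exponents so that plain field arithmetic settles
  it.\<close>

lemma telescope_aux:
  fixes M P x :: "'a::field"
  assumes "M \<noteq> 0" "P \<noteq> 0" "x \<noteq> 0" "d \<noteq> 0" "d = x - 1 / x"
  shows "((M * x - 1 / (M * x)) / d) * ((P / M - M / P) / d) + (P / (M * x) ^ 2 - (M * x) ^ 2 / P) / d
      = ((M * x ^ 2 - 1 / (M * x ^ 2)) / d) * ((P / (M * x) - M * x / P) / d)"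
proof -
  have "(M * x - 1 / (M * x)) * (P / M - M / P) + (P / (M * x) ^ 2 - (M * x) ^ 2 / P) * d
      = (M * x ^ 2 - 1 / (M * x ^ 2)) * (P / (M * x) - M * x / P)"
    unfolding assms(5) using assms(1-3)
    by (simp add: divide_simps) (simp add: algebra_simps power2_eq_square)
  then have "((M * x - 1 / (M * x)) * (P / M - M / P) + (P / (M * x) ^ 2 - (M * x) ^ 2 / P) * d) / (d * d)
      = (M * x ^ 2 - 1 / (M * x ^ 2)) * (P / (M * x) - M * x / P) / (d * d)"
    by simp
  then show ?thesis
    using assms(4) by (simp add: add_divide_distrib)
qed

lemma qnum_telescope:
  assumes "nonroot x"
  shows "qnum x (m + 1) * qnum x (p - m) + qnum x (p - 2 * (m + 1)) =
    qnum x (m + 2) * qnum x (p - (m + 1))"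
proof -
  have x: "x \<noteq> 0" and d: "x - inverse x \<noteq> 0"
    using assms nonroot_diff_inverse by (auto simp: nonroot_def)
  define d where "d = x - inverse x"
  define M P where "M = x powi m" and "P = x powi p"
  have nz: "M \<noteq> 0" "P \<noteq> 0" using x by (simp_all add: M_def P_def)
  have e: "x powi (m + 1) = M * x" "x powi (- (m + 1)) = 1 / (M * x)"
    "x powi (p - m) = P / M" "x powi (- (p - m)) = M / P"
    "x powi (m + 2) = M * x ^ 2" "x powi (- (m + 2)) = 1 / (M * x ^ 2)"
    "x powi (p - (m + 1)) = P / (M * x)" "x powi (- (p - (m + 1))) = M * x / P"
    "x powi (p - 2 * (m + 1)) = P / (M * x) ^ 2" "x powi (- (p - 2 * (m + 1))) = (M * x) ^ 2 / P"
    using x unfolding M_def P_def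
    by (simp_all add: power_int_add power_int_diff power_int_minus power_int_mult divide_simps
        power_int_mult mult.commute[of 2] del: minus_add_distrib minus_diff_eq)
  have "((M * x - 1 / (M * x)) / d) * ((P / M - M / P) / d) + (P / (M * x) ^ 2 - (M * x) ^ 2 / P) / d
      = ((M * x ^ 2 - 1 / (M * x ^ 2)) / d) * ((P / (M * x) - M * x / P) / d)"
    by (rule telescope_aux) (use x nz \<open>x - inverse x \<noteq> 0\<close> in \<open>simp_all add: d_def inverse_eq_divide\<close>)
  then show ?thesis
    unfolding qnum_def e d_def .
qed

text \<open>Along an f-string starting at pairing \<open>p\<close>, the Cartan part of [e, f] has
  eigenvalues [p - 2k]. Their partial sum is the coefficient produced by e on f^(n+1); the product
  form shows that it vanishes only for n = p.\<close>

lemma sum_qnum: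
  assumes "nonroot x"
  shows "(\<Sum>k\<le>n. qnum x (p - 2 * int k)) = qnum x (int n + 1) * qnum x (p - int n)"
proof (induction n)
  case 0
  show ?case by (simp add: qnum_1[OF assms])
next
  case (Suc n)
  then show ?case
    using qnum_telescope[OF assms, of "int n" p] by (simp add: algebra_simps)
qed

lemma qint_nz: "nonroot x \<Longrightarrow> 0 < n \<Longrightarrow> qint x n \<noteq> 0"
  by (simp add: qint_eq_qnum qnum_eq_0_iff)

lemma qfact_nz: "nonroot x \<Longrightarrow> qfact x n \<noteq> 0"
  by (auto simp: qfact_def qint_nz)

lemma qfact_Suc: "qfact x (Suc n) = qint x (Suc n) * qfact x n"
  by (simp add: qfact_def mult.commute)

lemma qfact_0 [simp]: "qfact x 0 = 1"
  by (simp add: qfact_def)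

lemma qbinom_0 [simp]: "nonroot x \<Longrightarrow> qbinom x n 0 = 1"
  using qfact_nz[of x n] by (simp add: qbinom_def)

lemma qbinom_self [simp]: "nonroot x \<Longrightarrow> qbinom x n n = 1"
  using qfact_nz[of x n] by (simp add: qbinom_def)

text \<open>Both sides are [m]! / ([r]! [m-r-1]!). Consecutive Serre coefficients cancel through
  this identity in \<open>qserre_commute_left\<close>.\<close>

lemma qbinom_absorb:
  assumes "nonroot x" "r < m"
  shows "qbinom x m r * qint x (m - r) = qbinom x m (Suc r) * qint x (Suc r)"
proof -
  have "m - r = Suc (m - Suc r)" using assms by simp
  then have "qfact x (m - r) = qint x (m - r) * qfact x (m - Suc r)"
    by (metis qfact_Suc)
  then show ?thesis
    using qfact_nz[OF assms(1)] qint_nz[OF assms(1), of "m - r"] qint_nz[OF assms(1), of "Suc r"] assms(2)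
    by (simp add: qbinom_def qfact_Suc)
qed

lemma qint_inverse: "qint (inverse x) n = qint x n"
proof -
  have "(a - b) / (c - d) = (b - a) / (d - c)" for a b c d :: kq
    by (metis minus_diff_eq minus_divide_divide)
  then show ?thesis by (simp add: qint_def)
qed

lemma qbinom_inverse: "qbinom (inverse x) n k = qbinom x n k"
  by (simp add: qbinom_def qfact_def qint_inverse)

lemma qbinom_Suc:
  assumes "nonroot x" "r < m"
  shows "qbinom x (Suc m) (Suc r) = x ^ Suc r * qbinom x m (Suc r) + inverse x ^ (m - r) * qbinom x m r"
proof -
  have x: "x \<noteq> 0" using assms by (simp add: nonroot_def)
  obtain t where t: "m = r + Suc t" using assms(2) less_imp_Suc_add by auto
  have "qint x (Suc r + Suc t) = x ^ Suc r * qint x (Suc t) + inverse x ^ Suc t * qint x (Suc r)"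
    using nonroot_diff_inverse[OF assms(1)] x
    by (simp add: qint_def divide_simps power_add power_inverse) (simp add: algebra_simps)
  then have "qint x (Suc m) = x ^ Suc r * qint x (m - r) + inverse x ^ (m - r) * qint x (Suc r)"
    by (simp add: t)
  moreover have "qfact x (m - r) = qint x (m - r) * qfact x (m - Suc r)"
    using qfact_Suc[of x t] by (simp add: t)
  ultimately show ?thesis
    using qfact_nz[OF assms(1)] qint_nz[OF assms(1), of "m - r"] qint_nz[OF assms(1), of "Suc r"] assms(2)
    by (simp add: qbinom_def qfact_Suc divide_simps) (simp add: algebra_simps)
qed

text \<open>The Gaussian binomial polynomial of degree m + 1 vanishes at x^m. Pascal's rule makes
  each inner term a difference of consecutive values of one sequence, and the ends of the telescope
  cancel the first and last terms. Abstract coefficients keep q-factorials out of the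
  computation.\<close>

lemma pascal_alternating_sum:
  fixes x :: "'a::field" and c c' :: "nat \<Rightarrow> 'a"
  assumes x: "x \<noteq> 0" and c: "c 0 = 1" "c m = 1" "c' 0 = 1" "c' (Suc m) = 1"
    and pascal: "\<And>r. r < m \<Longrightarrow> c' (Suc r) = x ^ Suc r * c (Suc r) + inverse x ^ (m - r) * c r"
  shows "(\<Sum>r\<le>Suc m. (- 1) ^ r * c' r * (x ^ m) ^ r) = 0"
proof -
  let ?z = "x ^ m" and ?i = "inverse x"
  \<comment> \<open>Pascal's two summands acquire matching powers: x^(m(r+1)) times x^(r+1) is
    x^((m+1)(r+1)), and x^(m(r+1)) times x^-(m-r) is x^((m+1)r).\<close>
  define g where "g r = (- 1) ^ r * c r * (x ^ Suc m) ^ r" for r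
  have step: "(- 1) ^ Suc r * c' (Suc r) * ?z ^ Suc r = g (Suc r) - g r" if "r < m" for r
  proof -
    obtain t where t: "m = r + t" using \<open>r < m\<close> by (metis le_add_diff_inverse less_imp_le)
    have "?z ^ Suc r = (x ^ Suc m) ^ r * x ^ t"
      unfolding power_mult[symmetric] power_add[symmetric] by (simp add: t algebra_simps)
    moreover have "x ^ t * ?i ^ t = 1"
      using x by (simp add: power_inverse)
    ultimately have 1: "?z ^ Suc r * ?i ^ (m - r) = (x ^ Suc m) ^ r"
      by (simp add: t mult.assoc)
    have 2: "?z ^ Suc r * x ^ Suc r = (x ^ Suc m) ^ Suc r"
      by (subst power_mult_distrib[symmetric]) (simp only: power_Suc2)
    have "(- 1) ^ Suc r * (a * b + d * e) * f = (- 1) ^ Suc r * b * (f * a) - (- 1) ^ r * e * (f * d)"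
      for a b d e f :: 'a
      by (simp add: algebra_simps)
    then show ?thesis
      unfolding g_def pascal[OF that] 1[symmetric] 2[symmetric] .
  qed
  have "(\<Sum>r<m. (- 1) ^ Suc r * c' (Suc r) * ?z ^ Suc r) = (\<Sum>r<m. g (Suc r) - g r)"
    by (intro sum.cong refl step) simp
  also have "\<dots> = g m - g 0"
    by (rule sum_lessThan_telescope)
  finally have mid: "(\<Sum>r<m. (- 1) ^ Suc r * c' (Suc r) * ?z ^ Suc r) = g m - g 0" .
  have "?z ^ Suc m = (x ^ Suc m) ^ m"
    unfolding power_mult[symmetric] by (simp only: mult.commute)
  then have last: "(- 1) ^ Suc m * c' (Suc m) * ?z ^ Suc m = - g m"
    by (simp add: g_def c)
  have "(\<Sum>r\<le>Suc m. (- 1) ^ r * c' r * ?z ^ r) =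
    (\<Sum>r<Suc (Suc m). (- 1) ^ r * c' r * ?z ^ r)"
    by (simp only: lessThan_Suc_atMost)
  also have "\<dots> = (- 1) ^ 0 * c' 0 * ?z ^ 0 + (\<Sum>r<m. (- 1) ^ Suc r * c' (Suc r) * ?z ^ Suc r)
    + (- 1) ^ Suc m * c' (Suc m) * ?z ^ Suc m"
    by (subst sum.lessThan_Suc_shift, subst sum.lessThan_Suc) (simp only: add.assoc)
  finally show ?thesis
    unfolding mid last by (simp add: c g_def)
qed
lemma qbinom_alternating_sum:
  assumes "nonroot x"
  shows "(\<Sum>r\<le>Suc m. (- 1) ^ r * qbinom x (Suc m) r * (x ^ m) ^ r) = 0"
  by (rule pascal_alternating_sum[where c = "qbinom x m"])
    (use assms qbinom_Suc[OF assms] in \<open>auto simp: nonroot_def\<close>)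

lemma qbinom_alternating_sum':
  assumes "nonroot x"
  shows "(\<Sum>r\<le>Suc m. (- 1) ^ r * qbinom x (Suc m) r * (inverse x ^ m) ^ r) = 0"
  using qbinom_alternating_sum[OF nonroot_inverse[OF assms], of m] by (simp add: qbinom_inverse)

section \<open>Left ideals containing the relators\<close>

lemma gen_scalar: "gen g * (scalar c * x) = scalar c * (gen g * x)"
  "gen g ^ n * (scalar c * x) = scalar c * (gen g ^ n * x)"
  by (rule mult_scalar_left)+

section \<open>Lattice pairings and simple roots\<close>

locale km =
  fixes D :: "('i::finite, 'p::ab_group_add, 'h::ab_group_add) km_datum"
  assumes km: "km_data D"
begin

abbreviation "a i j \<equiv> cartan D $ i $ j"
abbreviation "d i \<equiv> symm D i"
abbreviation "q i \<equiv> q_index D i"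
abbreviation "alpha h i \<equiv> pairing D h (root D i)"

lemma a_diag [simp]: "a i i = 2"
  and a_le_0: "i \<noteq> j \<Longrightarrow> a i j \<le> 0"
  and d_pos [simp]: "0 < d i"
  and d_a_sym: "int (d i) * a i j = int (d j) * a j i"
  using km by (auto simp: km_data_def gcm_def symmetrized_by_def)

lemma q_def: "q i = qq ^ d i"
  by (simp add: q_index_def)

lemma nonroot_q: "nonroot (q i)"
  by (simp add: q_def nonroot_qq_power)

sublocale vs: vector_space "cscale D"
  using km by (auto simp: km_data_def realization_def)

lemma emb_add: "emb D (h + h') = emb D h + emb D h'"
  using km by (auto simp: km_data_def coweight_lattice_def additive_def)

lemma emb_0: "emb D 0 = 0"
  using emb_add[of 0 0] by simp

lemma dual_linear: "f \<in> dual_space D \<Longrightarrow> f (x + y) = f x + f y"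
  "f \<in> dual_space D \<Longrightarrow> f (cscale D c x) = c * f x"
  by (auto simp: dual_space_def Vector_Spaces.linear_iff)

lemma dual_sum: "f \<in> dual_space D \<Longrightarrow> f (\<Sum>x\<in>A. g x) = (\<Sum>x\<in>A. f (g x))"
  using dual_linear(1)[of f] dual_linear(1)[of f 0 0]
  by (induction A rule: infinite_finite_induct) simp_all

lemma root_dual: "root D i \<in> dual_space D"
  using km by (auto simp: km_data_def realization_def)

lemma root_coroot: "root D j (emb D (coroot D i)) = of_int (a i j)"
  using km by (auto simp: km_data_def realization_def)

lemma root_weight: "root D i \<in> weight_lattice D"
proof -
  have "root D i (emb D h) \<in> \<int>" for h
  proof -
    have "emb D h \<in> range (emb D)" by simp
    then obtain m :: "'i + nat \<Rightarrow> int"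
      where m: "emb D h = (\<Sum>b\<in>lattice_index D. cscale D (of_int (m b)) (lattice_basis D b))"
      using km unfolding km_data_def coweight_lattice_def by blast
    have "root D i (lattice_basis D b) \<in> \<int>" if "b \<in> lattice_index D" for b
      using that km root_coroot
      by (auto simp: lattice_index_def lattice_basis_def km_data_def coweight_lattice_def)
    then show ?thesis
      unfolding m dual_sum[OF root_dual]
      by (intro Ints_sum) (auto simp: dual_linear[OF root_dual])
  qed
  then show ?thesis by (simp add: weight_lattice_def root_dual)
qed

lemma pairing_eq: "lam \<in> weight_lattice D \<Longrightarrow> of_int (pairing D h lam) = lam (emb D h)"
  by (auto simp: weight_lattice_def pairing_def elim!: Ints_cases)
    (metis Ints_cases Re_complex_of_real floor_of_int of_real_of_int_eq)

lemma pairing_add: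
  assumes "lam \<in> weight_lattice D"
  shows "pairing D (h + h') lam = pairing D h lam + pairing D h' lam"
proof -
  have "lam \<in> dual_space D" using assms by (simp add: weight_lattice_def)
  then have "(of_int (pairing D (h + h') lam) :: complex) = of_int (pairing D h lam + pairing D h' lam)"
    by (simp only: of_int_add pairing_eq[OF assms] emb_add dual_linear)
  then show ?thesis by (simp only: of_int_eq_iff)
qed

lemma pairing_0: "lam \<in> weight_lattice D \<Longrightarrow> pairing D 0 lam = 0"
  using pairing_add[of lam 0 0] by simp

lemma pairing_minus: "lam \<in> weight_lattice D \<Longrightarrow> pairing D (- h) lam = - pairing D h lam"
  using pairing_add[of lam h "- h"] pairing_0[of lam] by simp

lemma pairing_scaled_coroot:
  assumes "lam \<in> weight_lattice D"
  shows "pairing D (scaled_coroot D i) lam = int (d i) * pairing D (coroot D i) lam"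
proof -
  have "pairing D (\<Sum>k<n. coroot D i) lam = int n * pairing D (coroot D i) lam" for n
    by (induction n) (simp_all add: pairing_0[OF assms] pairing_add[OF assms] algebra_simps)
  then show ?thesis by (simp add: scaled_coroot_def)
qed

lemma alpha_coroot: "alpha (coroot D i) j = a i j"
proof -
  have "(of_int (alpha (coroot D i) j) :: complex) = of_int (a i j)"
    by (simp only: pairing_eq[OF root_weight] root_coroot)
  then show ?thesis by (simp only: of_int_eq_iff)
qed

text \<open>A combination of roots that vanishes on the lattice vanishes on its complex span, the
  whole Cartan subalgebra, and the simple roots are linearly independent. Hence weights can be
  indexed by coordinate vectors.\<close>

lemma alpha_separates:
  fixes \<nu> \<nu>' :: "'i \<Rightarrow> int"
  assumes "\<And>h. (\<Sum>j\<in>UNIV. \<nu> j * alpha h j) = (\<Sum>j\<in>UNIV. \<nu>' j * alpha h j)"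
  shows "\<nu> = \<nu>'"
proof -
  define c :: "'i \<Rightarrow> complex" where "c j = of_int (\<nu> j) - of_int (\<nu>' j)" for j
  let ?f = "\<lambda>x. \<Sum>j\<in>UNIV. c j * root D j x"
  have emb: "?f (emb D h) = 0" for h
  proof -
    have "?f (emb D h) = of_int ((\<Sum>j\<in>UNIV. \<nu> j * alpha h j) - (\<Sum>j\<in>UNIV. \<nu>' j * alpha h j))"
      by (simp add: c_def left_diff_distrib sum_subtractf pairing_eq[OF root_weight])
    then show ?thesis by (simp add: assms)
  qed
  have span: "vs.span (lattice_basis D ` lattice_index D) = UNIV"
    using km by (simp add: km_data_def coweight_lattice_def)
  have "?f x = 0" for x
  proof -
    have "x \<in> vs.span (lattice_basis D ` lattice_index D)" by (simp add: span)
    then show ?thesis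
    proof (induction rule: vs.span_induct_alt)
      case base
      show ?case using emb[of 0] by (simp add: emb_0)
    next
      case (step t x y)
      have "?f x = 0"
        using step(1) emb by (auto simp: lattice_basis_def split: sum.splits)
      moreover have "?f (cscale D t x + y) = t * ?f x + ?f y"
        by (simp add: dual_linear[OF root_dual] distrib_left sum.distrib sum_distrib_left mult_ac)
      ultimately show ?case using step(2) by simp
    qed
  qed
  then have "\<forall>i. c i = 0"
    using km unfolding km_data_def realization_def by metis
  then show ?thesis by (auto simp: c_def)
qed

end

text \<open>For a left ideal, the condition on relators says that it contains the two-sided ideal
  they generate, so the quotient by \<open>L\<close> is a cyclic module over the quantum
  group.\<close>

locale uq_ideal = km D
  for D :: "('i::finite, 'p::ab_group_add, 'h::ab_group_add) km_datum" +
  fixes L :: "('i, 'p) falg set"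
  assumes L_0: "0 \<in> L"
    and L_add: "x \<in> L \<Longrightarrow> y \<in> L \<Longrightarrow> x + y \<in> L"
    and L_mult: "x \<in> L \<Longrightarrow> y * x \<in> L"
    and L_relator: "r \<in> relators D \<Longrightarrow> r * x \<in> L"
begin

abbreviation E :: "'i \<Rightarrow> ('i, 'p) falg" where "E i \<equiv> gen (GE i)"
abbreviation F :: "'i \<Rightarrow> ('i, 'p) falg" where "F i \<equiv> gen (GF i)"
abbreviation K :: "'p \<Rightarrow> ('i, 'p) falg" where "K h \<equiv> gen (GK h)"

text \<open>A congruence for multiplication from the left only; this is why each commutation rule
  below carries an arbitrary right factor \<open>x\<close>.\<close>

definition eqv :: "('i, 'p) falg \<Rightarrow> ('i, 'p) falg \<Rightarrow> bool" (infix \<open>\<doteq>\<close> 50) where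
  "x \<doteq> y \<longleftrightarrow> x - y \<in> L"

lemma L_uminus: "x \<in> L \<Longrightarrow> - x \<in> L"
  using L_mult[of x "- 1"] by simp

lemma L_diff: "x \<in> L \<Longrightarrow> y \<in> L \<Longrightarrow> x - y \<in> L"
  using L_add[of x "- y"] L_uminus by simp

lemma L_sum: "(\<And>k. k \<in> A \<Longrightarrow> g k \<in> L) \<Longrightarrow> (\<Sum>k\<in>A. g k) \<in> L"
  by (induction A rule: infinite_finite_induct) (auto simp: L_0 L_add)

lemma L_scalar_iff: "c \<noteq> 0 \<Longrightarrow> scalar c * x \<in> L \<longleftrightarrow> x \<in> L"
  using L_mult[of x "scalar c"] L_mult[of "scalar c * x" "scalar (1 / c)"]
  by (auto simp flip: mult.assoc scalar_mult)

lemma eqv_refl [simp]: "x \<doteq> x"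
  by (simp add: eqv_def L_0)

lemma eqv_sym: "x \<doteq> y \<Longrightarrow> y \<doteq> x"
  using L_uminus[of "x - y"] by (simp add: eqv_def)

lemma eqv_trans [trans]: "x \<doteq> y \<Longrightarrow> y \<doteq> z \<Longrightarrow> x \<doteq> z"
  using L_add[of "x - y" "y - z"] by (simp add: eqv_def)

lemma eqv_add: "x \<doteq> y \<Longrightarrow> x' \<doteq> y' \<Longrightarrow> x + x' \<doteq> y + y'"
  using L_add[of "x - y" "x' - y'"] by (simp add: eqv_def algebra_simps)

lemma eqv_diff: "x \<doteq> y \<Longrightarrow> x' \<doteq> y' \<Longrightarrow> x - x' \<doteq> y - y'"
  using L_diff[of "x - y" "x' - y'"] by (simp add: eqv_def algebra_simps)

lemma eqv_mult: "x \<doteq> y \<Longrightarrow> z * x \<doteq> z * y"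
  using L_mult[of "x - y" z] by (simp add: eqv_def algebra_simps)

lemma eqv_sum: "(\<And>k. k \<in> A \<Longrightarrow> f k \<doteq> g k) \<Longrightarrow> (\<Sum>k\<in>A. f k) \<doteq> (\<Sum>k\<in>A. g k)"
  using L_sum[of A "\<lambda>k. f k - g k"] by (simp add: eqv_def sum_subtractf)

lemma eqv_mem: "x \<doteq> y \<Longrightarrow> x \<in> L \<longleftrightarrow> y \<in> L"
  using L_add[of "x - y" y] L_diff[of x "x - y"] by (auto simp: eqv_def)

lemma eqv_0_iff: "x \<doteq> 0 \<longleftrightarrow> x \<in> L"
  by (simp add: eqv_def)

lemma relator_eqv: "x - y \<in> relators D \<Longrightarrow> x * z \<doteq> y * z"
  using L_relator[of "x - y" z] by (simp add: eqv_def algebra_simps)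

lemma K_0: "K 0 * x \<doteq> x"
  using relator_eqv[OF K_zero, of x] by simp

lemma K_add: "K (h + h') * x \<doteq> K h * (K h' * x)"
  using relator_eqv[OF relators.K_add, of h h' x] by (simp add: mult.assoc)

lemma K_cancel: "K (- h) * (K h * x) \<doteq> x"
  using eqv_trans[OF eqv_sym[OF K_add, of "- h" h x]] K_0[of x] by simp

lemma K_E: "K h * (E i * x) \<doteq> scalar (qq powi alpha h i) * (E i * (K h * x))"
proof -
  \<comment> \<open>The relator describes conjugation by q^h. Inserting q^(-h) q^h in front of
    \<open>x\<close> turns it into a commutation rule.\<close>
  have "K h * (E i * x) \<doteq> K h * (E i * (K (- h) * (K h * x)))"
    by (intro eqv_mult eqv_sym[OF K_cancel])
  also have "\<dots> = (K h * E i * K (- h)) * (K h * x)"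
    by (simp only: mult.assoc)
  also have "\<dots> \<doteq> (scalar (qq powi alpha h i) * E i) * (K h * x)"
    by (rule relator_eqv[OF relators.K_E])
  finally show ?thesis by (simp add: mult.assoc)
qed

lemma K_F: "K h * (F i * x) \<doteq> scalar (qq powi (- alpha h i)) * (F i * (K h * x))"
proof -
  have "K h * (F i * x) \<doteq> K h * (F i * (K (- h) * (K h * x)))"
    by (intro eqv_mult eqv_sym[OF K_cancel])
  also have "\<dots> = (K h * F i * K (- h)) * (K h * x)"
    by (simp only: mult.assoc)
  also have "\<dots> \<doteq> (scalar (qq powi (- alpha h i)) * F i) * (K h * x)"
    by (rule relator_eqv[OF relators.K_F])
  finally show ?thesis by (simp add: mult.assoc)
qed

definition H :: "'i \<Rightarrow> ('i, 'p) falg" where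
  "H i = scalar (1 / (q i - inverse (q i))) * (K (scaled_coroot D i) - K (- scaled_coroot D i))"

lemma E_F: "E i * (F j * x) \<doteq> F j * (E i * x) + (if i = j then H i * x else 0)"
proof -
  have "(E i * F j - F j * E i) * x \<doteq> (if i = j then H i else 0) * x"
    unfolding H_def by (rule relator_eqv[OF relators.E_F])
  then have "(E i * F j - F j * E i) * x + F j * (E i * x) \<doteq> (if i = j then H i else 0) * x + F j * (E i * x)"
    by (rule eqv_add) simp
  then show ?thesis by (simp add: algebra_simps split: if_splits)
qed

lemma E_F_commute: "i \<noteq> j \<Longrightarrow> E i * (F j * x) \<doteq> F j * (E i * x)"
  using E_F[of i j x] by simp

lemma serre_F_mem: "i \<noteq> j \<Longrightarrow> serre D F i j * x \<in> L"
  by (rule L_relator) (rule relators.serre_F)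

lemma left_idealI:
  assumes "0 \<in> T" and "\<And>x y. x \<in> T \<Longrightarrow> y \<in> T \<Longrightarrow> x + y \<in> T"
    and "\<And>c x. x \<in> T \<Longrightarrow> scalar c * x \<in> T" and "\<And>g x. x \<in> T \<Longrightarrow> gen g * x \<in> T"
  shows "\<forall>x\<in>T. y * x \<in> T"
proof (induction y rule: falg_induct)
  case (add y z)
  then show ?case by (simp add: distrib_right assms)
qed (simp_all add: mult.assoc assms)

section \<open>Local nilpotency of the f_i\<close>

definition nilp :: "'i \<Rightarrow> ('i, 'p) falg set" where
  "nilp i = {x. \<exists>n. F i ^ n * x \<in> L}"

lemma L_subset_nilp: "L \<subseteq> nilp i"
  by (auto simp: nilp_def intro!: exI[of _ 0])

lemma F_pow_mono:
  assumes "F i ^ n * x \<in> L" "n \<le> m" shows "F i ^ m * x \<in> L"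
proof -
  have "F i ^ m * x = F i ^ (m - n) * (F i ^ n * x)"
    using assms(2) by (simp flip: mult.assoc power_add)
  then show ?thesis using assms(1) by (simp add: L_mult)
qed

lemma K_F_pow: "K h * (F i ^ n * x) \<doteq> scalar (qq powi (- int n * alpha h i)) * (F i ^ n * (K h * x))"
proof (induction n)
  case (Suc n)
  let ?a = "qq powi (- alpha h i)" and ?b = "qq powi (- int n * alpha h i)"
  have "K h * (F i * (F i ^ n * x)) \<doteq> scalar ?a * (F i * (K h * (F i ^ n * x)))"
    by (rule K_F)
  also have "\<dots> \<doteq> scalar ?a * (F i * (scalar ?b * (F i ^ n * (K h * x))))"
    by (intro eqv_mult Suc)
  also have "\<dots> = scalar (?a * ?b) * (F i ^ Suc n * (K h * x))"
    by (simp add: gen_scalar scalar_mult mult.assoc)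
  also have "?a * ?b = qq powi (- int (Suc n) * alpha h i)"
    by (simp add: algebra_simps flip: power_int_add)
  finally show ?case by (simp add: mult.assoc)
qed simp

lemma F_pow_K: "F i ^ n * x \<in> L \<Longrightarrow> F i ^ n * (K h * x) \<in> L"
  using K_F_pow[of h i n x] L_mult[of "F i ^ n * x" "K h"] by (simp add: eqv_mem L_scalar_iff)

lemma F_pow_H: "F i ^ n * x \<in> L \<Longrightarrow> F i ^ n * (H j * x) \<in> L"
  by (simp add: H_def gen_scalar left_diff_distrib right_diff_distrib mult.assoc L_mult L_diff F_pow_K)

text \<open>Commuting e_i with one f_i leaves \<open>F i * x\<close>, whose nilpotency degree is one
  lower, and a Cartan term, which the old power still kills because q^h commutes with powers of f_i
  up to scalars. One extra f_i therefore suffices.\<close>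

lemma F_pow_E_same: "F i ^ n * x \<in> L \<Longrightarrow> F i ^ Suc n * (E i * x) \<in> L"
proof (induction n arbitrary: x)
  case 0
  then show ?case by (simp add: L_mult)
next
  case (Suc n)
  have "F i * (E i * x) \<doteq> E i * (F i * x) - H i * x"
    using eqv_diff[OF eqv_sym[OF E_F[of i i x]] eqv_refl[of "H i * x"]] by simp
  then have "F i ^ Suc n * (F i * (E i * x)) \<doteq> F i ^ Suc n * (E i * (F i * x) - H i * x)"
    by (rule eqv_mult)
  moreover have "F i ^ Suc n * (E i * (F i * x)) \<in> L"
    by (rule Suc.IH) (use Suc.prems in \<open>simp only: power_Suc2 mult.assoc\<close>)
  moreover have "F i ^ Suc n * (H i * x) \<in> L"
    by (rule F_pow_H) (rule Suc.prems)
  ultimately have "F i ^ Suc n * (F i * (E i * x)) \<in> L"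
    by (simp only: eqv_mem right_diff_distrib L_diff)
  then show ?case by (simp only: power_Suc2[of _ "Suc n"] mult.assoc)
qed

lemma F_pow_E_other: "i \<noteq> k \<Longrightarrow> F i ^ n * (E k * x) \<doteq> E k * (F i ^ n * x)"
proof (induction n)
  case (Suc n)
  have "F i * (F i ^ n * (E k * x)) \<doteq> F i * (E k * (F i ^ n * x))"
    by (intro eqv_mult Suc)
  also have "\<dots> \<doteq> E k * (F i * (F i ^ n * x))"
    by (rule eqv_sym, rule E_F_commute) (use Suc.prems in simp)
  finally show ?case by (simp add: mult.assoc)
qed simp

text \<open>The Serre relation rewrites \<open>f\<^sub>i\<^sup>m f\<^sub>j\<close> so that at least one \<open>f\<^sub>i\<close> stands to the right of
  \<open>f\<^sub>j\<close> in every term, which makes the induction on the nilpotency degree work.\<close>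

lemma F_pow_F_other:
  assumes "i \<noteq> j" "F i ^ n * x \<in> L"
  shows "F i ^ (nat (1 - a i j) * n) * (F j * x) \<in> L"
  using assms(2)
proof (induction n arbitrary: x)
  case 0
  then show ?case by (simp add: L_mult)
next
  case (Suc n)
  define m where "m = nat (1 - a i j)"
  define c where "c k = (- 1) ^ k * qbinom (q i) m k" for k
  \<comment> \<open>The prefactor is the exponent that the induction hypothesis supplies for the
    terms with k > 0; in the term k = 0 the exponents add up to m * (n + 1).\<close>
  define T where "T k = F i ^ (m * n) * (scalar (c k) * F i ^ (m - k) * F j * F i ^ k * x)" for k
  have "F i ^ (m * n) * (serre D F i j * x) \<in> L"
    by (intro L_mult serre_F_mem assms)
  then have "(\<Sum>k\<le>m. T k) \<in> L"
    unfolding T_def by (simp add: serre_def Let_def sum_distrib_right sum_distrib_left m_def c_def)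
  moreover have "T (Suc k) \<in> L" for k
  proof -
    have "T (Suc k) = scalar (c (Suc k)) * F i ^ (m - Suc k) * (F i ^ (m * n) * (F j * (F i ^ Suc k * x)))"
      unfolding T_def
      by (simp only: mult.assoc mult_scalar_left) (simp only: mult.assoc[symmetric] power_add[symmetric] add.commute)
    moreover have "F i ^ n * (F i ^ Suc k * x) = F i ^ k * (F i ^ Suc n * x)"
      by (simp only: mult.assoc[symmetric] power_add[symmetric]) (simp add: add.commute)
    then have "F i ^ (m * n) * (F j * (F i ^ Suc k * x)) \<in> L"
      unfolding m_def using Suc.prems by (intro Suc.IH) (metis L_mult)
    ultimately show ?thesis by (simp only: L_mult)
  qed
  then have "(\<Sum>k<m. T (Suc k)) \<in> L" by (intro L_sum)
  moreover have "(\<Sum>k\<le>m. T k) = T 0 + (\<Sum>k<m. T (Suc k))"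
    by (rule sum.atMost_shift)
  ultimately have "T 0 \<in> L"
    using L_diff[of "\<Sum>k\<le>m. T k" "\<Sum>k<m. T (Suc k)"] by simp
  moreover have "c 0 = 1"
    by (simp add: c_def nonroot_q)
  ultimately show ?case
    unfolding T_def m_def[symmetric] by (simp add: power_add mult.assoc add.commute[of m])
qed

lemma nilp_gen: "x \<in> nilp i \<Longrightarrow> gen g * x \<in> nilp i"
proof -
  assume "x \<in> nilp i"
  then obtain n where n: "F i ^ n * x \<in> L" by (auto simp: nilp_def)
  show "gen g * x \<in> nilp i"
  proof (cases g)
    case (GE k)
    have "F i ^ Suc n * (E k * x) \<in> L"
    proof (cases "k = i")
      case True
      then show ?thesis using F_pow_E_same[OF n] by simp
    next
      case False
      then have "F i ^ n * (E k * x) \<in> L"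
        using eqv_mem[OF F_pow_E_other[of i k n x]] L_mult[OF n] by blast
      then show ?thesis by (rule F_pow_mono) simp
    qed
    then show ?thesis unfolding nilp_def GE by blast
  next
    case (GF k)
    have "F i ^ n * (F i * x) = F i * (F i ^ n * x)"
      by (simp only: mult.assoc[symmetric] power_commutes)
    with n have "F i ^ n * (F i * x) \<in> L" by (simp add: L_mult)
    then show ?thesis
      using F_pow_F_other[OF _ n, of k] GF by (cases "k = i") (auto simp: nilp_def)
  next
    case (GK h)
    then show ?thesis using F_pow_K[OF n] by (auto simp: nilp_def)
  qed
qed

lemma uq_ideal_nilp: "uq_ideal D (nilp i)"
proof -
  have add: "x + y \<in> nilp i" if "x \<in> nilp i" "y \<in> nilp i" for x y
  proof -
    from that obtain m n where "F i ^ m * x \<in> L" "F i ^ n * y \<in> L" by (auto simp: nilp_def)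
    then have "F i ^ max m n * (x + y) \<in> L"
      by (simp add: distrib_left L_add F_pow_mono)
    then show ?thesis by (auto simp: nilp_def)
  qed
  have 0: "0 \<in> nilp i" using L_0 L_subset_nilp by blast
  have "\<forall>x\<in>nilp i. y * x \<in> nilp i" for y
  proof (rule left_idealI)
    fix c x assume "x \<in> nilp i"
    then obtain n where "F i ^ n * x \<in> L" by (auto simp: nilp_def)
    then have "F i ^ n * (scalar c * x) \<in> L"
      unfolding mult_scalar_left[of "F i ^ n"] by (rule L_mult)
    then show "scalar c * x \<in> nilp i" by (auto simp: nilp_def)
  qed (fact 0 | erule (1) add | erule nilp_gen)+
  then show ?thesis
    using 0 add L_relator L_subset_nilp by unfold_locales blast+
qed

text \<open>Nilpotency spreads from the highest weight vector: \<open>nilp i\<close> is a left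
  ideal, and the assumption puts 1 into it.\<close>

lemma nilp_UNIV:
  assumes "F i ^ n \<in> L" shows "\<exists>n. F i ^ n * x \<in> L"
proof -
  have "1 \<in> nilp i" using assms by (auto simp: nilp_def)
  then have "x * 1 \<in> nilp i" by (rule uq_ideal.L_mult[OF uq_ideal_nilp])
  then show ?thesis by (simp add: nilp_def)
qed

section \<open>Weight spaces modulo a left ideal\<close>

definition wspace :: "('p \<Rightarrow> kq) \<Rightarrow> ('i, 'p) falg set" where
  "wspace \<mu> = {x. \<forall>h. K h * x \<doteq> scalar (\<mu> h) * x}"

lemma wspaceD: "x \<in> wspace \<mu> \<Longrightarrow> K h * x \<doteq> scalar (\<mu> h) * x"
  by (simp add: wspace_def)

lemma wspace_0: "0 \<in> wspace \<mu>"
  by (simp add: wspace_def)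

lemma wspace_add: "x \<in> wspace \<mu> \<Longrightarrow> y \<in> wspace \<mu> \<Longrightarrow> x + y \<in> wspace \<mu>"
  by (auto simp: wspace_def distrib_left intro: eqv_add)

lemma wspace_scalar:
  assumes "x \<in> wspace \<mu>" shows "scalar c * x \<in> wspace \<mu>"
  unfolding wspace_def
proof safe
  fix h
  have "scalar c * (K h * x) \<doteq> scalar c * (scalar (\<mu> h) * x)"
    by (intro eqv_mult wspaceD assms)
  also have "scalar c * (scalar (\<mu> h) * x) = scalar (\<mu> h) * (scalar c * x)"
    by (rule mult_scalar_left)
  finally show "K h * (scalar c * x) \<doteq> scalar (\<mu> h) * (scalar c * x)"
    by (simp only: gen_scalar)
qed

lemma wspace_diff: "x \<in> wspace \<mu> \<Longrightarrow> y \<in> wspace \<mu> \<Longrightarrow> x - y \<in> wspace \<mu>"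
  by (auto simp: wspace_def right_diff_distrib intro: eqv_diff)

lemma wspace_sum: "(\<And>k. k \<in> A \<Longrightarrow> f k \<in> wspace \<mu>) \<Longrightarrow> (\<Sum>k\<in>A. f k) \<in> wspace \<mu>"
  by (induction A rule: infinite_finite_induct) (auto intro: wspace_0 wspace_add)

text \<open>Applying q^h - \<psi>(h), with \<open>h\<close> chosen to tell \<mu> from \<psi>,
  removes the \<psi> component and rescales the others, the \<mu> component by a nonzero
  factor.\<close>

lemma wspace_independent:
  assumes "finite S" "\<And>\<mu>. \<mu> \<in> S \<Longrightarrow> y \<mu> \<in> wspace \<mu>" "(\<Sum>\<mu>\<in>S. y \<mu>) \<in> L" "\<mu> \<in> S"
  shows "y \<mu> \<in> L"
  using assms
proof (induction S arbitrary: y \<mu> rule: finite_induct)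
  case (insert \<psi> S)
  have other: "y \<mu> \<in> L" if "\<mu> \<in> S" for \<mu>
  proof -
    from that insert.hyps have "\<mu> \<noteq> \<psi>" by auto
    then obtain h where h: "\<mu> h \<noteq> \<psi> h" by auto
    define z where "z \<phi> = scalar (\<phi> h - \<psi> h) * y \<phi>" for \<phi>
    have "K h * (\<Sum>\<phi>\<in>insert \<psi> S. y \<phi>) - scalar (\<psi> h) * (\<Sum>\<phi>\<in>insert \<psi> S. y \<phi>) \<in> L"
      by (intro L_diff L_mult insert.prems)
    moreover have "K h * (\<Sum>\<phi>\<in>insert \<psi> S. y \<phi>) - scalar (\<psi> h) * (\<Sum>\<phi>\<in>insert \<psi> S. y \<phi>)
        = (\<Sum>\<phi>\<in>insert \<psi> S. K h * y \<phi> - scalar (\<psi> h) * y \<phi>)"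
      by (simp add: sum_distrib_left sum_subtractf)
    moreover have "\<dots> \<doteq> (\<Sum>\<phi>\<in>insert \<psi> S. scalar (\<phi> h) * y \<phi> - scalar (\<psi> h) * y \<phi>)"
      by (intro eqv_sum eqv_diff eqv_refl wspaceD insert.prems)
    moreover have "(\<Sum>\<phi>\<in>insert \<psi> S. scalar (\<phi> h) * y \<phi> - scalar (\<psi> h) * y \<phi>) = (\<Sum>\<phi>\<in>S. z \<phi>)"
      using insert.hyps by (simp add: z_def scalar_diff left_diff_distrib)
    ultimately have "(\<Sum>\<phi>\<in>S. z \<phi>) \<in> L" by (simp add: eqv_mem)
    moreover have "z \<phi> \<in> wspace \<phi>" if "\<phi> \<in> S" for \<phi>
      unfolding z_def by (intro wspace_scalar insert.prems) (use that in simp)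
    ultimately have "z \<mu> \<in> L" using that insert.IH[of z \<mu>] by blast
    then show ?thesis using h by (simp add: z_def L_scalar_iff)
  qed
  then have "(\<Sum>\<phi>\<in>S. y \<phi>) \<in> L" by (intro L_sum)
  then have "y \<psi> \<in> L"
    using insert.prems(2) insert.hyps L_diff[of "y \<psi> + (\<Sum>\<phi>\<in>S. y \<phi>)" "\<Sum>\<phi>\<in>S. y \<phi>"] by simp
  with other insert.prems(3) show ?case by auto
qed simp

end

section \<open>Weight vectors modulo a highest weight ideal\<close>

lemma qnum_minus: "qnum x (- n) = - qnum x n"
  by (simp add: qnum_def minus_divide_left)

context uq_ideal
begin

text \<open>Kept abstract in \<open>A\<close> and \<open>B\<close> because it is used twice: for
  f-strings below a vector killed by e_i and for e-strings above a vector killed by f_i.\<close>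

lemma sl2_string:
  fixes A B u :: "('i, 'p) falg" and s :: "nat \<Rightarrow> kq"
  assumes "A * u \<in> L"
    and comm: "\<And>n. A * (B * (B ^ n * u)) \<doteq> B * (A * (B ^ n * u)) + scalar (s n) * (B ^ n * u)"
  shows "A * (B ^ Suc n * u) \<doteq> scalar (\<Sum>k\<le>n. s k) * (B ^ n * u)"
proof (induction n)
  case 0
  have "A * (B * u) \<doteq> B * (A * u) + scalar (s 0) * u"
    using comm[of 0] by simp
  also have "\<dots> \<doteq> 0 + scalar (s 0) * u"
    using assms(1) by (intro eqv_add) (simp_all add: eqv_0_iff L_mult)
  finally show ?case by simp
next
  case (Suc n)
  have "A * (B * (B ^ Suc n * u)) \<doteq> B * (A * (B ^ Suc n * u)) + scalar (s (Suc n)) * (B ^ Suc n * u)"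
    by (rule comm)
  also have "\<dots> \<doteq> B * (scalar (\<Sum>k\<le>n. s k) * (B ^ n * u)) + scalar (s (Suc n)) * (B ^ Suc n * u)"
    by (intro eqv_add eqv_mult Suc eqv_refl)
  also have "\<dots> = scalar (\<Sum>k\<le>Suc n. s k) * (B ^ Suc n * u)"
    by (simp add: mult_scalar_left[of B] scalar_add mult.assoc distrib_right)
  finally show ?case by (simp add: mult.assoc)
qed

end

text \<open>\<open>L\<close> may be the whole algebra. Properness is the separate condition
  \<open>1 \<notin> L\<close>, since for the Verma and parabolic ideals it is only known by
  inclusion into the ideal of a nonzero module.\<close>

locale hw_ideal = uq_ideal D L
  for D :: "('i::finite, 'p::ab_group_add, 'h::ab_group_add) km_datum"
    and L :: "('i, 'p) falg set" +
  fixes lam :: "'h \<Rightarrow> complex"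
  assumes lam: "lam \<in> weight_lattice D"
    and L_E: "E i \<in> L"
    and L_K: "K h - scalar (qq powi pairing D h lam) \<in> L"
begin

text \<open>The character of the weight \<lambda> minus the combination of simple roots with
  coefficients \<nu>. Integer coefficients let e_i act on any index; leaving the positive cone is
  then refuted by \<open>wts_nonneg\<close>.\<close>

definition chi :: "('i \<Rightarrow> int) \<Rightarrow> 'p \<Rightarrow> kq" where
  "chi \<nu> h = qq powi (pairing D h lam - (\<Sum>j\<in>UNIV. \<nu> j * alpha h j))"

definition wpair :: "'i \<Rightarrow> ('i \<Rightarrow> int) \<Rightarrow> int" where
  "wpair i \<nu> = pairing D (coroot D i) lam - (\<Sum>j\<in>UNIV. a i j * \<nu> j)"

abbreviation "W \<nu> \<equiv> wspace (chi \<nu>)"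

lemma sum_fun_upd:
  fixes \<nu> g :: "'i \<Rightarrow> int"
  shows "(\<Sum>j\<in>UNIV. (\<nu>(i := \<nu> i + c)) j * g j) = (\<Sum>j\<in>UNIV. \<nu> j * g j) + c * g i"
proof -
  have "(\<Sum>j\<in>UNIV. (\<nu>(i := \<nu> i + c)) j * g j) = (\<Sum>j\<in>UNIV. \<nu> j * g j + (if j = i then c * g i else 0))"
    by (intro sum.cong) (auto simp: algebra_simps)
  then show ?thesis by (simp add: sum.distrib)
qed

lemma chi_fun_upd: "chi (\<nu>(i := \<nu> i + c)) h = qq powi (- c * alpha h i) * chi \<nu> h"
proof -
  have "pairing D h lam - (\<Sum>j\<in>UNIV. (\<nu>(i := \<nu> i + c)) j * alpha h j) =
      - c * alpha h i + (pairing D h lam - (\<Sum>j\<in>UNIV. \<nu> j * alpha h j))"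
    using sum_fun_upd[of \<nu> i c "alpha h"] by linarith
  then show ?thesis unfolding chi_def by (simp only:) (subst power_int_add, simp_all)
qed

lemma wpair_fun_upd: "wpair i (\<nu>(i := \<nu> i + c)) = wpair i \<nu> - 2 * c"
  using sum_fun_upd[of \<nu> i c "a i"] by (simp add: wpair_def mult.commute)

lemma chi_inj: "chi \<nu> = chi \<nu>' \<Longrightarrow> \<nu> = \<nu>'"
proof (rule alpha_separates)
  fix h
  assume "chi \<nu> = chi \<nu>'"
  then have "chi \<nu> h = chi \<nu>' h" by simp
  moreover have "nonroot qq" using nonroot_qq_power[of 1] by simp
  ultimately show "(\<Sum>j\<in>UNIV. \<nu> j * alpha h j) = (\<Sum>j\<in>UNIV. \<nu>' j * alpha h j)"
    by (simp add: chi_def nonroot_powi_inj)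
qed

lemma chi_scaled_coroot:
  "chi \<nu> (scaled_coroot D i) = q i powi wpair i \<nu>"
  "chi \<nu> (- scaled_coroot D i) = q i powi (- wpair i \<nu>)"
proof -
  have "(\<Sum>j\<in>UNIV. \<nu> j * alpha (scaled_coroot D i) j) = int (d i) * (\<Sum>j\<in>UNIV. a i j * \<nu> j)"
    by (simp add: pairing_scaled_coroot[OF root_weight] alpha_coroot sum_distrib_left mult_ac)
  then have e: "pairing D (scaled_coroot D i) lam - (\<Sum>j\<in>UNIV. \<nu> j * alpha (scaled_coroot D i) j) = int (d i) * wpair i \<nu>"
    by (simp add: pairing_scaled_coroot[OF lam] wpair_def right_diff_distrib)
  then show "chi \<nu> (scaled_coroot D i) = q i powi wpair i \<nu>"
    by (simp add: chi_def q_def power_int_mult)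
  have "pairing D (- scaled_coroot D i) lam - (\<Sum>j\<in>UNIV. \<nu> j * alpha (- scaled_coroot D i) j) = int (d i) * (- wpair i \<nu>)"
    using e by (simp add: pairing_minus[OF lam] pairing_minus[OF root_weight] sum_negf)
  then show "chi \<nu> (- scaled_coroot D i) = q i powi (- wpair i \<nu>)"
    unfolding chi_def by (simp only: q_def power_int_mult power_int_of_nat)
qed

lemma one_W: "1 \<in> W (\<lambda>_. 0)"
  using L_K by (simp add: wspace_def chi_def eqv_def)

lemma W_shiftI:
  assumes "x \<in> W \<nu>" and "\<And>h. K h * (g * x) \<doteq> scalar (qq powi (- c * alpha h i)) * (g * (K h * x))"
  shows "g * x \<in> W (\<nu>(i := \<nu> i + c))"
  unfolding wspace_def
proof safe
  fix h
  have "K h * (g * x) \<doteq> scalar (qq powi (- c * alpha h i)) * (g * (K h * x))"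
    by (rule assms)
  also have "\<dots> \<doteq> scalar (qq powi (- c * alpha h i)) * (g * (scalar (chi \<nu> h) * x))"
    by (intro eqv_mult wspaceD assms)
  also have "\<dots> = scalar (chi (\<nu>(i := \<nu> i + c)) h) * (g * x)"
    unfolding chi_fun_upd by (simp only: scalar_mult mult.assoc) (simp only: mult_scalar_left[of g])
  finally show "K h * (g * x) \<doteq> scalar (chi (\<nu>(i := \<nu> i + c)) h) * (g * x)" .
qed

lemma W_F: "x \<in> W \<nu> \<Longrightarrow> F i * x \<in> W (\<nu>(i := \<nu> i + 1))"
  using K_F by (intro W_shiftI) simp_all

lemma W_E: "x \<in> W \<nu> \<Longrightarrow> E i * x \<in> W (\<nu>(i := \<nu> i - 1))"
  using W_shiftI[of x \<nu> "E i" "- 1" i] K_E by simp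

lemma W_F_pow: "x \<in> W \<nu> \<Longrightarrow> F i ^ n * x \<in> W (\<nu>(i := \<nu> i + int n))"
proof (induction n)
  case (Suc n)
  show ?case using W_F[OF Suc.IH[OF Suc.prems], of i]
    by (simp add: mult.assoc add_ac fun_upd_same del: fun_upd_apply)
qed simp

lemma W_E_pow: "x \<in> W \<nu> \<Longrightarrow> E i ^ n * x \<in> W (\<nu>(i := \<nu> i - int n))"
proof (induction n)
  case (Suc n)
  show ?case using W_E[OF Suc.IH[OF Suc.prems], of i]
    by (simp add: mult.assoc diff_diff_eq add.commute fun_upd_same del: fun_upd_apply)
qed simp

lemma H_W:
  assumes "x \<in> W \<nu>" shows "H i * x \<doteq> scalar (qnum (q i) (wpair i \<nu>)) * x"
proof -
  have "H i * x = scalar (1 / (q i - inverse (q i))) * (K (scaled_coroot D i) * x - K (- scaled_coroot D i) * x)"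
    by (simp add: H_def mult.assoc left_diff_distrib)
  also have "\<dots> \<doteq> scalar (1 / (q i - inverse (q i))) *
      (scalar (chi \<nu> (scaled_coroot D i)) * x - scalar (chi \<nu> (- scaled_coroot D i)) * x)"
    by (intro eqv_mult eqv_diff wspaceD assms)
  also have "\<dots> = scalar (qnum (q i) (wpair i \<nu>)) * x"
    unfolding chi_scaled_coroot qnum_def
    by (simp only: left_diff_distrib[symmetric] scalar_diff[symmetric] mult.assoc[symmetric] scalar_mult[symmetric]) simp
  finally show ?thesis .
qed

lemma E_F_W:
  "x \<in> W \<nu> \<Longrightarrow> E i * (F i * x) \<doteq> F i * (E i * x) + scalar (qnum (q i) (wpair i \<nu>)) * x"
  using eqv_trans[OF E_F[of i i x]] eqv_add[OF eqv_refl[of "F i * (E i * x)"] H_W[of x \<nu> i]] by simp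

lemma F_E_W:
  assumes "x \<in> W \<nu>"
  shows "F i * (E i * x) \<doteq> E i * (F i * x) + scalar (qnum (q i) (- wpair i \<nu>)) * x"
proof -
  let ?s = "scalar (qnum (q i) (wpair i \<nu>)) * x"
  have "F i * (E i * x) + ?s - ?s \<doteq> E i * (F i * x) - ?s"
    by (intro eqv_diff eqv_refl eqv_sym[OF E_F_W[OF assms, of i]])
  then show ?thesis by (simp only: qnum_minus scalar_minus mult_minus_left add_diff_cancel_right' add_uminus_conv_diff)
qed

lemma highest_string:
  assumes "u \<in> W \<nu>" "E i * u \<in> L"
  shows "E i * (F i ^ Suc n * u) \<doteq>
    scalar (qnum (q i) (int n + 1) * qnum (q i) (wpair i \<nu> - int n)) * (F i ^ n * u)"
  using sl2_string[OF assms(2), of "F i" "\<lambda>n. qnum (q i) (wpair i \<nu> - 2 * int n)" n]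
    E_F_W[OF W_F_pow[OF assms(1), where i = i], where i = i] by (simp add: wpair_fun_upd sum_qnum[OF nonroot_q])

lemma lowest_string:
  assumes "u \<in> W \<nu>" "F i * u \<in> L"
  shows "F i * (E i ^ Suc n * u) \<doteq>
    scalar (qnum (q i) (int n + 1) * qnum (q i) (- wpair i \<nu> - int n)) * (E i ^ n * u)"
proof -
  have "wpair i (\<nu>(i := \<nu> i - int n)) = wpair i \<nu> + 2 * int n" for n
    using wpair_fun_upd[of i \<nu> "- int n"] by simp
  then show ?thesis
    using sl2_string[OF assms(2), of "E i" "\<lambda>n. qnum (q i) (- wpair i \<nu> - 2 * int n)" n]
      F_E_W[OF W_E_pow[OF assms(1), where i = i], where i = i] by (simp add: sum_qnum[OF nonroot_q])
qed

text \<open>e_i undoes the last f_i up to the factor [n+1][pairing - n], which vanishes only if the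
  pairing equals n. The string cannot break off earlier.\<close>

lemma highest_string_notin:
  assumes "u \<in> W \<nu>" "E i * u \<in> L" "u \<notin> L" "\<And>k. k < n \<Longrightarrow> wpair i \<nu> \<noteq> int k"
  shows "F i ^ n * u \<notin> L"
  using assms(4)
proof (induction n)
  case (Suc n)
  have "qnum (q i) (int n + 1) * qnum (q i) (wpair i \<nu> - int n) \<noteq> 0"
    using Suc.prems[of n] by (simp add: qnum_eq_0_iff nonroot_q)
  moreover have "F i ^ n * u \<notin> L" using Suc by simp
  ultimately have "E i * (F i ^ Suc n * u) \<notin> L"
    using eqv_mem[OF highest_string[OF assms(1,2), of n]] L_scalar_iff by blast
  then show ?case using L_mult by blast
qed (use assms in simp)

lemma lowest_string_notin:
  assumes "u \<in> W \<nu>" "F i * u \<in> L" "u \<notin> L" "\<And>k. k < n \<Longrightarrow> - wpair i \<nu> \<noteq> int k"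
  shows "E i ^ n * u \<notin> L"
  using assms(4)
proof (induction n)
  case (Suc n)
  have "qnum (q i) (int n + 1) * qnum (q i) (- wpair i \<nu> - int n) \<noteq> 0"
    using Suc.prems[of n] by (simp add: qnum_eq_0_iff nonroot_q)
  moreover have "E i ^ n * u \<notin> L" using Suc by simp
  ultimately have "F i * (E i ^ Suc n * u) \<notin> L"
    using eqv_mem[OF lowest_string[OF assms(1,2), of n]] L_scalar_iff by blast
  then show ?case using L_mult by blast
qed (use assms in simp)

section \<open>Words in the f_i and what they span\<close>

definition fw :: "'i list \<Rightarrow> ('i, 'p) falg" where "fw w = prod_list (map F w)"

definition cnt :: "'i list \<Rightarrow> 'i \<Rightarrow> int" where "cnt w i = int (count_list w i)"

lemma fw_simps [simp]: "fw [] = 1" "fw (i # w) = F i * fw w" "fw (u @ w) = fw u * fw w"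
  by (simp_all add: fw_def)

lemma cnt_Nil: "cnt [] = (\<lambda>_. 0)"
  by (simp add: cnt_def fun_eq_iff)

lemma cnt_Cons: "cnt (i # w) = (cnt w)(i := cnt w i + 1)"
  by (auto simp: cnt_def fun_eq_iff)

lemma cnt_append: "cnt (u @ w) i = cnt u i + cnt w i"
  by (simp add: cnt_def)

lemma cnt_nonneg: "0 \<le> cnt w i"
  by (simp add: cnt_def)

lemma cnt_pos_iff: "0 < cnt w i \<longleftrightarrow> i \<in> set w"
  by (auto simp: cnt_def count_list_0_iff neq0_conv[symmetric] simp del: neq0_conv)

lemma cnt_eq_0_iff: "cnt w = (\<lambda>_. 0) \<longleftrightarrow> w = []"
  by (cases w) (auto simp: cnt_Nil fun_eq_iff cnt_def intro: exI[of _ "hd w"])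

lemma fw_W: "fw w \<in> W (cnt w)"
  by (induction w) (simp_all add: cnt_Nil one_W cnt_Cons W_F del: fun_upd_apply)

lemma fw_mult_W: "b \<in> W \<nu> \<Longrightarrow> \<exists>\<nu>'. fw w * b \<in> W \<nu>'"
  by (induction w) (auto simp: mult.assoc dest: W_F)

text \<open>Modulo \<open>L\<close> this is the span of all f-words applied to \<open>B\<close>. The
  rule \<open>in_L\<close> makes the set invariant under congruence modulo \<open>L\<close>.\<close>

inductive_set fspan :: "('i, 'p) falg set \<Rightarrow> ('i, 'p) falg set" for B where
  in_L: "x \<in> L \<Longrightarrow> x \<in> fspan B"
| add: "x \<in> fspan B \<Longrightarrow> y \<in> fspan B \<Longrightarrow> x + y \<in> fspan B"
| scal: "x \<in> fspan B \<Longrightarrow> scalar c * x \<in> fspan B"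
| base: "b \<in> B \<Longrightarrow> fw w * b \<in> fspan B"

lemma fspan_eqv: "x \<doteq> y \<Longrightarrow> y \<in> fspan B \<Longrightarrow> x \<in> fspan B"
  using fspan.add[of y B "x - y"] fspan.in_L[of "x - y" B] by (simp add: eqv_def)

lemma fspan_F: "x \<in> fspan B \<Longrightarrow> F i * x \<in> fspan B"
proof (induction rule: fspan.induct)
  case (base b w)
  show ?case using fspan.base[OF base, of "i # w"] by (simp add: mult.assoc)
qed (simp_all add: L_mult gen_scalar distrib_left fspan.intros)

lemma fspan_K:
  assumes "\<And>b. b \<in> B \<Longrightarrow> \<exists>\<nu>. b \<in> W \<nu>" and "x \<in> fspan B"
  shows "K h * x \<in> fspan B"
  using assms(2)
proof (induction rule: fspan.induct)
  case (base b w)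
  then obtain \<nu> where "fw w * b \<in> W \<nu>" using assms(1) fw_mult_W by blast
  then show ?case using base by (blast intro: fspan_eqv fspan.intros dest: wspaceD)
qed (simp_all add: L_mult gen_scalar distrib_left fspan.intros)

lemma fspan_E:
  assumes "\<And>b. b \<in> B \<Longrightarrow> \<exists>\<nu>. b \<in> W \<nu>" "\<And>b i. b \<in> B \<Longrightarrow> E i * b \<in> fspan B" and "x \<in> fspan B"
  shows "E i * x \<in> fspan B"
  using assms(3)
proof (induction rule: fspan.induct)
  case (base b w)
  show ?case
  proof (induction w)
    case Nil
    show ?case using assms(2) base by simp
  next
    case (Cons j w)
    obtain \<nu> where \<nu>: "fw w * b \<in> W \<nu>" using assms(1) base fw_mult_W by blast
    have b: "fw w * b \<in> fspan B" by (rule fspan.base) (rule base)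
    show ?case
    proof (cases "i = j")
      case True
      have "F j * (E i * (fw w * b)) + scalar (qnum (q i) (wpair i \<nu>)) * (fw w * b) \<in> fspan B"
        by (intro fspan.intros(2,3) fspan_F Cons b)
      then show ?thesis using fspan_eqv[OF E_F_W[OF \<nu>, of i]] True by (simp add: mult.assoc)
    next
      case False
      then show ?thesis
        using fspan_eqv[OF E_F_commute fspan_F[OF Cons]] by (simp add: mult.assoc)
    qed
  qed
qed (simp_all add: L_mult gen_scalar distrib_left fspan.intros)

text \<open>The substitute for triangular decomposition: e_i and q^h move rightwards through an
  f-word until they meet \<open>B\<close>. With \<open>B = {1}\<close> it shows that f-words span
  everything, with \<open>B = {x}\<close> it treats singular vectors, and with the e-translates of
  one word it yields \<open>ew_recover\<close>.\<close>

lemma fspan_left_ideal: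
  assumes "\<And>b. b \<in> B \<Longrightarrow> \<exists>\<nu>. b \<in> W \<nu>" "\<And>b i. b \<in> B \<Longrightarrow> E i * b \<in> fspan B" and "x \<in> fspan B"
  shows "y * x \<in> fspan B"
proof -
  have "\<forall>x\<in>fspan B. y * x \<in> fspan B"
  proof (rule left_idealI)
    fix g x assume "x \<in> fspan B"
    then show "gen g * x \<in> fspan B"
      using fspan_E[OF assms(1,2)] fspan_F fspan_K[OF assms(1)] by (cases g) auto
  qed (auto intro: fspan.intros L_0)
  then show ?thesis using assms(3) by blast
qed

lemma fspan_one: "x \<in> fspan {1}"
proof -
  have "x * 1 \<in> fspan {1}"
    by (rule fspan_left_ideal) (use one_W L_E fspan.base[of 1 "{1}" "[]"] in \<open>auto intro: fspan.in_L\<close>)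
  then show ?thesis by simp
qed

lemma fspan_expand:
  assumes "x \<in> fspan B" "\<And>b. b \<in> B \<Longrightarrow> \<exists>w. b = fw w \<and> P w" "\<And>u w. P w \<Longrightarrow> P (u @ w)"
  shows "\<exists>T c. finite T \<and> (\<forall>w\<in>T. P w) \<and> x \<doteq> (\<Sum>w\<in>T. scalar (c w) * fw w)"
  using assms(1)
proof (induction rule: fspan.induct)
  case (in_L x)
  then show ?case by (intro exI[of _ "{}"]) (auto simp: eqv_0_iff)
next
  case (add x y)
  then obtain S b T c where S: "finite S" "\<forall>w\<in>S. P w" "x \<doteq> (\<Sum>w\<in>S. scalar (b w) * fw w)"
    and T: "finite T" "\<forall>w\<in>T. P w" "y \<doteq> (\<Sum>w\<in>T. scalar (c w) * fw w)"
    by blast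
  define e where "e w = (if w \<in> S then b w else 0) + (if w \<in> T then c w else 0)" for w
  have "(\<Sum>w\<in>S. scalar (b w) * fw w) = (\<Sum>w\<in>S \<union> T. scalar (if w \<in> S then b w else 0) * fw w)"
    using S(1) T(1) by (intro sum.mono_neutral_cong_left) auto
  moreover have "(\<Sum>w\<in>T. scalar (c w) * fw w) = (\<Sum>w\<in>S \<union> T. scalar (if w \<in> T then c w else 0) * fw w)"
    using S(1) T(1) by (intro sum.mono_neutral_cong_left) auto
  ultimately have "x + y \<doteq> (\<Sum>w\<in>S \<union> T. scalar (e w) * fw w)"
    using eqv_add[OF S(3) T(3)] by (simp add: e_def scalar_add distrib_right sum.distrib)
  then show ?case using S T by (intro exI[of _ "S \<union> T"] exI[of _ e]) auto
next
  case (scal x c)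
  then obtain T b where T: "finite T" "\<forall>w\<in>T. P w" "x \<doteq> (\<Sum>w\<in>T. scalar (b w) * fw w)"
    by blast
  have "scalar c * x \<doteq> (\<Sum>w\<in>T. scalar (c * b w) * fw w)"
    using eqv_mult[OF T(3), of "scalar c"] by (simp add: sum_distrib_left scalar_mult mult.assoc)
  then show ?case using T by (intro exI[of _ T] exI[of _ "\<lambda>w. c * b w"]) simp
next
  case (base b w)
  obtain u where "b = fw u" "P u" using assms(2)[OF base] by blast
  then show ?case using assms(3)[of u w]
    by (intro exI[of _ "{w @ u}"] exI[of _ "\<lambda>_. 1"]) simp
qed

text \<open>Group the expansion by characters and subtract \<open>x\<close> from the component of
  its own character. The result sums into \<open>L\<close>, so by independence each component lies
  in \<open>L\<close>.\<close>

lemma wspace_component: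
  assumes "finite T" "x \<doteq> (\<Sum>w\<in>T. scalar (c w) * fw w)" "x \<in> wspace \<mu>"
  shows "x \<doteq> (\<Sum>w\<in>{w \<in> T. chi (cnt w) = \<mu>}. scalar (c w) * fw w)"
proof -
  define Y where "Y \<psi> = (\<Sum>w\<in>{w \<in> T. chi (cnt w) = \<psi>}. scalar (c w) * fw w)" for \<psi>
  define S where "S = insert \<mu> ((\<lambda>w. chi (cnt w)) ` T)"
  define Z where "Z \<psi> = Y \<psi> - (if \<psi> = \<mu> then x else 0)" for \<psi>
  have S: "finite S" "\<mu> \<in> S" using assms(1) by (simp_all add: S_def)
  have Y: "Y \<psi> \<in> wspace \<psi>" for \<psi>
    unfolding Y_def by (intro wspace_sum wspace_scalar) (use fw_W in auto)
  have "(\<Sum>\<psi>\<in>S. Y \<psi>) = (\<Sum>w\<in>T. scalar (c w) * fw w)"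
    unfolding Y_def using assms(1) S by (intro sum.group) (auto simp: S_def)
  moreover have "(\<Sum>\<psi>\<in>S. Z \<psi>) = (\<Sum>\<psi>\<in>S. Y \<psi>) - x"
    using S by (simp add: Z_def sum_subtractf)
  ultimately have "(\<Sum>\<psi>\<in>S. Z \<psi>) \<in> L"
    using eqv_sym[OF assms(2)] by (simp add: eqv_def)
  moreover have "Z \<psi> \<in> wspace \<psi>" for \<psi>
    unfolding Z_def using Y assms(3) by (auto intro: wspace_diff)
  ultimately have "Z \<mu> \<in> L" using wspace_independent[of S Z \<mu>] S by blast
  then have "Y \<mu> \<doteq> x" by (simp add: Z_def eqv_def)
  then show ?thesis unfolding Y_def by (rule eqv_sym)
qed

lemma wspace_expand:
  assumes "x \<in> wspace \<mu>"
  shows "\<exists>T c. finite T \<and> (\<forall>w\<in>T. chi (cnt w) = \<mu>) \<and> x \<doteq> (\<Sum>w\<in>T. scalar (c w) * fw w)"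
proof -
  have "\<exists>T c. finite T \<and> (\<forall>w\<in>T. True) \<and> x \<doteq> (\<Sum>w\<in>T. scalar (c w) * fw w)"
    by (rule fspan_expand[OF fspan_one[of x]]) (auto intro: exI[of _ "[]"])
  then obtain T c where T: "finite T" "x \<doteq> (\<Sum>w\<in>T. scalar (c w) * fw w)"
    by (elim exE conjE)
  show ?thesis
    by (intro exI[of _ "{w \<in> T. chi (cnt w) = \<mu>}"] exI[of _ c] conjI wspace_component[OF T assms])
      (use T(1) in simp_all)
qed

text \<open>Weights are read off from words, in coordinates relative to the highest weight. Nothing
  is lost, because each weight vector is congruent to a combination of words of its weight
  (\<open>wspace_notin\<close>).\<close>

definition wts :: "('i \<Rightarrow> int) set" where
  "wts = {cnt w | w. fw w \<notin> L}"

lemma wspace_notin: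
  assumes "x \<in> wspace \<mu>" "x \<notin> L" shows "\<exists>\<nu>\<in>wts. \<mu> = chi \<nu>"
proof -
  obtain T c where T: "finite T" "\<forall>w\<in>T. chi (cnt w) = \<mu>" "x \<doteq> (\<Sum>w\<in>T. scalar (c w) * fw w)"
    using wspace_expand[OF assms(1)] by (elim exE conjE)
  have "(\<Sum>w\<in>T. scalar (c w) * fw w) \<notin> L" using eqv_mem[OF T(3)] assms(2) by simp
  moreover have "(\<Sum>w\<in>T. scalar (c w) * fw w) \<in> L" if "\<forall>w\<in>T. fw w \<in> L"
    using that by (intro L_sum L_mult) simp
  ultimately obtain w where "w \<in> T" "fw w \<notin> L" by blast
  then show ?thesis using T(2) by (auto simp: wts_def)
qed

lemma W_notin: "x \<in> W \<nu> \<Longrightarrow> x \<notin> L \<Longrightarrow> \<nu> \<in> wts"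
  using wspace_notin chi_inj by blast

lemma wts_obtain:
  assumes "\<nu> \<in> wts" obtains w where "cnt w = \<nu>" "fw w \<in> W \<nu>" "fw w \<notin> L"
  using assms fw_W by (auto simp: wts_def)

lemma wts_nonneg: "\<nu> \<in> wts \<Longrightarrow> 0 \<le> \<nu> i"
  by (auto simp: wts_def cnt_nonneg)

lemma W_zero:
  assumes "x \<in> W (\<lambda>_. 0)" shows "\<exists>c. x \<doteq> scalar c"
proof -
  obtain T c where T: "finite T" "\<forall>w\<in>T. chi (cnt w) = chi (\<lambda>_. 0)" "x \<doteq> (\<Sum>w\<in>T. scalar (c w) * fw w)"
    using wspace_expand[OF assms(1)] by (elim exE conjE)
  have "T \<subseteq> {[]}" using T(2) chi_inj cnt_eq_0_iff by blast
  then have "T = {} \<or> T = {[]}" by auto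
  then show ?thesis using T(3) scalar_0 by (auto intro: exI[of _ 0])
qed

text \<open>\<open>L\<close> together with everything of weight strictly below the highest one. For
  proper \<open>L\<close> the scalars are a complement, so membership tests whether the highest
  weight component vanishes.\<close>

definition fpos :: "('i, 'p) falg set" where
  "fpos = fspan (range F)"

lemma fw_fpos: "w \<noteq> [] \<Longrightarrow> fw w \<in> fpos"
  using fspan.base[of "F (last w)" "range F" "butlast w"] fw_simps(3)[of "butlast w" "[last w]"]
  by (simp add: fpos_def)

lemma fpos_scalar_sum: "(\<And>w. w \<in> T \<Longrightarrow> w \<noteq> []) \<Longrightarrow> (\<Sum>w\<in>T. scalar (c w) * fw w) \<in> fpos"
  by (induction T rule: infinite_finite_induct)
    (auto simp: fpos_def L_0 intro: fspan.in_L fspan.intros(2,3) fw_fpos[unfolded fpos_def])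

lemma fpos_intros:
  "x \<in> L \<Longrightarrow> x \<in> fpos" "x \<in> fpos \<Longrightarrow> y \<in> fpos \<Longrightarrow> x + y \<in> fpos" "x \<in> fpos \<Longrightarrow> scalar c * x \<in> fpos"
  "x \<doteq> y \<Longrightarrow> y \<in> fpos \<Longrightarrow> x \<in> fpos"
  unfolding fpos_def by (blast intro: fspan.intros fspan_eqv)+

lemma fpos_expand:
  assumes "x \<in> fpos"
  shows "\<exists>T c. finite T \<and> (\<forall>w\<in>T. w \<noteq> []) \<and> x \<doteq> (\<Sum>w\<in>T. scalar (c w) * fw w)"
proof (rule fspan_expand[OF assms[unfolded fpos_def], of "\<lambda>w. w \<noteq> []"])
  fix b assume "b \<in> range F"
  then obtain i where "b = F i" by blast
  then show "\<exists>w. b = fw w \<and> w \<noteq> []" by (intro exI[of _ "[i]"]) simp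
qed simp

lemma F_fpos: "F i * x \<in> fpos"
  using fspan_one[of x]
proof (induction rule: fspan.induct)
  case (base b w)
  then show ?case using fw_fpos[of "i # w"] by simp
qed (simp_all add: fpos_intros L_mult distrib_left gen_scalar)

lemma fw_mult_fpos: "w \<noteq> [] \<Longrightarrow> fw w * x \<in> fpos"
  by (cases w) (simp_all add: F_fpos mult.assoc)

lemma W_fpos:
  assumes "x \<in> W \<nu>" "\<nu> \<noteq> (\<lambda>_. 0)" shows "x \<in> fpos"
proof -
  obtain T c where T: "finite T" "\<forall>w\<in>T. chi (cnt w) = chi \<nu>" "x \<doteq> (\<Sum>w\<in>T. scalar (c w) * fw w)"
    using wspace_expand[OF assms(1)] by (elim exE conjE)
  have "w \<noteq> []" if "w \<in> T" for w using that T(2) assms(2) chi_inj cnt_Nil by metis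
  then show ?thesis using T(3) fpos_intros(4) fpos_scalar_sum by blast
qed

lemma fpos_complement: "\<exists>c. x - scalar c \<in> fpos"
  using fspan_one[of x]
proof (induction rule: fspan.induct)
  case (in_L x)
  then show ?case by (auto intro!: exI[of _ 0] fpos_intros)
next
  case (add x y)
  then obtain a b where "x - scalar a \<in> fpos" "y - scalar b \<in> fpos" by blast
  from fpos_intros(2)[OF this] show ?case
    by (intro exI[of _ "a + b"]) (simp add: scalar_add algebra_simps)
next
  case (scal x c)
  then obtain a where "x - scalar a \<in> fpos" by blast
  from fpos_intros(3)[OF this, of c] show ?case
    by (intro exI[of _ "c * a"]) (simp only: scalar_mult right_diff_distrib)
next
  case (base b w)
  show ?case
  proof (cases "w = []")
    case True
    then show ?thesis using base by (auto intro!: exI[of _ 1] fpos_intros L_0)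
  next
    case False
    then show ?thesis using base fw_fpos by (auto intro!: exI[of _ 0])
  qed
qed

text \<open>A scalar has the highest weight and nonempty words have other weights, so the relevant
  component of an expansion in nonempty words is an empty sum.\<close>

lemma scalar_fpos:
  assumes "scalar c \<in> fpos" shows "scalar c \<in> L"
proof -
  obtain T b where T: "finite T" "\<forall>w\<in>T. w \<noteq> []" "scalar c \<doteq> (\<Sum>w\<in>T. scalar (b w) * fw w)"
    using fpos_expand[OF assms] by (elim exE conjE)
  have "scalar c \<in> W (\<lambda>_. 0)" using wspace_scalar[OF one_W, of c] by simp
  from wspace_component[OF T(1,3) this]
  have "scalar c \<doteq> (\<Sum>w\<in>{w \<in> T. chi (cnt w) = chi (\<lambda>_. 0)}. scalar (b w) * fw w)" .
  moreover have "{w \<in> T. chi (cnt w) = chi (\<lambda>_. 0)} = {}"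
    using T(2) chi_inj cnt_eq_0_iff by blast
  ultimately have "scalar c \<doteq> 0" by simp
  then show ?thesis by (simp only: eqv_0_iff)
qed

lemma scalar_L_iff: "1 \<notin> L \<Longrightarrow> scalar c \<in> L \<longleftrightarrow> c = 0"
  using L_scalar_iff[of c 1] L_0 by (cases "c = 0") simp_all

end

section \<open>Comparing weights of highest weight ideals\<close>

context hw_ideal
begin

abbreviation "hwt i \<equiv> pairing D (coroot D i) lam"

lemma wpair_0: "wpair i (\<lambda>_. 0) = hwt i"
  by (simp add: wpair_def)

section \<open>Weights along sl(2)-strings\<close>

lemma last_power_notin:
  fixes g x :: "('i, 'p) falg"
  assumes "x \<notin> L" "g ^ n * x \<in> L"
  shows "\<exists>m. g ^ m * x \<notin> L \<and> g * (g ^ m * x) \<in> L"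
  using assms(2)
proof (induction n)
  case 0
  then show ?case using assms(1) by simp
next
  case (Suc n)
  then show ?case by (cases "g ^ n * x \<in> L") (auto simp: mult.assoc)
qed

lemma E_nilpotent:
  assumes "x \<in> W \<nu>" shows "\<exists>n. E i ^ n * x \<in> L"
proof (rule ccontr)
  \<comment> \<open>So many applications of e_i make the i-th coordinate negative.\<close>
  define n where "n = Suc (nat (\<nu> i))"
  assume "\<nexists>n. E i ^ n * x \<in> L"
  then have "\<nu>(i := \<nu> i - int n) \<in> wts"
    using W_notin[OF W_E_pow[OF assms]] by blast
  from wts_nonneg[OF this, of i] show False by (simp add: n_def split: if_splits)
qed

text \<open>Climb m steps with e_i to a surviving vector killed by e_i. The pairing has grown by 2m
  there, so the s + m steps down stay in the range where f_i does not vanish.\<close>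

lemma string_weights:
  assumes "\<nu> \<in> wts" "int s \<le> wpair i \<nu>"
  shows "\<nu>(i := \<nu> i + int s) \<in> wts"
proof -
  obtain w where x: "fw w \<in> W \<nu>" "fw w \<notin> L" using assms(1) by (rule wts_obtain)
  obtain m where m: "E i ^ m * fw w \<notin> L" "E i * (E i ^ m * fw w) \<in> L"
    using E_nilpotent[OF x(1)] last_power_notin[OF x(2)] by blast
  let ?u = "E i ^ m * fw w" and ?\<nu> = "\<nu>(i := \<nu> i - int m)"
  have u: "?u \<in> W ?\<nu>" by (rule W_E_pow[OF x(1)])
  have "wpair i ?\<nu> = wpair i \<nu> + 2 * int m"
    using wpair_fun_upd[of i \<nu> "- int m"] by simp
  then have "F i ^ (s + m) * ?u \<notin> L"
    using assms(2) by (intro highest_string_notin[OF u m(2,1)]) linarith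
  moreover have "F i ^ (s + m) * ?u \<in> W (?\<nu>(i := ?\<nu> i + int (s + m)))"
    by (rule W_F_pow[OF u])
  moreover have "?\<nu>(i := ?\<nu> i + int (s + m)) = \<nu>(i := \<nu> i + int s)"
    by auto
  ultimately show ?thesis using W_notin by metis
qed

text \<open>The mirror image of \<open>string_weights\<close>: nilpotency of f_i provides a vector
  killed by f_i, m steps down, and e_i climbs back from it past \<nu> to the reflected
  weight.\<close>

lemma reflect_weights:
  assumes "F i ^ n \<in> L" "\<nu> \<in> wts" "wpair i \<nu> \<le> 0"
  shows "\<nu>(i := \<nu> i + wpair i \<nu>) \<in> wts"
proof -
  obtain w where x: "fw w \<in> W \<nu>" "fw w \<notin> L" using assms(2) by (rule wts_obtain)
  obtain m where m: "F i ^ m * fw w \<notin> L" "F i * (F i ^ m * fw w) \<in> L"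
    using nilp_UNIV[OF assms(1), of "fw w"] last_power_notin[OF x(2)] by blast
  let ?u = "F i ^ m * fw w" and ?\<nu> = "\<nu>(i := \<nu> i + int m)"
  define p where "p = nat (- wpair i \<nu>)"
  have p: "int p = - wpair i \<nu>" using assms(3) by (simp add: p_def)
  have u: "?u \<in> W ?\<nu>" by (rule W_F_pow[OF x(1)])
  have "wpair i ?\<nu> = wpair i \<nu> - 2 * int m" by (rule wpair_fun_upd)
  then have "E i ^ (p + m) * ?u \<notin> L"
    using p by (intro lowest_string_notin[OF u m(2,1)]) linarith
  moreover have "E i ^ (p + m) * ?u \<in> W (?\<nu>(i := ?\<nu> i - int (p + m)))"
    by (rule W_E_pow[OF u])
  moreover have "?\<nu>(i := ?\<nu> i - int (p + m)) = \<nu>(i := \<nu> i + wpair i \<nu>)"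
    using p by auto
  ultimately show ?thesis using W_notin by metis
qed

lemma F_pow_notin: "1 \<notin> L \<Longrightarrow> hwt i < 0 \<Longrightarrow> F i ^ n \<notin> L"
  using highest_string_notin[OF one_W, of i n] L_E by (simp add: wpair_0)

lemma hwt_nonneg: "1 \<notin> L \<Longrightarrow> F i ^ n \<in> L \<Longrightarrow> 0 \<le> hwt i"
  using F_pow_notin by force

lemma E_F_pow_singular:
  assumes "0 \<le> hwt i"
  shows "E k * F i ^ Suc (nat (hwt i)) \<in> L"
proof (cases "k = i")
  case True
  have "E i * (F i ^ Suc (nat (hwt i)) * 1) \<doteq>
      scalar (qnum (q i) (int (nat (hwt i)) + 1) * qnum (q i) (wpair i (\<lambda>_. 0) - int (nat (hwt i)))) * (F i ^ nat (hwt i) * 1)"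
    by (rule highest_string[OF one_W]) (simp add: L_E)
  then show ?thesis
    using assms True by (simp add: wpair_0 eqv_0_iff)
next
  case False
  then have "F i ^ Suc (nat (hwt i)) * (E k * 1) \<doteq> E k * (F i ^ Suc (nat (hwt i)) * 1)"
    by (intro F_pow_E_other) simp
  moreover have "F i ^ Suc (nat (hwt i)) * (E k * 1) \<in> L"
    by (rule L_mult) (simp add: L_E)
  ultimately show ?thesis using eqv_mem by simp
qed

text \<open>The largest left ideal inside \<open>fpos\<close>, hence the kernel of the map onto the
  simple quotient when \<open>L\<close> is proper. This form avoids sums of submodules.\<close>

definition maxN :: "('i, 'p) falg set" where
  "maxN = {x. \<forall>y. y * x \<in> fpos}"

lemma L_subset_maxN: "L \<subseteq> maxN"
  by (auto simp: maxN_def intro: fpos_intros L_mult)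

lemma hw_ideal_maxN: "hw_ideal D maxN lam"
proof unfold_locales
  show "0 \<in> maxN" using L_subset_maxN L_0 by blast
  show "x + y \<in> maxN" if "x \<in> maxN" "y \<in> maxN" for x y
    using that by (auto simp: maxN_def distrib_left intro: fpos_intros)
  show "y * x \<in> maxN" if "x \<in> maxN" for x y
    using that by (auto simp: maxN_def simp flip: mult.assoc)
  show "r * x \<in> maxN" if "r \<in> relators D" for r x
    using that L_relator L_subset_maxN by blast
  show "E i \<in> maxN" for i using L_E L_subset_maxN by blast
  show "K h - scalar (qq powi pairing D h lam) \<in> maxN" for h
    using L_K L_subset_maxN by blast
qed (rule lam)

lemma one_maxN: "1 \<notin> L \<Longrightarrow> 1 \<notin> maxN"
  using scalar_fpos[of 1] by (auto simp: maxN_def dest: spec[of _ 1])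

text \<open>For \<open>x \<in> T\<close>, the scalar part of \<open>y * x\<close> lies in
  \<open>T.fpos\<close>, hence in \<open>T\<close> by \<open>scalar_fpos\<close>, so it is 0 as
  \<open>T\<close> is proper. Thus every \<open>y * x\<close> lies in \<open>fpos\<close>.\<close>

lemma maxN_maximal:
  assumes "hw_ideal D T lam" "L \<subseteq> T" "1 \<notin> T"
  shows "T \<subseteq> maxN"
proof
  interpret T: hw_ideal D T lam by fact
  have fpos: "z \<in> T.fpos" if "z \<in> fpos" for z
    using that unfolding fpos_def T.fpos_def
  proof (induction rule: fspan.induct)
    case (in_L x)
    then show ?case using assms(2) by (intro T.fspan.in_L) blast
  qed (auto intro: T.fspan.intros)
  fix x assume x: "x \<in> T"
  have "y * x \<in> fpos" for y
  proof -
    obtain c where c: "y * x - scalar c \<in> fpos" using fpos_complement by blast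
    have "scalar c = y * x + scalar (- 1) * (y * x - scalar c)"
      by (simp add: scalar_minus)
    moreover have "y * x + scalar (- 1) * (y * x - scalar c) \<in> T.fpos"
      by (rule T.fpos_intros(2)[OF T.fpos_intros(1)[OF T.L_mult[OF x]] T.fpos_intros(3)[OF fpos[OF c]]])
    ultimately have "scalar c \<in> T" using T.scalar_fpos by metis
    then have "c = 0" using T.scalar_L_iff[OF assms(3)] by blast
    with c show ?thesis by simp
  qed
  then show "x \<in> maxN" by (simp add: maxN_def)
qed

text \<open>By \<open>fspan_left_ideal\<close> a singular vector generates only f-words applied to
  itself, and below the top these never reach the highest weight.\<close>

lemma singular_maxN:
  assumes "x \<in> W \<nu>" "\<nu> \<noteq> (\<lambda>_. 0)" "\<And>k. E k * x \<in> L"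
  shows "x \<in> maxN"
proof -
  have x: "x \<in> fspan {x}" using fspan.base[of x "{x}" "[]"] by simp
  have "y * x \<in> fspan {x}" for y
    by (rule fspan_left_ideal[OF _ _ x]) (use assms in \<open>auto intro: fspan.in_L\<close>)
  moreover have "z \<in> fpos" if "z \<in> fspan {x}" for z
    using that
  proof (induction rule: fspan.induct)
    case (base b w)
    then show ?case using W_fpos[OF assms(1,2)] fw_mult_fpos by (cases "w = []") auto
  qed (auto intro: fpos_intros)
  ultimately show ?thesis by (auto simp: maxN_def)
qed

lemma F_pow_maxN:
  assumes "0 \<le> hwt i" shows "F i ^ Suc (nat (hwt i)) \<in> maxN"
proof (rule singular_maxN)
  show "F i ^ Suc (nat (hwt i)) \<in> W ((\<lambda>_. 0)(i := 0 + int (Suc (nat (hwt i)))))"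
    using W_F_pow[OF one_W, of i "Suc (nat (hwt i))"] by simp
  show "(\<lambda>_. 0)(i := 0 + int (Suc (nat (hwt i)))) \<noteq> (\<lambda>_. 0)"
    by (auto dest: fun_cong[of _ _ i])
qed (rule E_F_pow_singular[OF assms])

lemma nilpotent_maxN_iff:
  assumes "1 \<notin> L" shows "(\<exists>n. F i ^ n \<in> maxN) \<longleftrightarrow> 0 \<le> hwt i"
  using F_pow_maxN hw_ideal.hwt_nonneg[OF hw_ideal_maxN one_maxN[OF assms]] by blast

lemma fw_notin_maxN:
  assumes "1 \<notin> L" "\<And>j. j \<in> set w \<Longrightarrow> hwt j < 0"
  shows "fw w \<notin> maxN"
  using assms(2)
proof (induction w)
  case Nil
  then show ?case using one_maxN[OF assms(1)] by simp
next
  case (Cons j w)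
  interpret N: hw_ideal D maxN lam by (rule hw_ideal_maxN)
  have sub: "maxN \<subseteq> N.nilp j" by (rule N.L_subset_nilp)
  have "hw_ideal D (N.nilp j) lam"
    using N.uq_ideal_nilp[of j] lam N.L_E N.L_K sub
    unfolding hw_ideal_def hw_ideal_axioms_def by blast
  moreover have "1 \<notin> N.nilp j"
    using N.F_pow_notin[OF one_maxN[OF assms(1)], of j] Cons.prems by (simp add: N.nilp_def)
  ultimately have "N.nilp j \<subseteq> maxN"
    using L_subset_maxN sub by (intro maxN_maximal) blast+
  moreover have "fw w \<in> N.nilp j" if "F j * fw w \<in> maxN"
    using that by (auto simp: N.nilp_def intro: exI[of _ 1])
  ultimately show ?case using Cons by auto
qed

definition ew :: "'i list \<Rightarrow> ('i, 'p) falg" where "ew w = prod_list (map E w)"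

lemma ew_simps [simp]: "ew [] = 1" "ew (i # w) = E i * ew w"
  by (simp_all add: ew_def)

lemma ew_W: "x \<in> W \<nu> \<Longrightarrow> ew u * x \<in> W (\<lambda>i. \<nu> i - cnt u i)"
proof (induction u)
  case (Cons i u)
  have "(\<lambda>j. \<nu> j - cnt u j)(i := \<nu> i - cnt u i - 1) = (\<lambda>j. \<nu> j - cnt (i # u) j)"
    by (auto simp: cnt_Cons)
  then show ?case using W_E[OF Cons.IH[OF Cons.prems], of i] by (simp add: mult.assoc)
qed (simp add: cnt_Nil)

text \<open>Some \<open>y * fw w\<close> has a highest weight component. It lies in the span of
  f-words applied to the vectors \<open>ew u * fw w\<close>, so one of these is itself outside
  \<open>fpos\<close>; it must then have the highest weight, which equates the contents of
  \<open>u\<close> and \<open>w\<close>. The highest weight space consists of scalars, so the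
  congruence holds modulo \<open>L\<close> and not just modulo \<open>maxN\<close>.\<close>

lemma ew_recover:
  assumes "fw w \<notin> maxN"
  shows "\<exists>u c. set u = set w \<and> c \<noteq> 0 \<and> ew u * fw w \<doteq> scalar c"
proof -
  define B where "B = range (\<lambda>u. ew u * fw w)"
  have "y * fw w \<in> fspan B" for y
  proof (rule fspan_left_ideal)
    show "\<exists>\<nu>. b \<in> W \<nu>" if "b \<in> B" for b
      using that ew_W[OF fw_W] by (auto simp: B_def)
    show "E i * b \<in> fspan B" if b: "b \<in> B" for b i
    proof -
      obtain u where "b = ew u * fw w" using b by (auto simp: B_def)
      then have "E i * b \<in> B" unfolding B_def by (intro range_eqI[of _ _ "i # u"]) (simp add: mult.assoc)
      from fspan.base[OF this, of "[]"] show ?thesis by simp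
    qed
    have "fw w \<in> B" unfolding B_def by (intro range_eqI[of _ _ "[]"]) simp
    from fspan.base[OF this, of "[]"] show "fw w \<in> fspan B" by simp
  qed
  moreover have "fspan B \<subseteq> fpos" if "B \<subseteq> fpos"
  proof
    fix z assume "z \<in> fspan B"
    then show "z \<in> fpos"
    proof (induction rule: fspan.induct)
      case (base b v)
      then show ?case using that fw_mult_fpos by (cases "v = []") auto
    qed (auto intro: fpos_intros)
  qed
  moreover obtain y where "y * fw w \<notin> fpos" using assms by (auto simp: maxN_def)
  ultimately obtain u where u: "ew u * fw w \<notin> fpos" unfolding B_def by blast
  have W: "ew u * fw w \<in> W (\<lambda>i. cnt w i - cnt u i)" by (rule ew_W[OF fw_W])
  then have z: "(\<lambda>i. cnt w i - cnt u i) = (\<lambda>_. 0)" using u W_fpos by blast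
  then have "cnt u i = cnt w i" for i by (metis right_minus_eq)
  then have "set u = set w" using cnt_pos_iff by (metis subsetI subset_antisym)
  moreover obtain c where c: "ew u * fw w \<doteq> scalar c" using W z W_zero by metis
  moreover have "c \<noteq> 0"
    using u c L_0 by (metis eqv_0_iff fpos_intros(1) scalar_0)
  ultimately show ?thesis by blast
qed

lemma E_fw_commute: "i \<notin> set u \<Longrightarrow> E i * (fw u * x) \<doteq> fw u * (E i * x)"
proof (induction u)
  case (Cons j u)
  then have "E i * (F j * (fw u * x)) \<doteq> F j * (E i * (fw u * x))" by (intro E_F_commute) simp
  also have "\<dots> \<doteq> F j * (fw u * (E i * x))" using Cons by (intro eqv_mult) simp
  finally show ?case by (simp add: mult.assoc)
qed simp

lemma ew_fw_commute: "set v \<inter> set u = {} \<Longrightarrow> ew v * (fw u * x) \<doteq> fw u * (ew v * x)"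
proof (induction v)
  case (Cons i v)
  have "E i * (ew v * (fw u * x)) \<doteq> E i * (fw u * (ew v * x))"
    using Cons by (intro eqv_mult) simp
  also have "\<dots> \<doteq> fw u * (E i * (ew v * x))"
    using Cons.prems by (intro E_fw_commute) simp
  finally show ?case by (simp add: mult.assoc)
qed simp

lemma fw_append_notin:
  assumes "fw u \<notin> L" "fw w \<notin> maxN" "set u \<inter> set w = {}"
  shows "fw (u @ w) \<notin> L"
proof -
  obtain v c where v: "set v = set w" "c \<noteq> 0" "ew v * fw w \<doteq> scalar c"
    using ew_recover[OF assms(2)] by blast
  have "ew v * (fw u * fw w) \<doteq> fw u * (ew v * fw w)"
    using assms(3) v(1) by (intro ew_fw_commute) auto
  also have "\<dots> \<doteq> fw u * scalar c" by (intro eqv_mult v(3))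
  also have "fw u * scalar c = scalar c * fw u" by (rule scalar_commute[symmetric])
  finally have "ew v * (fw u * fw w) \<notin> L"
    using assms(1) v(2) by (simp add: eqv_mem L_scalar_iff)
  then show ?thesis using L_mult by auto
qed

lemma cnt_surj:
  assumes "\<And>i. 0 \<le> \<nu> i" shows "\<exists>w. cnt w = \<nu>"
  using assms
proof (induction "nat (\<Sum>i\<in>UNIV. \<nu> i)" arbitrary: \<nu>)
  case 0
  then have "(\<Sum>i\<in>UNIV. \<nu> i) = 0" by (simp add: order_antisym sum_nonneg)
  then have "\<nu> i = 0" for i using 0(2) by (simp add: sum_nonneg_eq_0_iff)
  then have "cnt [] = \<nu>" by (simp add: cnt_Nil fun_eq_iff)
  then show ?case by blast
next
  case (Suc n)
  have "\<exists>i. \<nu> i \<noteq> 0"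
  proof (rule ccontr)
    assume "\<nexists>i. \<nu> i \<noteq> 0"
    with Suc.hyps(2) show False by simp
  qed
  then obtain i where i: "0 < \<nu> i" using Suc.prems by (metis order_less_le)
  have "(\<Sum>j\<in>UNIV. (\<nu>(i := \<nu> i + (- 1))) j * 1) = (\<Sum>j\<in>UNIV. \<nu> j * 1) + (- 1) * 1"
    by (rule sum_fun_upd)
  then have "n = nat (\<Sum>j\<in>UNIV. (\<nu>(i := \<nu> i - 1)) j)"
    using Suc.hyps(2) by simp
  moreover have "0 \<le> (\<nu>(i := \<nu> i - 1)) j" for j using Suc.prems i by simp
  ultimately obtain w where "cnt w = \<nu>(i := \<nu> i - 1)" using Suc.hyps(1) by blast
  then have "cnt (i # w) = \<nu>" by (simp add: cnt_Cons)
  then show ?case by blast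
qed

section \<open>Weight cones and the transfer of weights\<close>

definition cone :: "'i set \<Rightarrow> ('i \<Rightarrow> int) set" where
  "cone J = {\<nu>. \<forall>i. 0 \<le> \<nu> i \<and> (i \<notin> J \<longrightarrow> \<nu> i = 0)}"

lemma cone_wts:
  assumes "1 \<notin> L" "cone J \<subseteq> wts"
  shows "cone (J \<union> {j. hwt j < 0}) \<subseteq> wts"
proof
  fix \<nu> assume \<nu>: "\<nu> \<in> cone (J \<union> {j. hwt j < 0})"
  have "(\<lambda>i. if i \<in> J then \<nu> i else 0) \<in> cone J" using \<nu> by (auto simp: cone_def)
  then obtain u where u: "cnt u = (\<lambda>i. if i \<in> J then \<nu> i else 0)" "fw u \<notin> L"
    using assms(2) wts_obtain by blast
  have "0 \<le> (if i \<in> J then 0 else \<nu> i)" for i using \<nu> by (simp add: cone_def)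
  then obtain w where w: "cnt w = (\<lambda>i. if i \<in> J then 0 else \<nu> i)"
    using cnt_surj[of "\<lambda>i. if i \<in> J then 0 else \<nu> i"] by blast
  have "set u \<subseteq> J" using u(1) cnt_pos_iff[of u] by (metis less_irrefl subsetI)
  moreover have "i \<notin> J \<and> hwt i < 0" if "i \<in> set w" for i
    using that \<nu> cnt_pos_iff[of w i] unfolding w cone_def by (auto split: if_splits)
  ultimately have "fw (u @ w) \<notin> L"
    using u(2) assms(1) by (intro fw_append_notin fw_notin_maxN) auto
  moreover have "cnt (u @ w) = \<nu>"
    by (rule ext) (simp add: cnt_append u w)
  ultimately show "\<nu> \<in> wts" by (auto simp: wts_def)
qed

lemma F_commute:
  assumes "i \<noteq> j" "a i j = 0" shows "F i * (F j * x) \<doteq> F j * (F i * x)"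
proof -
  have "serre D F i j = F i * F j - F j * F i"
    using assms(2) nonroot_q[of i] qbinom_self[of "q i" "Suc 0"]
    by (simp add: serre_def scalar_minus)
  then show ?thesis
    using serre_F_mem[OF assms(1), of x] by (simp add: eqv_def left_diff_distrib mult.assoc)
qed

text \<open>The last letter taken from \<open>T\<close> commutes with all letters to its right,
  since the Serre relation with a_ij = 0 is a commutator, and so reaches the highest weight vector,
  which it kills.\<close>

lemma fw_isolated_letters_mem:
  assumes "\<And>i. i \<in> T \<Longrightarrow> F i \<in> L" "\<exists>i\<in>T. i \<in> set w"
    and "\<And>i j. i \<in> T \<Longrightarrow> j \<in> set w \<Longrightarrow> j \<notin> T \<Longrightarrow> a i j = 0"
  shows "fw w \<in> L"
proof -
  obtain u i v where w: "w = u @ i # v" "i \<in> T" "\<And>j. j \<in> set v \<Longrightarrow> j \<notin> T"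
    using split_list_last_propE[of w "\<lambda>i. i \<in> T"] assms(2) by metis
  have "F i * fw v \<doteq> fw v * F i"
    using w(3) assms(3)[OF w(2)] unfolding w(1)
  proof (induction v)
    case (Cons j v)
    have "i \<noteq> j" using Cons.prems(1)[of j] w(2) by auto
    then have "F i * (F j * fw v) \<doteq> F j * (F i * fw v)"
      using Cons.prems by (intro F_commute) auto
    also have "\<dots> \<doteq> F j * (fw v * F i)" using Cons by (intro eqv_mult) auto
    finally show ?case by (simp add: mult.assoc)
  qed simp
  moreover have "fw v * F i \<in> L" by (intro L_mult assms(1) w(2))
  ultimately have "F i * fw v \<in> L" by (simp add: eqv_mem)
  then show ?thesis by (simp add: w(1) L_mult)
qed

text \<open>Choose \<open>\<gamma> \<le> \<nu>\<close> maximal in \<open>wts\<close> among those agreeing with \<open>\<nu>\<close> outside \<open>J\<close>. On the set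
  \<open>T\<close> where they differ, pairing \<open>\<nu> - \<gamma>\<close> with \<open>\<gamma>\<close> through the symmetrized Cartan matrix forces
  \<open>T\<close> to be orthogonal both to \<open>lam\<close> and to the rest of the support of \<open>\<nu>\<close>, so that the letters in
  \<open>T\<close> kill the highest weight vector. Hence \<open>T\<close> is empty.\<close>

lemma dominant_weight_transfer:
  assumes M: "hw_ideal D M lam" and nonneg: "\<And>i. i \<in> J \<Longrightarrow> 0 \<le> hwt i"
    and kill: "\<And>i. i \<in> J \<Longrightarrow> hwt i = 0 \<Longrightarrow> F i \<in> M"
    and cone: "cone (- J) \<subseteq> wts"
    and \<nu>: "\<nu> \<in> hw_ideal.wts M" and dominant: "\<And>i. i \<in> J \<Longrightarrow> 0 \<le> wpair i \<nu>"
  shows "\<nu> \<in> wts"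
proof -
  interpret M: hw_ideal D M lam by (rule M)
  \<comment> \<open>Competitors may differ from \<nu> only inside \<open>J\<close>. There is one:
    \<nu> with its coordinates in \<open>J\<close> replaced by 0 lies in
    \<open>cone (- J)\<close>.\<close>
  define P where "P \<gamma> \<longleftrightarrow> (\<forall>i. 0 \<le> \<gamma> i \<and> \<gamma> i \<le> \<nu> i \<and> (i \<notin> J \<longrightarrow> \<gamma> i = \<nu> i)) \<and> \<gamma> \<in> wts" for \<gamma>
  define ht where "ht \<gamma> = nat (\<Sum>i\<in>UNIV. \<gamma> i)" for \<gamma> :: "'i \<Rightarrow> int"
  have \<nu>_nonneg: "0 \<le> \<nu> i" for i by (rule M.wts_nonneg[OF \<nu>])
  have "(\<lambda>i. if i \<in> J then 0 else \<nu> i) \<in> wts"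
    using cone \<nu>_nonneg by (auto simp: cone_def)
  then have "P (\<lambda>i. if i \<in> J then 0 else \<nu> i)"
    using \<nu>_nonneg by (simp add: P_def)
  moreover have "\<forall>\<gamma>. P \<gamma> \<longrightarrow> ht \<gamma> < Suc (ht \<nu>)"
    by (auto simp: P_def ht_def less_Suc_eq_le intro!: nat_mono sum_mono)
  ultimately obtain \<gamma> where \<gamma>: "P \<gamma>" and max: "\<And>\<gamma>'. P \<gamma>' \<Longrightarrow> ht \<gamma>' \<le> ht \<gamma>"
    using ex_has_greatest_nat[of P _ ht] by blast
  have \<gamma>_nonneg: "0 \<le> \<gamma> i" and \<gamma>_le: "\<gamma> i \<le> \<nu> i" and \<gamma>_off: "i \<notin> J \<Longrightarrow> \<gamma> i = \<nu> i" for i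
    using \<gamma> by (auto simp: P_def)
  define T where "T = {i. \<gamma> i < \<nu> i}"
  have T_J: "i \<in> J" if "i \<in> T" for i using that \<gamma>_off[of i] by (auto simp: T_def)
  have off_T: "\<gamma> i = \<nu> i" if "i \<notin> T" for i using that \<gamma>_le[of i] by (simp add: T_def)
  \<comment> \<open>Otherwise \<open>string_weights\<close> would allow raising the i-th coordinate
    by one, still below \<nu>, against maximality.\<close>
  have \<gamma>_pair: "wpair i \<gamma> \<le> 0" if "i \<in> T" for i
  proof (rule ccontr)
    assume "\<not> wpair i \<gamma> \<le> 0"
    then have "\<gamma>(i := \<gamma> i + int 1) \<in> wts"
      using \<gamma> by (intro string_weights) (auto simp: P_def)
    then have "P (\<gamma>(i := \<gamma> i + 1))"
      using \<gamma> that T_J[OF that] by (auto simp: P_def T_def)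
    then have "ht (\<gamma>(i := \<gamma> i + 1)) \<le> ht \<gamma>" by (rule max)
    moreover have "(\<Sum>j\<in>UNIV. (\<gamma>(i := \<gamma> i + 1)) j * 1) = (\<Sum>j\<in>UNIV. \<gamma> j * 1) + 1 * 1"
      by (rule sum_fun_upd)
    moreover have "0 \<le> (\<Sum>j\<in>UNIV. \<gamma> j)" by (intro sum_nonneg \<gamma>_nonneg)
    ultimately show False by (simp add: ht_def del: fun_upd_apply)
  qed
  define x where "x j = \<nu> j - \<gamma> j" for j
  \<comment> \<open>Off-diagonal entries are nonpositive, so cutting \<gamma> down to
    \<open>T\<close> can only raise A \<gamma> on \<open>T\<close>. The excess measures the links
    between \<open>T\<close> and the rest of the support.\<close>
  define y where "y j = (if j \<in> T then \<gamma> j else 0)" for j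
  have x_off: "x j = 0" if "j \<notin> T" for j using off_T[OF that] by (simp add: x_def)
  have x_pos: "0 < x j" if "j \<in> T" for j using that by (simp add: x_def T_def)
  have y_nonneg: "0 \<le> y j" for j using \<gamma>_nonneg by (simp add: y_def)
  define Ax where "Ax i = (\<Sum>j\<in>UNIV. a i j * x j)" for i
  define Ay where "Ay i = (\<Sum>j\<in>UNIV. a i j * y j)" for i
  have Ax: "Ax i \<le> 0" if "i \<in> T" for i
  proof -
    have "Ax i = wpair i \<gamma> - wpair i \<nu>"
      by (simp add: Ax_def x_def wpair_def right_diff_distrib sum_subtractf)
    then show ?thesis using \<gamma>_pair[OF that] dominant[OF T_J[OF that]] by simp
  qed
  have Ay_eq: "Ay i = (\<Sum>j\<in>UNIV. a i j * \<gamma> j) + (\<Sum>j\<in>- T. - a i j * \<gamma> j)" for i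
  proof -
    have "Ay i = (\<Sum>j\<in>UNIV. a i j * \<gamma> j + (if j \<in> - T then - a i j * \<gamma> j else 0))"
      unfolding Ay_def by (intro sum.cong) (auto simp: y_def)
    then show ?thesis by (simp add: sum.distrib flip: sum.inter_filter Compl_eq)
  qed
  have rest: "0 \<le> - a i j * \<gamma> j" if "i \<in> T" "j \<in> - T" for i j
  proof -
    have "a i j \<le> 0" using that by (intro a_le_0) auto
    then show ?thesis using \<gamma>_nonneg[of j] by (simp add: mult_nonpos_nonneg)
  qed
  have Ay: "hwt i + (\<Sum>j\<in>- T. - a i j * \<gamma> j) \<le> Ay i" if "i \<in> T" for i
    using \<gamma>_pair[OF that] by (simp add: Ay_eq wpair_def)
  have hw: "0 \<le> hwt i" if "i \<in> T" for i using nonneg[OF T_J[OF that]] .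
  have rest_sum: "0 \<le> (\<Sum>j\<in>- T. - a i j * \<gamma> j)" if "i \<in> T" for i
    using rest[OF that] by (rule sum_nonneg)
  have Ay_nonneg: "0 \<le> Ay i" if "i \<in> T" for i
    using Ay[OF that] hw[OF that] rest_sum[OF that] by linarith
  \<comment> \<open>The symmetric form of x and y is computed in both orders: x against A y is
    nonnegative, y against A x nonpositive. All terms vanish, and x > 0 on \<open>T\<close> leaves A
    y = 0 there.\<close>
  have "(\<Sum>i\<in>UNIV. int (d i) * x i * Ay i) = (\<Sum>i\<in>UNIV. \<Sum>j\<in>UNIV. (int (d i) * a i j) * x i * y j)"
    by (simp add: Ay_def sum_distrib_left mult_ac)
  also have "\<dots> = (\<Sum>j\<in>UNIV. \<Sum>i\<in>UNIV. (int (d j) * a j i) * x i * y j)"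
    by (subst sum.swap) (simp add: d_a_sym)
  also have "\<dots> = (\<Sum>j\<in>UNIV. int (d j) * y j * Ax j)"
    by (simp add: Ax_def sum_distrib_left mult_ac)
  also have "\<dots> \<le> 0"
  proof (rule sum_nonpos)
    fix j
    show "int (d j) * y j * Ax j \<le> 0"
      using Ax[of j] y_nonneg[of j] by (cases "j \<in> T") (auto simp: y_def mult_nonneg_nonpos)
  qed
  finally have le: "(\<Sum>i\<in>UNIV. int (d i) * x i * Ay i) \<le> 0" .
  have ge: "0 \<le> int (d i) * x i * Ay i" for i
  proof (cases "i \<in> T")
    case True
    then show ?thesis using Ay_nonneg[OF True] x_pos[OF True] by simp
  qed (simp add: x_off)
  have "0 \<le> (\<Sum>i\<in>UNIV. int (d i) * x i * Ay i)" by (rule sum_nonneg) (rule ge)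
  with le have "(\<Sum>i\<in>UNIV. int (d i) * x i * Ay i) = 0" by (rule order_antisym)
  then have "\<forall>i\<in>UNIV. int (d i) * x i * Ay i = 0"
    by (rule sum_nonneg_eq_0_iff[THEN iffD1, rotated 2]) (auto intro: ge)
  then have "int (d i) * x i * Ay i = 0" for i by simp
  moreover have "int (d i) * x i \<noteq> 0" if "i \<in> T" for i
    using x_pos[OF that] d_pos[of i] by simp
  ultimately have Ay_0: "Ay i = 0" if "i \<in> T" for i
    using that mult_eq_0_iff by blast
  have hw_0: "hwt i = 0" if "i \<in> T" for i
    using Ay[OF that] hw[OF that] rest_sum[OF that] Ay_0[OF that] by linarith
  have orth: "a i j * \<nu> j = 0" if "i \<in> T" "j \<notin> T" for i j
  proof -
    have "(\<Sum>j\<in>- T. - a i j * \<gamma> j) = 0"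
      using Ay[OF that(1)] hw[OF that(1)] rest_sum[OF that(1)] Ay_0[OF that(1)] by linarith
    then have "\<forall>j\<in>- T. - a i j * \<gamma> j = 0"
      by (rule sum_nonneg_eq_0_iff[THEN iffD1, rotated 2]) (simp, rule rest[OF that(1)])
    then show ?thesis using that(2) off_T[of j] by auto
  qed
  obtain w where w: "M.cnt w = \<nu>" "M.fw w \<notin> M" using \<nu> by (rule M.wts_obtain)
  have "T = {}"
  proof (rule ccontr)
    assume "T \<noteq> {}"
    then obtain i where i: "i \<in> T" by blast
    then have "0 < M.cnt w i" using \<gamma>_nonneg[of i] by (simp add: w T_def)
    then have "\<exists>i\<in>T. i \<in> set w" using i by (auto simp: cnt_pos_iff)
    moreover have "F i \<in> M" if "i \<in> T" for i using kill T_J hw_0 that by blast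
    moreover have "a i j = 0" if "i \<in> T" "j \<in> set w" "j \<notin> T" for i j
      using orth[OF that(1,3)] that(2) cnt_pos_iff[of w j] by (auto simp: w)
    ultimately have "M.fw w \<in> M" by (intro M.fw_isolated_letters_mem)
    with w(2) show False ..
  qed
  then have "\<gamma> = \<nu>" using off_T by auto
  then show ?thesis using \<gamma> by (simp add: P_def)
qed

text \<open>Induction on the height of \<nu>. A negative pairing with some i in \<open>J\<close>
  permits a reflection in \<open>M\<close>, where f_i is nilpotent, to smaller height; the way back
  is made in \<open>L\<close> along an sl(2)-string. Otherwise \<nu> is
  \<open>J\<close>-dominant.\<close>

theorem weight_transfer:
  assumes M: "hw_ideal D M lam"
    and nilpotent: "\<And>i. i \<in> J \<Longrightarrow> F i ^ Suc (nat (hwt i)) \<in> M"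
    and cone: "cone (- J) \<subseteq> wts"
  shows "hw_ideal.wts M \<subseteq> wts"
proof
  interpret M: hw_ideal D M lam by (rule M)
  fix \<nu> assume "\<nu> \<in> M.wts"
  then show "\<nu> \<in> wts"
  proof (induction "nat (\<Sum>i\<in>UNIV. \<nu> i)" arbitrary: \<nu> rule: less_induct)
    case less
    have one: "1 \<notin> M" using less.prems M.L_mult by (metis M.wts_obtain mult.right_neutral)
    have nonneg: "0 \<le> hwt i" if "i \<in> J" for i
      using nilpotent[OF that] by (rule M.hwt_nonneg[OF one])
    show ?case
    proof (cases "\<exists>i\<in>J. wpair i \<nu> < 0")
      case True
      then obtain i where i: "i \<in> J" "wpair i \<nu> < 0" by blast
      let ?\<nu> = "\<nu>(i := \<nu> i + wpair i \<nu>)"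
      have \<nu>': "?\<nu> \<in> M.wts"
        using M.reflect_weights[OF nilpotent[OF i(1)] less.prems] i(2) by simp
      have "(\<Sum>j\<in>UNIV. ?\<nu> j * 1) = (\<Sum>j\<in>UNIV. \<nu> j * 1) + wpair i \<nu> * 1"
        by (rule sum_fun_upd)
      moreover have "0 \<le> (\<Sum>j\<in>UNIV. ?\<nu> j)" by (intro sum_nonneg M.wts_nonneg[OF \<nu>'])
      ultimately have "nat (\<Sum>j\<in>UNIV. ?\<nu> j) < nat (\<Sum>j\<in>UNIV. \<nu> j)"
        using i(2) by (simp del: fun_upd_apply)
      then have "?\<nu> \<in> wts" using \<nu>' by (rule less.hyps)
      \<comment> \<open>The reflection negates the pairing, so the step back has exactly the
        admissible length.\<close>
      moreover have "int (nat (- wpair i \<nu>)) \<le> wpair i ?\<nu>"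
        using i(2) by (simp add: wpair_fun_upd del: fun_upd_apply)
      ultimately have "?\<nu>(i := ?\<nu> i + int (nat (- wpair i \<nu>))) \<in> wts"
        by (rule string_weights)
      moreover have "?\<nu>(i := ?\<nu> i + int (nat (- wpair i \<nu>))) = \<nu>"
        using i(2) by auto
      ultimately show ?thesis by metis
    next
      case False
      have "F i \<in> M" if "i \<in> J" "hwt i = 0" for i using nilpotent[OF that(1)] that(2) by simp
      with False less.prems show ?thesis
        by (intro dominant_weight_transfer[OF M nonneg _ cone]) (auto simp: not_less)
    qed
  qed
qed

end

section \<open>Quantum Serre elements and sl(2)\<close>

text \<open>The recursion for the coefficients in \<open>sl2_ladder\<close>: the second summand
  comes from moving a Cartan half past n factors.\<close>

lemma qint_Suc_shift:
  assumes "nonroot x"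
  shows "qint x n * x powi (1 - int n) + x powi (- 2 * int n) = qint x (Suc n) * x powi (- int n)"
proof -
  have x: "x \<noteq> 0" using assms by (simp add: nonroot_def)
  define y where "y = x ^ n"
  have y: "y \<noteq> 0" using x by (simp add: y_def)
  have e: "x powi (1 - int n) = x / y" "x powi (- 2 * int n) = 1 / (y * y)" "x powi (- int n) = 1 / y"
    using x by (simp_all add: y_def power_int_diff power_int_minus divide_simps power_int_mult
        power2_eq_square flip: power_mult power_add)
  have aux: "(y - inverse y) / d * (x / y) + 1 / (y * y) = (x * y - inverse (x * y)) / d * (1 / y)"
    if "d \<noteq> 0" "d = x - inverse x" for d
  proof -
    have "(y - inverse y) * (x / y) + 1 / (y * y) * d = (x * y - inverse (x * y)) * (1 / y)"
      unfolding that(2) using x y by (simp add: field_simps)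
    then have "((y - inverse y) * (x / y) + 1 / (y * y) * d) / d = (x * y - inverse (x * y)) * (1 / y) / d"
      by simp
    then show ?thesis using that(1) by (simp add: add_divide_distrib mult.commute)
  qed
  show ?thesis
    unfolding e using aux[OF nonroot_diff_inverse[OF assms] refl]
    by (simp add: qint_def y_def power_inverse)
qed

context scalar_map
begin

lemma skew_power:
  assumes "\<And>x. P * (A * x) = s c * (A * (P * x))"
  shows "P * (A ^ n * x) = s (c ^ n) * (A ^ n * (P * x))"
proof (induction n)
  case 0
  show ?case by (simp add: s_one)
next
  case (Suc n)
  have "P * (A ^ Suc n * x) = s c * (A * (P * (A ^ n * x)))"
    by (simp add: mult.assoc assms)
  also have "\<dots> = s c * (s (c ^ n) * (A * (A ^ n * (P * x))))"
    by (simp only: Suc s_left[of A])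
  finally show ?case by (simp add: s_mult mult.assoc)
qed

text \<open>With \<open>E\<close>, \<open>A\<close> for \<open>e\<^sub>i\<close>, \<open>f\<^sub>i\<close>, the elements \<open>P\<close> and \<open>M\<close> are the two summands of
  \<open>(K\<^sub>i - K\<^sub>i\<^sup>-\<^sup>1) / (q\<^sub>i - q\<^sub>i\<^sup>-\<^sup>1)\<close>.\<close>

lemma sl2_ladder:
  assumes Q: "nonroot Q"
    and EA: "\<And>x. E * (A * x) = A * (E * x) + P * x + M * x"
    and PA: "\<And>x. P * (A * x) = s (Q powi (- 2)) * (A * (P * x))"
    and MA: "\<And>x. M * (A * x) = s (inverse Q powi (- 2)) * (A * (M * x))"
  shows "E * (A ^ n * x) = A ^ n * (E * x) + s (qint Q n * Q powi (1 - int n)) * (A ^ (n - 1) * (P * x))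
    + s (qint Q n * inverse Q powi (1 - int n)) * (A ^ (n - 1) * (M * x))"
proof (induction n)
  case 0
  show ?case by (simp add: qint_def s_zero)
next
  case (Suc n)
  have shift: "s (qint Q n * R powi (1 - int n)) * (A * (A ^ (n - 1) * y)) =
      s (qint Q n * R powi (1 - int n)) * (A ^ n * y)" for R y
  proof (cases n)
    case 0
    then show ?thesis by (simp add: qint_def s_zero)
  qed (simp add: mult.assoc)
  \<comment> \<open>Both Cartan halves obey the same recursion, the second with the inverse of
    \<open>Q\<close>; q-integers do not see the difference.\<close>
  have combine: "s (qint Q n * R powi (1 - int n)) * z + s ((R powi (- 2)) ^ n) * z = s (qint Q (Suc n) * R powi (- int n)) * z"
    if "R = Q \<or> R = inverse Q" for R z
  proof -
    have "qint R n * R powi (1 - int n) + R powi (- 2 * int n) = qint R (Suc n) * R powi (- int n)"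
      using that Q nonroot_inverse by (intro qint_Suc_shift) auto
    moreover have "qint R k = qint Q k" for k using that qint_inverse by auto
    moreover have "(R powi (- 2)) ^ n = R powi (- 2 * int n)"
      by (simp only: power_int_mult power_int_of_nat)
    ultimately show ?thesis by (simp only: s_add[symmetric] distrib_right[symmetric])
  qed
  have "E * (A ^ Suc n * x) = A * (E * (A ^ n * x)) + P * (A ^ n * x) + M * (A ^ n * x)"
    by (simp only: power_Suc mult.assoc EA)
  also have "A * (E * (A ^ n * x)) = A ^ Suc n * (E * x) + s (qint Q n * Q powi (1 - int n)) * (A ^ n * (P * x))
    + s (qint Q n * inverse Q powi (1 - int n)) * (A ^ n * (M * x))"
    by (simp only: Suc distrib_left s_left[of A] shift) (simp only: power_Suc mult.assoc)
  also have "P * (A ^ n * x) = s ((Q powi (- 2)) ^ n) * (A ^ n * (P * x))"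
    by (rule skew_power) (rule PA)
  also have "M * (A ^ n * x) = s ((inverse Q powi (- 2)) ^ n) * (A ^ n * (M * x))"
    by (rule skew_power) (rule MA)
  finally have "E * (A ^ Suc n * x) = A ^ Suc n * (E * x)
      + (s (qint Q n * Q powi (1 - int n)) * (A ^ n * (P * x)) + s ((Q powi (- 2)) ^ n) * (A ^ n * (P * x)))
      + (s (qint Q n * inverse Q powi (1 - int n)) * (A ^ n * (M * x)) + s ((inverse Q powi (- 2)) ^ n) * (A ^ n * (M * x)))"
    by (simp only: add.assoc add.left_commute add.commute)
  then show ?case by (simp add: combine)
qed

definition qserre :: "kq \<Rightarrow> nat \<Rightarrow> 'r \<Rightarrow> 'r \<Rightarrow> 'r" where
  "qserre Q m A B = (\<Sum>k\<le>m. s ((- 1) ^ k * qbinom Q m k) * A ^ (m - k) * B * A ^ k)"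

lemma qserre_mult:
  "qserre Q m A B * x = (\<Sum>k\<le>m. s ((- 1) ^ k * qbinom Q m k) * (A ^ (m - k) * (B * (A ^ k * x))))"
  by (simp add: qserre_def sum_distrib_right mult.assoc)

lemma mult_qserre:
  "E * (qserre Q m A B * x) = (\<Sum>k\<le>m. s ((- 1) ^ k * qbinom Q m k) * (E * (A ^ (m - k) * (B * (A ^ k * x)))))"
  by (simp add: qserre_mult sum_distrib_left s_left[of E])

lemma qserre_skew:
  assumes PA: "\<And>x. P * (A * x) = s c * (A * (P * x))" and PB: "\<And>x. P * (B * x) = s b * (B * (P * x))"
  shows "P * (qserre Q m A B * x) = s (c ^ m * b) * (qserre Q m A B * (P * x))"
proof -
  have "P * (A ^ (m - k) * (B * (A ^ k * x))) = s (c ^ m * b) * (A ^ (m - k) * (B * (A ^ k * (P * x))))"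
    if "k \<le> m" for k
  proof -
    have "P * (A ^ (m - k) * (B * (A ^ k * x))) =
        s (c ^ (m - k)) * (s b * (s (c ^ k) * (A ^ (m - k) * (B * (A ^ k * (P * x))))))"
      by (simp only: skew_power[OF PA] PB s_left[of B] s_left[of "A ^ (m - k)"])
    also have "\<dots> = s (c ^ (m - k) * b * c ^ k) * (A ^ (m - k) * (B * (A ^ k * (P * x))))"
      by (simp only: s_mult mult.assoc)
    also have "c ^ (m - k) * b * c ^ k = c ^ m * b"
      using that by (metis le_add_diff_inverse2 mult.assoc mult.commute power_add)
    finally show ?thesis .
  qed
  then have "P * (qserre Q m A B * x) = (\<Sum>k\<le>m. s ((- 1) ^ k * qbinom Q m k) *
      (s (c ^ m * b) * (A ^ (m - k) * (B * (A ^ k * (P * x))))))"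
    unfolding mult_qserre by (intro sum.cong refl) simp
  also have "\<dots> = s (c ^ m * b) * (qserre Q m A B * (P * x))"
    unfolding qserre_mult sum_distrib_left by (intro sum.cong refl s_left)
  finally show ?thesis .
qed

text \<open>e_i against the Serre element of (i, j). Each Cartan half passes the letters up to
  scalars, so the k-th summand contributes multiples of two neighbouring monomials
  \<open>U N (k - 1)\<close> and \<open>U N k\<close>. The alternating coefficients cancel these in
  pairs by \<open>qbinom_absorb\<close>; m = 1 - a makes the powers of q match.\<close>

lemma qserre_commute_left:
  assumes Q: "nonroot Q" and m: "int m = 1 - a"
    and EA: "\<And>x. E * (A * x) = A * (E * x) + P * x + M * x"
    and EB: "\<And>x. E * (B * x) = B * (E * x)"
    and PA: "\<And>x. P * (A * x) = s (Q powi (- 2)) * (A * (P * x))"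
    and MA: "\<And>x. M * (A * x) = s (inverse Q powi (- 2)) * (A * (M * x))"
    and PB: "\<And>x. P * (B * x) = s (Q powi (- a)) * (B * (P * x))"
    and MB: "\<And>x. M * (B * x) = s (inverse Q powi (- a)) * (B * (M * x))"
  shows "E * (qserre Q m A B * x) = qserre Q m A B * (E * x)"
proof -
  note ladder = sl2_ladder[OF Q EA PA MA]
  define c where "c k = (- 1) ^ k * qbinom Q m k" for k
  define U where "U N k = A ^ (m - Suc k) * (B * (A ^ k * (N * x)))" for N k
  \<comment> \<open>The truncated subtractions at k = 0 and k = m are harmless: the coefficient
    there is \<open>qint Q 0 = 0\<close>.\<close>
  define V where "V R N k = s (qint Q k * R powi (1 - int k)) * U N (k - 1) + s (qint Q (m - k) * R powi (- int k)) * U N k" for R N k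
  have part: "s (qint Q k * R powi (1 - int k)) * (A ^ (m - k) * (B * (A ^ (k - 1) * (N * x))))
      + s (qint Q (m - k) * R powi (1 - int (m - k))) * (A ^ (m - k - 1) * (N * (B * (A ^ k * x)))) = V R N k"
    if k: "k \<le> m" and R: "R \<noteq> 0" and NA: "\<And>x. N * (A * x) = s (R powi (- 2)) * (A * (N * x))"
      and NB: "\<And>x. N * (B * x) = s (R powi (- a)) * (B * (N * x))" for k R N
  proof -
    have "s (qint Q k * R powi (1 - int k)) * (A ^ (m - k) * (B * (A ^ (k - 1) * (N * x)))) =
      s (qint Q k * R powi (1 - int k)) * U N (k - 1)"
      by (cases k) (simp_all add: U_def qint_def s_zero)
    moreover have "A ^ (m - k - 1) * (N * (B * (A ^ k * x))) = s (R powi (- a)) * (s ((R powi (- 2)) ^ k) * U N k)"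
      by (simp only: skew_power[OF NA] NB s_left[of B] s_left[of "A ^ _"] U_def diff_Suc_eq_diff_pred diff_commute)
    moreover have "R powi (1 - int (m - k)) * (R powi (- a) * (R powi (- 2)) ^ k) = R powi (- int k)"
    proof -
      have "R powi (1 - int (m - k)) * (R powi (- a) * (R powi (- 2)) ^ k) =
          R powi ((1 - int (m - k)) + (- a + (- 2) * int k))"
        using R by (simp only: power_int_add power_int_mult power_int_of_nat simp_thms)
      also have "(1 - int (m - k)) + (- a + (- 2) * int k) = - int k"
        using k m by (simp add: of_nat_diff)
      finally show ?thesis .
    qed
    then have "s (qint Q (m - k) * R powi (1 - int (m - k))) * (s (R powi (- a)) * (s ((R powi (- 2)) ^ k) * U N k))
       = s (qint Q (m - k) * R powi (- int k)) * U N k"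
      by (simp only: mult.assoc[symmetric] s_mult[symmetric]) (simp only: mult.assoc)
    ultimately show ?thesis by (simp only: V_def)
  qed
  have cancel: "(\<Sum>k\<le>m. s (c k) * V R N k) = 0" for R N
  proof -
    have "(\<Sum>k\<le>m. s (c k) * V R N k) = (\<Sum>k\<le>m. s (c k * qint Q k * R powi (1 - int k)) * U N (k - 1))
      + (\<Sum>k\<le>m. s (c k * qint Q (m - k) * R powi (- int k)) * U N k)"
      by (simp add: V_def distrib_left sum.distrib s_mult mult.assoc)
    also have "(\<Sum>k\<le>m. s (c k * qint Q k * R powi (1 - int k)) * U N (k - 1)) =
        (\<Sum>k<m. s (c (Suc k) * qint Q (Suc k) * R powi (- int k)) * U N k)"
      by (subst sum.atMost_shift) (simp add: qint_def s_zero)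
    also have "(\<Sum>k\<le>m. s (c k * qint Q (m - k) * R powi (- int k)) * U N k) =
        (\<Sum>k<m. s (c k * qint Q (m - k) * R powi (- int k)) * U N k)"
      unfolding lessThan_Suc_atMost[symmetric] by (simp add: qint_def s_zero)
    also have "\<dots> = (\<Sum>k<m. - (s (c (Suc k) * qint Q (Suc k) * R powi (- int k)) * U N k))"
    proof (intro sum.cong refl)
      fix k assume "k \<in> {..<m}"
      then have "c k * qint Q (m - k) = - (c (Suc k) * qint Q (Suc k))"
        using qbinom_absorb[OF Q, of k m] by (simp add: c_def mult.assoc)
      then show "s (c k * qint Q (m - k) * R powi (- int k)) * U N k =
          - (s (c (Suc k) * qint Q (Suc k) * R powi (- int k)) * U N k)"
        by (simp add: s_minus)
    qed
    finally show ?thesis by (simp add: sum_negf)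
  qed
  have "E * (A ^ (m - k) * (B * (A ^ k * x))) = A ^ (m - k) * (B * (A ^ k * (E * x))) + (V Q P k + V (inverse Q) M k)"
    if k: "k \<le> m" for k
  proof -
    have Q0: "Q \<noteq> 0" "inverse Q \<noteq> 0" using Q by (simp_all add: nonroot_def)
    have "E * (A ^ (m - k) * (B * (A ^ k * x))) = A ^ (m - k) * (B * (E * (A ^ k * x)))
      + s (qint Q (m - k) * Q powi (1 - int (m - k))) * (A ^ (m - k - 1) * (P * (B * (A ^ k * x))))
      + s (qint Q (m - k) * inverse Q powi (1 - int (m - k))) * (A ^ (m - k - 1) * (M * (B * (A ^ k * x))))"
      unfolding ladder[of "m - k"] EB ..
    also have "A ^ (m - k) * (B * (E * (A ^ k * x))) = A ^ (m - k) * (B * (A ^ k * (E * x)))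
      + s (qint Q k * Q powi (1 - int k)) * (A ^ (m - k) * (B * (A ^ (k - 1) * (P * x))))
      + s (qint Q k * inverse Q powi (1 - int k)) * (A ^ (m - k) * (B * (A ^ (k - 1) * (M * x))))"
      unfolding ladder[of k] by (simp only: distrib_left s_left[of B] s_left[of "A ^ (m - k)"])
    finally show ?thesis
      unfolding part[OF k Q0(1) PA PB, symmetric] part[OF k Q0(2) MA MB, symmetric]
      by (simp only: add.assoc add.left_commute add.commute)
  qed
  then have "E * (qserre Q m A B * x) = (\<Sum>k\<le>m. s (c k) * (A ^ (m - k) * (B * (A ^ k * (E * x)))) + (s (c k) * V Q P k + s (c k) * V (inverse Q) M k))"
    unfolding mult_qserre c_def by (intro sum.cong refl) (simp add: distrib_left)
  then show ?thesis
    by (simp add: sum.distrib cancel) (simp add: qserre_mult c_def)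
qed

text \<open>e_j against the Serre element of (i, j). It meets only the single factor
  \<open>B\<close>, so all Cartan terms are multiples of \<open>A ^ m * (P * x)\<close> or
  \<open>A ^ m * (M * x)\<close>. Their coefficients are the alternating q-binomial sums at Q^(m-1)
  and its inverse, both zero.\<close>

lemma qserre_commute_right:
  assumes Q: "nonroot Q" and m: "int m = 1 - a" "a \<le> 0"
    and EA: "\<And>x. E * (A * x) = A * (E * x)"
    and EB: "\<And>x. E * (B * x) = B * (E * x) + P * x + M * x"
    and PA: "\<And>x. P * (A * x) = s (Q powi (- a)) * (A * (P * x))"
    and MA: "\<And>x. M * (A * x) = s (inverse Q powi (- a)) * (A * (M * x))"
  shows "E * (qserre Q m A B * x) = qserre Q m A B * (E * x)"
proof -
  define c where "c k = (- 1) ^ k * qbinom Q m k" for k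
  obtain l where "m = Suc l" using m by (cases m) auto
  then have l: "m = Suc l" "- a = int l" using m by simp_all
  have EAn: "E * (A ^ n * x) = A ^ n * (E * x)" for n x
    using skew_power[of E A 1] EA by (simp add: s_one)
  have part: "A ^ (m - k) * (N * (A ^ k * x)) = s ((R ^ l) ^ k) * (A ^ m * (N * x))"
    if "k \<le> m" and NA: "\<And>x. N * (A * x) = s (R powi (- a)) * (A * (N * x))" for k R N
  proof -
    have "A ^ (m - k) * (A ^ k * (N * x)) = A ^ m * (N * x)"
      using that(1) by (simp flip: mult.assoc power_add)
    then show ?thesis by (simp only: skew_power[OF NA] s_left[of "A ^ _"] l(2) power_int_of_nat)
  qed
  have "E * (A ^ (m - k) * (B * (A ^ k * x))) = A ^ (m - k) * (B * (A ^ k * (E * x)))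
      + s ((Q ^ l) ^ k) * (A ^ m * (P * x)) + s ((inverse Q ^ l) ^ k) * (A ^ m * (M * x))" if "k \<le> m" for k
    using part[OF that PA] part[OF that MA] by (simp only: EAn EB distrib_left)
  then have "E * (qserre Q m A B * x) = (\<Sum>k\<le>m. s (c k) * (A ^ (m - k) * (B * (A ^ k * (E * x))))
      + s (c k * (Q ^ l) ^ k) * (A ^ m * (P * x)) + s (c k * (inverse Q ^ l) ^ k) * (A ^ m * (M * x)))"
    unfolding mult_qserre c_def by (intro sum.cong refl) (simp add: distrib_left s_mult mult.assoc)
  also have "\<dots> = qserre Q m A B * (E * x) + s (\<Sum>k\<le>m. c k * (Q ^ l) ^ k) * (A ^ m * (P * x))
      + s (\<Sum>k\<le>m. c k * (inverse Q ^ l) ^ k) * (A ^ m * (M * x))"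
    by (simp add: sum.distrib qserre_mult c_def s_sum sum_distrib_right)
  finally show ?thesis
    unfolding c_def l(1) using qbinom_alternating_sum[OF Q, of l] qbinom_alternating_sum'[OF Q, of l]
    by (simp add: s_zero)
qed

lemma qserre_commute_other:
  assumes "\<And>x. E * (A * x) = A * (E * x)" "\<And>x. E * (B * x) = B * (E * x)"
  shows "E * (qserre Q m A B * x) = qserre Q m A B * (E * x)"
  using qserre_skew[of E A 1 B 1] assms by (simp add: s_one)

end

section \<open>A representation on functions of words\<close>

text \<open>These operators act from the right: the product \<open>f * g\<close> first applies \<open>f\<close>.\<close>

typedef 'i wop = "{f :: ('i list \<Rightarrow> kq) \<Rightarrow> 'i list \<Rightarrow> kq.
    (\<forall>\<phi> \<psi>. f (\<lambda>w. \<phi> w + \<psi> w) = (\<lambda>w. f \<phi> w + f \<psi> w)) \<and> (\<forall>c \<phi>. f (\<lambda>w. c * \<phi> w) = (\<lambda>w. c * f \<phi> w))}"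
  morphisms app Wop
  by (rule exI[of _ "\<lambda>\<phi>. \<phi>"]) simp

setup_lifting type_definition_wop

lemma app_add: "app f (\<lambda>w. \<phi> w + \<psi> w) = (\<lambda>w. app f \<phi> w + app f \<psi> w)"
  and app_scale: "app f (\<lambda>w. c * \<phi> w) = (\<lambda>w. c * app f \<phi> w)"
  using app[of f] by auto

lemma app_zero [simp]: "app f (\<lambda>w. 0) = (\<lambda>w. 0)"
  using app_scale[of f 0 "\<lambda>_. 0"] by simp

lemma wop_eqI: "(\<And>\<phi> w. app f \<phi> w = app g \<phi> w) \<Longrightarrow> f = g"
  by (metis app_inject ext)

instantiation wop :: (type) ring_1
begin

lift_definition zero_wop :: "'a wop" is "\<lambda>_ _. 0" by simp
lift_definition one_wop :: "'a wop" is "\<lambda>\<phi>. \<phi>" by simp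
lift_definition plus_wop :: "'a wop \<Rightarrow> 'a wop \<Rightarrow> 'a wop" is "\<lambda>f g \<phi> w. f \<phi> w + g \<phi> w"
  by (simp add: algebra_simps)
lift_definition minus_wop :: "'a wop \<Rightarrow> 'a wop \<Rightarrow> 'a wop" is "\<lambda>f g \<phi> w. f \<phi> w - g \<phi> w"
  by (simp add: algebra_simps)
lift_definition uminus_wop :: "'a wop \<Rightarrow> 'a wop" is "\<lambda>f \<phi> w. - f \<phi> w"
  by simp
lift_definition times_wop :: "'a wop \<Rightarrow> 'a wop \<Rightarrow> 'a wop" is "\<lambda>f g \<phi>. g (f \<phi>)"
  by simp

instance
proof
  show "(0 :: 'a wop) \<noteq> 1"
  proof
    assume "(0 :: 'a wop) = 1"
    then have "app (0 :: 'a wop) (\<lambda>_. 1) [] = app 1 (\<lambda>_. 1) []" by simp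
    then show False by (simp add: zero_wop.rep_eq one_wop.rep_eq)
  qed
qed (rule wop_eqI, simp add: zero_wop.rep_eq one_wop.rep_eq plus_wop.rep_eq minus_wop.rep_eq
    uminus_wop.rep_eq times_wop.rep_eq app_add)+

end

definition wscale :: "kq \<Rightarrow> 'i wop" where
  "wscale c = Wop (\<lambda>\<phi> w. c * \<phi> w)"

lemma app_wscale [simp]: "app (wscale c) \<phi> = (\<lambda>w. c * \<phi> w)"
  unfolding wscale_def by (subst Wop_inverse) (simp_all add: algebra_simps)

lemma app_simps [simp]:
  "app 0 \<phi> = (\<lambda>w. 0)" "app 1 \<phi> = \<phi>" "app (f + g) \<phi> = (\<lambda>w. app f \<phi> w + app g \<phi> w)"
  "app (f - g) \<phi> = (\<lambda>w. app f \<phi> w - app g \<phi> w)" "app (- f) \<phi> = (\<lambda>w. - app f \<phi> w)"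
  "app (f * g) \<phi> = app g (app f \<phi>)"
  by (simp_all add: zero_wop.rep_eq one_wop.rep_eq plus_wop.rep_eq minus_wop.rep_eq
      uminus_wop.rep_eq times_wop.rep_eq)

lemma app_sum: "app (\<Sum>k\<in>A. f k) \<phi> w = (\<Sum>k\<in>A. app (f k) \<phi> w)"
  by (induction A rule: infinite_finite_induct) simp_all

interpretation wscale: scalar_map "wscale :: kq \<Rightarrow> 'i wop"
  by unfold_locales (rule wop_eqI, simp add: algebra_simps app_scale)+

locale verma_rep = km D
  for D :: "('i::finite, 'p::ab_group_add, 'h::ab_group_add) km_datum" +
  fixes lam :: "'h \<Rightarrow> complex"
  assumes lam: "lam \<in> weight_lattice D"
begin

primrec wexp :: "'p \<Rightarrow> 'i list \<Rightarrow> int" where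
  "wexp h [] = pairing D h lam"
| "wexp h (j # w) = wexp h w - alpha h j"

definition ehw :: "'i \<Rightarrow> 'i list \<Rightarrow> kq" where
  "ehw i w = 1 / (q i - inverse (q i)) * (qq powi wexp (scaled_coroot D i) w - qq powi wexp (- scaled_coroot D i) w)"

text \<open>The value of \<phi> on e_i w, computed from e_i f_j = f_j e_i + \<delta>_ij H_i with e_i
  killing the empty word. So \<open>opE\<close> is the transpose of e_i on the free module over
  words, which explains the reversed product in \<open>wop\<close>.\<close>

primrec actE :: "'i \<Rightarrow> 'i list \<Rightarrow> ('i list \<Rightarrow> kq) \<Rightarrow> kq" where
  "actE i [] = (\<lambda>\<phi>. 0)"
| "actE i (j # w) = (\<lambda>\<phi>. (if i = j then ehw i w * \<phi> w else 0) + actE i w (\<lambda>v. \<phi> (j # v)))"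

definition "opE i = Wop (\<lambda>\<phi> w. actE i w \<phi>)"
definition opF :: "'i \<Rightarrow> 'i wop" where "opF i = Wop (\<lambda>\<phi> w. \<phi> (i # w))"
definition "opK h = Wop (\<lambda>\<phi> w. qq powi wexp h w * \<phi> w)"

lemma actE_linear:
  "actE i w (\<lambda>v. \<phi> v + \<psi> v) = actE i w \<phi> + actE i w \<psi>"
  "actE i w (\<lambda>v. c * \<phi> v) = c * actE i w \<phi>"
  by (induction w arbitrary: \<phi> \<psi>) (simp_all add: algebra_simps)

lemma app_op [simp]:
  "app (opE i) \<phi> = (\<lambda>w. actE i w \<phi>)" "app (opF i) \<phi> = (\<lambda>w. \<phi> (i # w))"
  "app (opK h) \<phi> = (\<lambda>w. qq powi wexp h w * \<phi> w)"
  unfolding opE_def opF_def opK_def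
  by (subst Wop_inverse; simp add: actE_linear algebra_simps)+

lemma wexp_0: "wexp 0 w = 0"
  by (induction w) (simp_all add: pairing_0[OF lam] pairing_0[OF root_weight])

lemma wexp_add: "wexp (h + h') w = wexp h w + wexp h' w"
  by (induction w) (simp_all add: pairing_add[OF lam] pairing_add[OF root_weight])

lemma opK_0: "opK 0 = 1"
  by (rule wop_eqI) (simp add: wexp_0)

lemma opK_add: "opK (h + h') = opK h * opK h'"
  by (rule wop_eqI) (simp add: wexp_add power_int_add)

lemma opK_cancel: "opK h * opK (- h) = 1"
  by (simp add: opK_0 flip: opK_add)

lemma opK_opF: "opK h * (opF i * x) = wscale (qq powi (- alpha h i)) * (opF i * (opK h * x))"
proof -
  have "opK h * opF i = wscale (qq powi (- alpha h i)) * (opF i * opK h)"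
    by (rule wop_eqI) (simp add: power_int_diff power_int_minus divide_inverse)
  then show ?thesis by (metis mult.assoc)
qed

lemma opK_opE: "opK h * (opE i * x) = wscale (qq powi alpha h i) * (opE i * (opK h * x))"
proof -
  have "actE i w (\<lambda>v. qq powi wexp h v * \<phi> v) = qq powi (alpha h i + wexp h w) * actE i w \<phi>" for w \<phi>
  proof (induction w arbitrary: \<phi>)
    case (Cons j w)
    have "(\<lambda>v. qq powi wexp h (j # v) * \<phi> (j # v)) =
        (\<lambda>v. qq powi (- alpha h j) * (qq powi wexp h v * \<phi> (j # v)))"
      by (simp add: power_int_diff power_int_minus divide_inverse mult_ac)
    then have 1: "actE i w (\<lambda>v. qq powi wexp h (j # v) * \<phi> (j # v)) =
        qq powi (- alpha h j) * (qq powi (alpha h i + wexp h w) * actE i w (\<lambda>v. \<phi> (j # v)))"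
      by (simp only: actE_linear(2) Cons)
    have "alpha h i + wexp h (j # w) = - alpha h j + (alpha h i + wexp h w)" by simp
    then have 2: "qq powi (alpha h i + wexp h (j # w)) = qq powi (- alpha h j) * qq powi (alpha h i + wexp h w)"
      by (simp only: power_int_add qq_neq_0 simp_thms)
    have 3: "qq powi (alpha h j + wexp h (j # w)) = qq powi wexp h w" by simp
    have "(if i = j then ehw i w * (qq powi wexp h w * \<phi> w) else 0) =
        qq powi (alpha h i + wexp h (j # w)) * (if i = j then ehw i w * \<phi> w else 0)"
      using 3 by (simp del: wexp.simps)
    with 1 show ?case
      by (simp only: actE.simps distrib_left 2 mult.assoc)
  qed simp
  note eq = this
  have "opK h * opE i = wscale (qq powi alpha h i) * (opE i * opK h)"
    by (intro wop_eqI) (simp add: actE_linear(2) eq, simp add: power_int_add)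
  then show ?thesis by (metis mult.assoc)
qed

definition "hP i = wscale (1 / (q i - inverse (q i))) * opK (scaled_coroot D i)"
definition "hM i = wscale (- 1 / (q i - inverse (q i))) * opK (- scaled_coroot D i)"

lemma opE_opF: "opE i * (opF j * x) = opF j * (opE i * x) + (if i = j then hP i * x + hM i * x else 0)"
proof -
  have "opE i * opF j = opF j * opE i + (if i = j then hP i + hM i else 0)"
    by (rule wop_eqI) (simp add: hP_def hM_def ehw_def algebra_simps)
  then have "(opE i * opF j) * x = (opF j * opE i + (if i = j then hP i + hM i else 0)) * x" by simp
  then show ?thesis by (simp add: distrib_right mult.assoc)
qed

lemma alpha_scaled_coroot: "alpha (scaled_coroot D i) j = int (d i) * a i j"
  "alpha (- scaled_coroot D i) j = - (int (d i) * a i j)"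
  by (simp_all add: pairing_scaled_coroot[OF root_weight] alpha_coroot pairing_minus[OF root_weight])

lemma qq_powi_d: "qq powi (int (d i) * n) = q i powi n" "qq powi (- (int (d i) * n)) = inverse (q i) powi n"
proof -
  show "qq powi (int (d i) * n) = q i powi n"
    by (simp add: q_def power_int_mult)
  then show "qq powi (- (int (d i) * n)) = inverse (q i) powi n"
    by (simp only: power_int_minus power_int_inverse)
qed

lemma inverse_powi: "inverse (q i) powi n = q i powi (- n)" "inverse (q i) powi (- n) = q i powi n"
  by (simp_all add: power_int_minus power_int_inverse)

lemma hP_opF: "hP i * (opF j * x) = wscale (q i powi (- a i j)) * (opF j * (hP i * x))"
  and hM_opF: "hM i * (opF j * x) = wscale (inverse (q i) powi (- a i j)) * (opF j * (hM i * x))"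
  unfolding hP_def hM_def mult.assoc opK_opF alpha_scaled_coroot wscale.s_left[of "opF j"]
  by (simp_all only: minus_minus qq_powi_d inverse_powi wscale.s_left[of "wscale (q i powi _)"])

lemma hP_opE: "hP i * (opE j * x) = wscale (inverse (q i) powi (- a i j)) * (opE j * (hP i * x))"
  and hM_opE: "hM i * (opE j * x) = wscale (q i powi (- a i j)) * (opE j * (hM i * x))"
  unfolding hP_def hM_def mult.assoc opK_opE alpha_scaled_coroot wscale.s_left[of "opE j"]
  by (simp_all only: minus_minus qq_powi_d inverse_powi wscale.s_left[of "wscale (q i powi _)"])

definition "theta op i j = wscale.qserre (q i) (nat (1 - a i j)) (op i) (op j)"

text \<open>Symmetrizability on the quantum side: d_i a_ij = d_j a_ji makes the commutation factors
  of i and j agree.\<close>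

lemma q_powi_swap: "q j powi (- a j i) = q i powi (- a i j)"
  "inverse (q j) powi (- a j i) = inverse (q i) powi (- a i j)"
  by (metis d_a_sym mult_minus_right qq_powi_d(1))
    (metis d_a_sym mult_minus_right qq_powi_d(2))

lemma opE_theta:
  assumes "i \<noteq> j" shows "opE k * (theta opF i j * x) = theta opF i j * (opE k * x)"
proof -
  have m: "int (nat (1 - a i j)) = 1 - a i j" and le: "a i j \<le> 0" using a_le_0[OF assms] by simp_all
  consider "k = i" | "k = j" | "k \<noteq> i" "k \<noteq> j" by blast
  then show ?thesis
  proof cases
    case 1
    show ?thesis unfolding theta_def 1
      by (rule wscale.qserre_commute_left[OF nonroot_q m, where P = "hP i" and M = "hM i"])
        (use assms hP_opF[of i i] hM_opF[of i i] hP_opF[of i j] hM_opF[of i j] in \<open>simp_all add: opE_opF add.assoc\<close>)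
  next
    case 2
    show ?thesis unfolding theta_def 2
      by (rule wscale.qserre_commute_right[OF nonroot_q m le, where P = "hP j" and M = "hM j"])
        (use assms in \<open>simp_all add: opE_opF add.assoc\<close>,
          simp_all only: hP_opF hM_opF q_powi_swap[of j i])
  next
    case 3
    then show ?thesis unfolding theta_def
      by (intro wscale.qserre_commute_other) (simp_all add: opE_opF)
  qed
qed

lemma opF_opE: "opF j * (opE i * x) = opE i * (opF j * x) + (if i = j then - hM i * x + - hP i * x else 0)"
  using opE_opF[of i j x] by simp

text \<open>Exchanging e and f negates the Cartan part and interchanges the roles of its halves, so
  the same general lemmas apply with \<open>- hM\<close> for \<open>P\<close> and
  \<open>- hP\<close> for \<open>M\<close>.\<close>

lemma opF_theta:
  assumes "i \<noteq> j" shows "opF k * (theta opE i j * x) = theta opE i j * (opF k * x)"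
proof -
  have m: "int (nat (1 - a i j)) = 1 - a i j" and le: "a i j \<le> 0" using a_le_0[OF assms] by simp_all
  have neg: "- y * z = - (y * z)" for y z :: "'i wop" by simp
  consider "k = i" | "k = j" | "k \<noteq> i" "k \<noteq> j" by blast
  then show ?thesis
  proof cases
    case 1
    show ?thesis unfolding theta_def 1
      by (rule wscale.qserre_commute_left[OF nonroot_q m, where P = "- hM i" and M = "- hP i"])
        (use assms hP_opE[of i i] hM_opE[of i i] hP_opE[of i j] hM_opE[of i j] in \<open>simp_all add: opF_opE add.assoc\<close>)
  next
    case 2
    show ?thesis unfolding theta_def 2
      by (rule wscale.qserre_commute_right[OF nonroot_q m le, where P = "- hM j" and M = "- hP j"])
        (use assms in \<open>simp_all add: opF_opE add.assoc\<close>,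
          simp_all only: hP_opE hM_opE q_powi_swap[of j i])
  next
    case 3
    then show ?thesis unfolding theta_def
      by (intro wscale.qserre_commute_other) (simp_all add: opF_opE)
  qed
qed

section \<open>Functionals annihilating Serre and parabolic elements\<close>

primrec opw :: "'i list \<Rightarrow> 'i wop" where
  "opw [] = 1"
| "opw (i # u) = opF i * opw u"

lemma app_opw: "app (opw u) \<phi> w = \<phi> (u @ w)"
  by (induction u arbitrary: \<phi>) simp_all

lemma opK_opw: "\<exists>c. opK h * (opw u * x) = wscale c * (opw u * (opK h * x))"
proof (induction u)
  case Nil
  show ?case by (rule exI[of _ 1]) (simp add: wscale.s_one)
next
  case (Cons i u)
  then obtain c where c: "opK h * (opw u * x) = wscale c * (opw u * (opK h * x))" by blast
  have "opK h * (opF i * (opw u * x)) = wscale (qq powi (- alpha h i)) * (wscale c * (opF i * (opw u * (opK h * x))))"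
    unfolding opK_opF c wscale.s_left[of "opF i"] ..
  then show ?case
    by (intro exI[of _ "qq powi (- alpha h i) * c"]) (simp add: wscale.s_mult mult.assoc)
qed

text \<open>The Serre elements in the e_i commute with all f_k and vanish at the empty word, from
  which the f_k reach every word. So they act as zero on all functions.\<close>

lemma theta_opE_zero:
  assumes "i \<noteq> j" shows "theta opE i j = 0"
proof (rule wop_eqI)
  fix \<phi> w
  have comm: "opw u * theta opE i j = theta opE i j * opw u" for u
  proof (induction u)
    case (Cons k u)
    have "opF k * (opw u * theta opE i j) = opF k * (theta opE i j * opw u)" by (simp only: Cons)
    then show ?case by (simp add: opF_theta[OF assms] mult.assoc)
  qed simp
  have "app (opE k ^ n) \<psi> [] = (if n = 0 then \<psi> [] else 0)" for k n \<psi>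
    by (cases n) (simp_all add: power_Suc2 del: power_Suc)
  then have nil: "app (theta opE i j) \<psi> [] = 0" for \<psi>
    by (simp add: theta_def wscale.qserre_def app_sum)
  have "app (theta opE i j) \<phi> w = app (theta opE i j * opw w) \<phi> []"
    by (simp add: app_opw)
  also have "\<dots> = 0"
    unfolding comm[symmetric] by (simp add: nil)
  finally show "app (theta opE i j) \<phi> w = app 0 \<phi> w" by simp
qed

text \<open>\<phi> vanishes on all products u N w with w in \<open>S\<close>. For
  \<open>S = UNIV\<close> this is the two-sided ideal generated by \<open>N\<close> among f-words;
  for \<open>S = {[]}\<close> it is the left ideal, that is, all f-words applied to \<open>N\<close>
  on the highest weight vector.\<close>

definition annih :: "'i wop \<Rightarrow> 'i list set \<Rightarrow> ('i list \<Rightarrow> kq) \<Rightarrow> bool" where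
  "annih N S \<phi> \<longleftrightarrow> (\<forall>u. \<forall>w\<in>S. app (opw u * N) \<phi> w = 0)"

definition opgen :: "('i, 'p) qgen \<Rightarrow> 'i wop" where
  "opgen g = (case g of GE i \<Rightarrow> opE i | GF i \<Rightarrow> opF i | GK h \<Rightarrow> opK h)"

lemma opgen_simps [simp]: "opgen (GE i) = opE i" "opgen (GF i) = opF i" "opgen (GK h) = opK h"
  by (simp_all add: opgen_def)

sublocale rep: algebra_map wscale opgen ..

abbreviation "rep \<equiv> extend_hom wscale opgen"

lemma annih_add: "annih N S \<phi> \<Longrightarrow> annih N S \<psi> \<Longrightarrow> annih N S (\<lambda>w. \<phi> w + \<psi> w)"
  by (simp add: annih_def app_add)

lemma annih_scale: "annih N S \<phi> \<Longrightarrow> annih N S (\<lambda>w. c * \<phi> w)"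
  by (simp add: annih_def app_scale)

lemma annih_F: "annih N S \<phi> \<Longrightarrow> annih N S (app (opF i) \<phi>)"
  unfolding annih_def
proof safe
  fix u w assume "\<forall>u. \<forall>w\<in>S. app (opw u * N) \<phi> w = 0" "w \<in> S"
  then have "app (opw (i # u) * N) \<phi> w = 0" by blast
  then show "app (opw u * N) (app (opF i) \<phi>) w = 0" by simp
qed

lemma annih_K:
  assumes K: "\<And>h. \<exists>c. opK h * N = wscale c * (N * opK h)" and \<phi>: "annih N S \<phi>"
  shows "annih N S (app (opK h) \<phi>)"
  unfolding annih_def
proof safe
  fix u w assume w: "w \<in> S"
  obtain b where b: "opK h * (opw u * N) = wscale b * (opw u * (opK h * N))"
    using opK_opw by blast
  obtain c where c: "opK h * N = wscale c * (N * opK h)" using K by blast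
  have "app (opw u * N) (app (opK h) \<phi>) w = app (opK h * (opw u * N)) \<phi> w" by simp
  also have "opK h * (opw u * N) = wscale b * (wscale c * ((opw u * N) * opK h))"
    unfolding b c wscale.s_left[of "opw u"] mult.assoc ..
  also have "app \<dots> \<phi> w = qq powi wexp h w * (c * (b * app (opw u * N) \<phi> w))"
    by (simp add: app_scale)
  also have "app (opw u * N) \<phi> w = 0" using \<phi> w unfolding annih_def by blast
  finally show "app (opw u * N) (app (opK h) \<phi>) w = 0" by simp
qed

text \<open>Passing e_k through the word \<open>u\<close> creates Cartan terms, which
  \<open>annih_K\<close> absorbs, and finally puts e_k next to \<open>N\<close>, where hypothesis
  \<open>E\<close> takes over.\<close>

lemma annih_E:
  assumes K: "\<And>h. \<exists>c. opK h * N = wscale c * (N * opK h)"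
    and E: "\<And>k \<phi> w. annih N S \<phi> \<Longrightarrow> w \<in> S \<Longrightarrow> app (opE k * N) \<phi> w = 0"
    and \<phi>: "annih N S \<phi>"
  shows "annih N S (app (opE k) \<phi>)"
  unfolding annih_def
proof (intro allI ballI)
  fix u w assume w: "w \<in> S"
  have "app (opE k * (opw u * N)) \<phi> w = 0"
    using \<phi>
  proof (induction u arbitrary: \<phi>)
    case Nil
    then show ?case using E w by simp
  next
    case (Cons j u)
    have 1: "app (opF j * (opE k * (opw u * N))) \<phi> w = 0"
      using Cons.IH[OF annih_F[OF Cons.prems, of j]] by simp
    have "app (opw u * N) (app (wscale c * opK h) \<phi>) w = 0" for c h
      using annih_K[OF K annih_scale[OF Cons.prems], of h c] w unfolding annih_def app_simps app_wscale by blast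
    from this[of "1 / (q k - inverse (q k))" "scaled_coroot D k"] this[of "- 1 / (q k - inverse (q k))" "- scaled_coroot D k"]
    have 2: "app (hP k * (opw u * N)) \<phi> w = 0" "app (hM k * (opw u * N)) \<phi> w = 0"
      by (simp_all add: hP_def hM_def)
    have "opE k * (opw (j # u) * N) = opF j * (opE k * (opw u * N)) +
        (if k = j then hP k * (opw u * N) + hM k * (opw u * N) else 0)"
      by (simp only: opw.simps mult.assoc opE_opF)
    then show ?case using 1 2 by (cases "k = j") (simp_all add: app_add)
  qed
  then show "app (opw u * N) (app (opE k) \<phi>) w = 0" by simp
qed

lemma annih_rep:
  assumes K: "\<And>h. \<exists>c. opK h * N = wscale c * (N * opK h)"
    and E: "\<And>k \<phi> w. annih N S \<phi> \<Longrightarrow> w \<in> S \<Longrightarrow> app (opE k * N) \<phi> w = 0"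
    and \<phi>: "annih N S \<phi>"
  shows "annih N S (app (rep x) \<phi>)"
  using \<phi>
proof (induction x arbitrary: \<phi> rule: falg_induct)
  case one
  then show ?case by (simp add: rep.hom_simps)
next
  case (add x y)
  have "app (rep (x + y)) \<phi> = (\<lambda>w. app (rep x) \<phi> w + app (rep y) \<phi> w)"
    by (rule ext) (simp add: rep.hom_simps)
  then show ?case using add annih_add by simp
next
  case (scalar c x)
  then show ?case using annih_scale by (simp add: rep.hom_simps)
next
  case (gen g x)
  have "annih N S (app (opgen g) \<phi>)"
    using annih_F annih_K[OF K] annih_E[OF K E] gen.prems by (cases g) auto
  then show ?case using gen.IH by (simp add: rep.hom_simps)
qed

end

section \<open>Weights off the parabolic set\<close>

context verma_rep
begin

lemma skew_theta: "\<exists>c. opK h * theta opF i j = wscale c * (theta opF i j * opK h)"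
  using wscale.qserre_skew[of "opK h" "opF i" "qq powi (- alpha h i)" "opF j" "qq powi (- alpha h j)"
      "q i" "nat (1 - a i j)" 1] opK_opF
  unfolding theta_def by auto

lemma skew_F_pow: "\<exists>c. opK h * opF k ^ n = wscale c * (opF k ^ n * opK h)"
  using wscale.skew_power[of "opK h" "opF k" "qq powi (- alpha h k)" n 1] opK_opF by auto

lemma opE_theta_vanish:
  assumes "i \<noteq> j" "annih (theta opF i j) UNIV \<phi>"
  shows "app (opE k * theta opF i j) \<phi> w = 0"
proof -
  have "app (theta opF i j) \<phi> = (\<lambda>w. 0)"
    using assms(2)[unfolded annih_def, rule_format, of _ "[]"] by (intro ext) simp
  moreover have "opE k * theta opF i j = theta opF i j * opE k"
    using opE_theta[OF assms(1), of k 1] by simp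
  moreover have "actE k w (\<lambda>w. 0) = 0"
    using actE_linear(2)[of k w 0 "\<lambda>_. 0"] by simp
  ultimately show ?thesis by simp
qed

text \<open>Singularity already in the free module: at the empty word the two Cartan halves in
  \<open>sl2_ladder\<close> give opposite values precisely for this exponent.\<close>

lemma opE_F_pow_vanish:
  assumes "0 \<le> pairing D (coroot D i) lam"
  shows "app (opE k * opF i ^ Suc (nat (pairing D (coroot D i) lam))) \<phi> [] = 0"
proof -
  define n where "n = nat (pairing D (coroot D i) lam)"
  have n: "pairing D (coroot D i) lam = int n" using assms by (simp add: n_def)
  show ?thesis
  proof (cases "k = i")
    case True
    have e: "wexp (scaled_coroot D i) [] = int (d i) * int n" "wexp (- scaled_coroot D i) [] = - (int (d i) * int n)"
      by (simp_all add: pairing_scaled_coroot[OF lam] pairing_minus[OF lam] n)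
    have "opE i * (opF i ^ Suc n * 1) = opF i ^ Suc n * (opE i * 1)
      + wscale (qint (q i) (Suc n) * q i powi (1 - int (Suc n))) * (opF i ^ (Suc n - 1) * (hP i * 1))
      + wscale (qint (q i) (Suc n) * inverse (q i) powi (1 - int (Suc n))) * (opF i ^ (Suc n - 1) * (hM i * 1))"
      by (rule wscale.sl2_ladder[OF nonroot_q]) 
        (use hP_opF[of i i] hM_opF[of i i] in \<open>simp_all add: opE_opF add.assoc\<close>)
    then have "app (opE i * opF i ^ Suc n) \<phi> [] =
        qint (q i) (Suc n) * q i powi (- int n) * (1 / (q i - inverse (q i)) * qq powi wexp (scaled_coroot D i) []) * app (opF i ^ n) \<phi> []
      + qint (q i) (Suc n) * inverse (q i) powi (- int n) * (- 1 / (q i - inverse (q i)) * qq powi wexp (- scaled_coroot D i) []) * app (opF i ^ n) \<phi> []"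
      by (simp add: hP_def hM_def app_scale mult.assoc del: power_Suc wexp.simps)
    also have "\<dots> = 0"
      unfolding e qq_powi_d inverse_powi by (simp add: mult_ac)
    finally show ?thesis using True by (simp add: n_def)
  next
    case False
    then have "opE k * (opF i ^ Suc n * 1) = wscale (1 ^ Suc n) * (opF i ^ Suc n * (opE k * 1))"
      by (intro wscale.skew_power) (simp add: opE_opF wscale.s_one)
    then have "opE k * opF i ^ Suc n = opF i ^ Suc n * opE k"
      by (simp add: wscale.s_one del: power_Suc)
    then show ?thesis by (simp add: n_def del: power_Suc)
  qed
qed

definition tcoef :: "('i \<Rightarrow> nat) \<Rightarrow> 'i \<Rightarrow> 'i \<Rightarrow> kq" where
  "tcoef r j k = (if r j < r k then q j powi (- a j k) else 1)"

text \<open>Up to the scalars \<open>g\<close>, this evaluates a word as an ordered monomial of the quantum torus with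
  \<open>x\<^sub>i x\<^sub>j = q\<^sub>i\<^sup>-\<^sup>a\<^sup>i\<^sup>j x\<^sub>j x\<^sub>i\<close> for \<open>r i < r j\<close>, in which the Serre relations hold.\<close>

primrec tor :: "('i \<Rightarrow> nat) \<Rightarrow> 'i list \<Rightarrow> ('i \<Rightarrow> kq) \<Rightarrow> kq" where
  "tor r [] = (\<lambda>g. 1)"
| "tor r (j # w) = (\<lambda>g. g j * tor r w (\<lambda>k. g k * tcoef r j k))"

lemma tcoef_nz: "tcoef r j k \<noteq> 0"
  using nonroot_q[of j] by (simp add: tcoef_def nonroot_def)

lemma tor_nz: "(\<And>k. k \<in> set w \<Longrightarrow> g k \<noteq> 0) \<Longrightarrow> tor r w g \<noteq> 0"
  by (induction w arbitrary: g) (simp_all add: tcoef_nz)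

lemma F_tor: "app (opF j) (\<lambda>w. z * tor r w g) = (\<lambda>w. (z * g j) * tor r w (\<lambda>k. g k * tcoef r j k))"
  by (simp add: mult.assoc)

lemma F_pow_tor: "app (opF i ^ n) (\<lambda>w. z * tor r w g) = (\<lambda>w. (z * g i ^ n) * tor r w (\<lambda>k. g k * tcoef r i k ^ n))"
proof (induction n arbitrary: z g)
  case (Suc n)
  have "app (opF i ^ Suc n) (\<lambda>w. z * tor r w g) =
      app (opF i ^ n) (\<lambda>w. (z * g i) * tor r w (\<lambda>k. g k * tcoef r i k))"
    unfolding power_Suc app_simps F_tor ..
  also have "\<dots> = (\<lambda>w. (z * g i * (g i * tcoef r i i) ^ n) * tor r w (\<lambda>k. g k * tcoef r i k * tcoef r i k ^ n))"
    by (rule Suc)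
  also have "tcoef r i i = 1" by (simp add: tcoef_def)
  finally show ?case by (simp add: mult.assoc)
qed simp

text \<open>Prepending letters only rescales the torus parameters, and a parameter that is 0 remains
  0; the latter preserves the parabolic relations.\<close>

lemma opw_tor: "\<exists>z' g'. app (opw u) (\<lambda>w. z * tor r w g) = (\<lambda>w. z' * tor r w g') \<and> (\<forall>k. g k = 0 \<longrightarrow> g' k = 0)"
proof (induction u arbitrary: z g)
  case Nil
  then show ?case by auto
next
  case (Cons j u)
  have 1: "app (opw (j # u)) (\<lambda>w. z * tor r w g) = app (opw u) (\<lambda>w. (z * g j) * tor r w (\<lambda>k. g k * tcoef r j k))"
    unfolding opw.simps app_simps F_tor ..
  obtain z' g' where 2: "app (opw u) (\<lambda>w. (z * g j) * tor r w (\<lambda>k. g k * tcoef r j k)) = (\<lambda>w. z' * tor r w g')"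
    "\<forall>k. g k * tcoef r j k = 0 \<longrightarrow> g' k = 0"
    using Cons.IH[of "z * g j" "\<lambda>k. g k * tcoef r j k"] by (elim exE conjE)
  show ?case
    by (intro exI[of _ z'] exI[of _ g'] conjI) (simp only: 1 2(1), use 2(2) in simp)
qed

text \<open>All words in a Serre element have the same content, hence are multiples of one ordered
  monomial. Ordering x_j among the x_i leaves an alternating q-binomial sum at a power of q_i or of
  its inverse, depending on which of \<open>r i\<close>, \<open>r j\<close> is smaller.\<close>

lemma theta_tor:
  assumes r: "inj r" and ij: "i \<noteq> j"
  shows "app (theta opF i j) (\<lambda>w. z * tor r w g) = (\<lambda>w. 0)"
proof
  fix w
  define m where "m = nat (1 - a i j)"
  obtain l where "m = Suc l" using a_le_0[OF ij] by (cases m) (auto simp: m_def)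
  then have l: "m = Suc l" "- a i j = int l" using a_le_0[OF ij] by (simp_all add: m_def)
  define c where "c k = (- 1) ^ k * qbinom (q i) m k" for k
  define h where "h = (\<lambda>k. g k * tcoef r i k ^ m * tcoef r j k)"
  have one: "tcoef r k k = 1" for k by (simp add: tcoef_def)
  have summand: "app (wscale (c k) * opF i ^ (m - k) * opF j * opF i ^ k) (\<lambda>w. z * tor r w g) w =
      z * g i ^ m * g j * tor r w h * (c k * (tcoef r i j ^ (m - k) * tcoef r j i ^ k))" if "k \<le> m" for k
  proof -
    have "app (wscale (c k) * opF i ^ (m - k) * opF j * opF i ^ k) (\<lambda>w. z * tor r w g) =
        app (opF i ^ k) (app (opF j) (app (opF i ^ (m - k)) (\<lambda>w. (c k * z) * tor r w g)))"
      by (simp add: mult.assoc)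
    also have "\<dots> = (\<lambda>w. (c k * z * g i ^ (m - k) * (g j * tcoef r i j ^ (m - k)) * (g i * tcoef r i i ^ (m - k) * tcoef r j i) ^ k)
        * tor r w (\<lambda>x. g x * tcoef r i x ^ (m - k) * tcoef r j x * tcoef r i x ^ k))"
      unfolding F_pow_tor F_tor ..
    also have "(\<lambda>x. g x * tcoef r i x ^ (m - k) * tcoef r j x * tcoef r i x ^ k) = h"
    proof
      fix x
      have t: "tcoef r i x ^ m = tcoef r i x ^ (m - k) * tcoef r i x ^ k"
        using that by (simp flip: power_add)
      show "g x * tcoef r i x ^ (m - k) * tcoef r j x * tcoef r i x ^ k = h x"
        unfolding h_def t by (simp only: mult_ac)
    qed
    also have "c k * z * g i ^ (m - k) * (g j * tcoef r i j ^ (m - k)) * (g i * tcoef r i i ^ (m - k) * tcoef r j i) ^ k =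
        z * g i ^ m * g j * (c k * (tcoef r i j ^ (m - k) * tcoef r j i ^ k))"
    proof -
      have gm: "g i ^ m = g i ^ (m - k) * g i ^ k" using that by (simp flip: power_add)
      show ?thesis unfolding one power_one mult_1_right power_mult_distrib gm by (simp only: mult_ac)
    qed
    finally show ?thesis by (simp add: mult_ac)
  qed
  have "r i \<noteq> r j" using r ij by (auto dest: injD)
  then consider "r i < r j" | "r j < r i" by linarith
  then have sum: "(\<Sum>k\<le>m. c k * (tcoef r i j ^ (m - k) * tcoef r j i ^ k)) = 0"
  proof cases
    case 1
    have "tcoef r i j ^ (m - k) = (q i ^ l) ^ m * (inverse (q i) ^ l) ^ k" if "k \<le> m" for k
    proof -
      have "(q i ^ l) ^ m = (q i ^ l) ^ (m - k) * (q i ^ l) ^ k" using that by (simp flip: power_add)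
      moreover have "(q i ^ l) ^ k * (inverse (q i) ^ l) ^ k = 1"
        using nonroot_q[of i] by (simp add: nonroot_def flip: power_mult_distrib)
      moreover have "tcoef r i j = q i ^ l" using 1 l by (simp add: tcoef_def)
      ultimately show ?thesis by (simp add: mult.assoc)
    qed
    moreover have "tcoef r j i = 1" using 1 by (simp add: tcoef_def)
    ultimately have "(\<Sum>k\<le>m. c k * (tcoef r i j ^ (m - k) * tcoef r j i ^ k)) =
        (\<Sum>k\<le>m. (q i ^ l) ^ m * (c k * (inverse (q i) ^ l) ^ k))"
      by (intro sum.cong refl) simp
    also have "\<dots> = (q i ^ l) ^ m * (\<Sum>k\<le>m. c k * (inverse (q i) ^ l) ^ k)"
      by (rule sum_distrib_left[symmetric])
    also have "\<dots> = 0"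
      unfolding c_def l(1) by (simp only: qbinom_alternating_sum'[OF nonroot_q] mult_zero_right)
    finally show ?thesis .
  next
    case 2
    then have "tcoef r i j = 1" "tcoef r j i = q i ^ l"
      using l q_powi_swap(1)[of j i] by (simp_all add: tcoef_def)
    then show ?thesis
      unfolding c_def l(1) by (simp only: qbinom_alternating_sum[OF nonroot_q] power_one mult_1_left)
  qed
  have "app (theta opF i j) (\<lambda>w. z * tor r w g) w =
      (\<Sum>k\<le>m. z * g i ^ m * g j * tor r w h * (c k * (tcoef r i j ^ (m - k) * tcoef r j i ^ k)))"
    unfolding theta_def wscale.qserre_def app_sum m_def[symmetric] c_def[symmetric]
    by (intro sum.cong refl summand) simp
  also have "\<dots> = 0"
    unfolding sum_distrib_left[symmetric] sum by simp
  finally show "app (theta opF i j) (\<lambda>w. z * tor r w g) w = 0" .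
qed

lemma rep_serre: "rep (serre D (\<lambda>i. gen (GE i)) i j) = theta opE i j" "rep (serre D (\<lambda>i. gen (GF i)) i j) = theta opF i j"
  by (simp_all add: serre_def Let_def rep.hom_simps theta_def wscale.qserre_def)

text \<open>All relators except the Serre relations in the f_i act as zero on every function; those
  are imposed on \<phi> by assumption.\<close>

lemma rep_relator:
  assumes "x \<in> relators D" and serre: "\<And>i j. i \<noteq> j \<Longrightarrow> app (theta opF i j) \<phi> = (\<lambda>w. 0)"
  shows "app (rep x) \<phi> = (\<lambda>w. 0)"
  using assms(1)
proof cases
  case K_zero
  then show ?thesis by (simp add: rep.hom_simps opK_0 del: app_op)
next
  case (K_add h h')
  have "rep x = 0" unfolding K_add by (simp only: rep.hom_simps opgen_simps opK_add diff_self)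
  then show ?thesis by simp
next
  case (K_E h i)
  have "rep x = 0"
    unfolding K_E by (simp only: rep.hom_simps opgen_simps mult.assoc opK_opE opK_cancel mult_1_right diff_self)
  then show ?thesis by simp
next
  case (K_F h i)
  have "rep x = 0"
    unfolding K_F by (simp only: rep.hom_simps opgen_simps mult.assoc opK_opF opK_cancel mult_1_right diff_self)
  then show ?thesis by simp
next
  case (E_F i j)
  have "wscale (- 1 / (q i - inverse (q i))) = - (wscale (1 / (q i - inverse (q i))) :: 'i wop)"
    by (simp only: wscale.s_minus[symmetric] minus_divide_left)
  then have "wscale (1 / (q i - inverse (q i))) * (opK (scaled_coroot D i) - opK (- scaled_coroot D i)) = hP i + hM i"
    by (simp only: hP_def hM_def right_diff_distrib mult_minus_left add_uminus_conv_diff)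
  moreover have "opE i * opF j - opF j * opE i = (if i = j then hP i + hM i else 0)"
    using opE_opF[of i j 1] by simp
  ultimately have "rep x = 0"
    unfolding E_F by (cases "i = j") (simp_all add: rep.hom_simps)
  then show ?thesis by simp
next
  case (serre_E i j)
  then show ?thesis by (simp add: rep_serre theta_opE_zero)
next
  case (serre_F i j)
  then show ?thesis by (simp add: rep_serre serre)
qed

definition admissible :: "'i set \<Rightarrow> ('i list \<Rightarrow> kq) \<Rightarrow> bool" where
  "admissible J \<phi> \<longleftrightarrow> (\<forall>i j. i \<noteq> j \<longrightarrow> annih (theta opF i j) UNIV \<phi>) \<and>
     (\<forall>k\<in>J. annih (opF k ^ Suc (nat (pairing D (coroot D k) lam))) {[]} \<phi>)"

text \<open>Defined dually, as a common kernel of functionals, so that a single admissible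
  functional certifies that a word lies outside.\<close>

definition pideal :: "'i set \<Rightarrow> ('i, 'p) falg set" where
  "pideal J = {x. \<forall>\<phi>. admissible J \<phi> \<longrightarrow> app (rep x) \<phi> [] = 0}"

lemma admissible_rep:
  assumes J: "\<And>k. k \<in> J \<Longrightarrow> 0 \<le> pairing D (coroot D k) lam" and "admissible J \<phi>"
  shows "admissible J (app (rep x) \<phi>)"
  unfolding admissible_def
proof safe
  fix i j :: 'i assume "i \<noteq> j"
  then show "annih (theta opF i j) UNIV (app (rep x) \<phi>)"
    using assms(2) by (intro annih_rep skew_theta opE_theta_vanish) (auto simp: admissible_def)
next
  fix k assume k: "k \<in> J"
  show "annih (opF k ^ Suc (nat (pairing D (coroot D k) lam))) {[]} (app (rep x) \<phi>)"
    by (rule annih_rep) (use assms(2) k J skew_F_pow opE_F_pow_vanish in \<open>auto simp: admissible_def simp del: power_Suc app_simps\<close>)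
qed

lemma hw_ideal_pideal:
  assumes J: "\<And>k. k \<in> J \<Longrightarrow> 0 \<le> pairing D (coroot D k) lam"
  shows "hw_ideal D (pideal J) lam"
proof unfold_locales
  show "y * x \<in> pideal J" if "x \<in> pideal J" for x y
    using that admissible_rep[OF J] by (simp add: pideal_def rep.hom_simps)
  show "r * x \<in> pideal J" if "r \<in> relators D" for r x
  proof -
    have "app (rep r) \<phi> = (\<lambda>w. 0)" if "admissible J \<phi>" for \<phi>
    proof (rule rep_relator[OF \<open>r \<in> relators D\<close>])
      fix i j :: 'i assume "i \<noteq> j"
      then have "annih (theta opF i j) UNIV \<phi>" using that by (simp add: admissible_def)
      from this[unfolded annih_def, rule_format, of _ "[]"] show "app (theta opF i j) \<phi> = (\<lambda>w. 0)"
        by (intro ext) simp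
    qed
    then show ?thesis by (simp add: pideal_def rep.hom_simps)
  qed
qed (simp_all add: pideal_def rep.hom_simps lam)

lemma F_pow_pideal:
  assumes "k \<in> J"
  shows "gen (GF k) ^ Suc (nat (pairing D (coroot D k) lam)) \<in> pideal J"
  unfolding pideal_def
proof safe
  fix \<phi> assume "admissible J \<phi>"
  then have "annih (opF k ^ Suc (nat (pairing D (coroot D k) lam))) {[]} \<phi>"
    using assms by (simp add: admissible_def)
  from this[unfolded annih_def, rule_format, of "[]" "[]"]
  show "app (rep (gen (GF k) ^ Suc (nat (pairing D (coroot D k) lam)))) \<phi> [] = 0"
    by (simp only: rep.hom_power rep.hom_gen opgen_simps opw.simps mult_1_left) simp
qed

lemma F_word_notin_pideal:
  assumes "set w \<inter> J = {}"
  shows "prod_list (map (\<lambda>i. gen (GF i)) w) \<notin> pideal J"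
proof
  assume mem: "prod_list (map (\<lambda>i. gen (GF i)) w) \<in> pideal J"
  obtain r :: "'i \<Rightarrow> nat" where r: "inj r" using finite_imp_inj_to_nat_seg[of "UNIV :: 'i set"] by auto
  \<comment> \<open>With x_k = 0 for k in \<open>J\<close>, every word containing such a letter
    evaluates to 0; the exponents in the parabolic relations are positive, so these hold. Words off
    \<open>J\<close> keep nonzero values.\<close>
  define g where "g k = (if k \<in> J then 0 else 1 :: kq)" for k
  have "admissible J (\<lambda>w. 1 * tor r w g)"
    unfolding admissible_def annih_def
  proof safe
    fix i j :: 'i and u v :: "'i list" assume "i \<noteq> j"
    obtain z' g' where "app (opw u) (\<lambda>w. 1 * tor r w g) = (\<lambda>w. z' * tor r w g')"
      using opw_tor by metis
    then show "app (opw u * theta opF i j) (\<lambda>w. 1 * tor r w g) v = 0"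
      by (simp add: theta_tor[OF r \<open>i \<noteq> j\<close>] del: mult_1_left)
  next
    fix k u assume "k \<in> J"
    obtain z' g' where 1: "app (opw u) (\<lambda>w. 1 * tor r w g) = (\<lambda>w. z' * tor r w g')" and "\<forall>k. g k = 0 \<longrightarrow> g' k = 0"
      using opw_tor by metis
    then have "g' k = 0" using \<open>k \<in> J\<close> by (simp add: g_def)
    then show "app (opw u * opF k ^ Suc (nat (pairing D (coroot D k) lam))) (\<lambda>w. 1 * tor r w g) [] = 0"
      unfolding app_simps 1 F_pow_tor by simp
  qed
  then have "app (rep (prod_list (map (\<lambda>i. gen (GF i)) w))) (\<lambda>w. 1 * tor r w g) [] = 0"
    using mem unfolding pideal_def by blast
  moreover have "rep (prod_list (map (\<lambda>i. gen (GF i)) w)) = opw w"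
    by (induction w) (simp_all add: rep.hom_simps)
  ultimately have "tor r w g = 0" by (simp add: app_opw)
  moreover have "tor r w g \<noteq> 0" using assms by (intro tor_nz) (auto simp: g_def)
  ultimately show False by contradiction
qed

end

section \<open>Modules as quotients by left ideals\<close>

lemma ring_of_type_algebra_simps [simp]:
  "carrier (ring_of_type_algebra :: 'a::ring_1 ring) = UNIV"
  "x \<otimes>\<^bsub>ring_of_type_algebra\<^esub> y = x * (y :: 'a)" "x \<oplus>\<^bsub>ring_of_type_algebra\<^esub> y = x + (y :: 'a)"
  "\<one>\<^bsub>ring_of_type_algebra\<^esub> = (1 :: 'a)" "\<zero>\<^bsub>ring_of_type_algebra\<^esub> = (0 :: 'a)"
  by (simp_all add: ring_of_type_algebra_def)

lemma ring_ring_of_type_algebra: "ring (ring_of_type_algebra :: 'a::ring_1 ring)"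
proof -
  have "\<exists>y. x + y = 0" for x :: 'a
    using add.right_inverse by blast
  thus ?thesis
    unfolding ring_of_type_algebra_def using add.right_inverse
    by unfold_locales (auto simp: algebra_simps Units_def)
qed

definition left_ideal :: "'a::ring_1 set \<Rightarrow> bool" where
  "left_ideal T \<longleftrightarrow> 0 \<in> T \<and> (\<forall>x\<in>T. \<forall>y\<in>T. x + y \<in> T) \<and> (\<forall>x\<in>T. \<forall>y. y * x \<in> T)"

definition lideal :: "'a::ring_1 set \<Rightarrow> 'a set" where
  "lideal S = \<Inter>{T. left_ideal T \<and> S \<subseteq> T}"

lemma left_idealD:
  assumes "left_ideal T"
  shows "0 \<in> T" "x \<in> T \<Longrightarrow> y \<in> T \<Longrightarrow> x + y \<in> T" "x \<in> T \<Longrightarrow> z * x \<in> T"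
  using assms by (simp_all add: left_ideal_def)

lemma left_ideal_lideal: "left_ideal (lideal S)"
  by (auto simp: left_ideal_def lideal_def)

lemma lideal_subset: "S \<subseteq> lideal S"
  by (auto simp: lideal_def)

lemma lideal_minimal: "left_ideal T \<Longrightarrow> S \<subseteq> T \<Longrightarrow> lideal S \<subseteq> T"
  by (auto simp: lideal_def)

section \<open>The quantum group as a quotient of the free algebra\<close>

context
  fixes D :: "('i::finite, 'p::ab_group_add, 'h::ab_group_add) km_datum"
begin

interpretation FR: ring "ring_of_type_algebra :: ('i, 'p) falg ring"
  by (rule ring_ring_of_type_algebra)

lemma ideal_relator_ideal: "ideal (relator_ideal D) ring_of_type_algebra"
  unfolding relator_ideal_def by (rule FR.genideal_ideal) simp

interpretation RI: ideal "relator_ideal D" "ring_of_type_algebra :: ('i, 'p) falg ring"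
  by (rule ideal_relator_ideal)

lemma uq_class_eq_iff: "uq_class D x = uq_class D y \<longleftrightarrow> x - y \<in> relator_ideal D"
proof -
  have inv: "\<ominus>\<^bsub>ring_of_type_algebra\<^esub> y = - y" for y :: "('i, 'p) falg"
    using FR.minus_equality[of "- y" y] by simp
  show ?thesis
    unfolding uq_class_def
    using FR.quotient_eq_iff_same_a_r_cos[OF ideal_relator_ideal, of x y] by (simp add: a_minus_def inv)
qed

lemma ring_Uq: "ring (Uq D)"
  unfolding Uq_def by (rule RI.quotient_is_ring)

lemma carrier_Uq: "carrier (Uq D) = range (uq_class D)"
  by (auto simp: Uq_def FactRing_def uq_class_def A_RCOSETS_def RCOSETS_def a_r_coset_def)

lemma uq_class_add: "uq_class D (x + y) = uq_class D x \<oplus>\<^bsub>Uq D\<^esub> uq_class D y"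
  using RI.a_rcos_sum[of x y] by (simp add: Uq_def FactRing_def uq_class_def)

lemma uq_class_mult: "uq_class D (x * y) = uq_class D x \<otimes>\<^bsub>Uq D\<^esub> uq_class D y"
  using RI.rcoset_mult_add[of x y] by (simp add: Uq_def FactRing_def uq_class_def)

lemma uq_class_1: "uq_class D 1 = \<one>\<^bsub>Uq D\<^esub>"
  by (simp add: Uq_def FactRing_def uq_class_def)

lemma uq_class_power: "uq_class D (x ^ n) = uq_class D x [^]\<^bsub>Uq D\<^esub> n"
  by (induction n) (simp_all add: uq_class_1 power_Suc2 uq_class_mult del: power_Suc)

lemma uq_class_minus: "uq_class D (x - y) = uq_class D x \<ominus>\<^bsub>Uq D\<^esub> uq_class D y"
proof -
  interpret U: ring "Uq D" by (rule ring_Uq)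
  have c: "uq_class D z \<in> carrier (Uq D)" for z by (simp add: carrier_Uq)
  have "uq_class D x \<ominus>\<^bsub>Uq D\<^esub> uq_class D y = (uq_class D (x - y) \<oplus>\<^bsub>Uq D\<^esub> uq_class D y) \<ominus>\<^bsub>Uq D\<^esub> uq_class D y"
    by (simp flip: uq_class_add)
  also have "\<dots> = uq_class D (x - y)"
    using c[of "x - y"] c[of y] by (simp add: U.minus_eq U.a_assoc U.r_neg)
  finally show ?thesis by simp
qed

lemma relator_ideal_props:
  "left_ideal (relator_ideal D)" "r \<in> relators D \<Longrightarrow> r * x \<in> relator_ideal D"
proof -
  have "relators D \<subseteq> relator_ideal D"
    unfolding relator_ideal_def using FR.genideal_self[of "relators D"] by simp
  then show "r \<in> relators D \<Longrightarrow> r * x \<in> relator_ideal D"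
    using RI.I_r_closed[of r x] by auto
  show "left_ideal (relator_ideal D)"
    using RI.zero_closed RI.a_closed RI.I_l_closed by (auto simp: left_ideal_def)
qed

text \<open>The annihilator of the quotient by \<open>L\<close>, all x with
  \<open>x * y \<in> L\<close> for every y, is a two-sided ideal containing the relators; y = 1
  shows that it lies in \<open>L\<close>.\<close>

lemma relator_ideal_subset:
  assumes "uq_ideal D L" shows "relator_ideal D \<subseteq> L"
proof -
  interpret uq_ideal D L by fact
  define J where "J = {x. \<forall>y. x * y \<in> L}"
  have "ideal J ring_of_type_algebra"
  proof (rule idealI)
    show "subgroup J (add_monoid ring_of_type_algebra)"
    proof (rule FR.add.subgroupI)
      show "\<ominus>\<^bsub>ring_of_type_algebra\<^esub> x \<in> J" if "x \<in> J" for x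
      proof -
        have "\<ominus>\<^bsub>ring_of_type_algebra\<^esub> x = - x" using FR.minus_equality[of "- x" x] by simp
        then show ?thesis using that L_uminus by (simp add: J_def)
      qed
    qed (auto simp: J_def L_0 distrib_right L_add intro: exI[of _ 0])
  qed (auto simp: J_def L_mult mult.assoc ring_ring_of_type_algebra)
  moreover have "relators D \<subseteq> J" by (auto simp: J_def L_relator)
  ultimately have "relator_ideal D \<subseteq> J"
    unfolding relator_ideal_def by (rule FR.genideal_minimal)
  also have "J \<subseteq> L" by (auto simp: J_def dest: spec[of _ 1])
  finally show ?thesis .
qed

end

text \<open>The bridge from modules of any carrier type to left ideals: \<open>V\<close> is cyclic
  on \<open>v\<close>, and \<open>L\<close> is the annihilator of \<open>v\<close> pulled back to
  the free algebra.\<close>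

locale presentation = left_module "Uq D" V
  for D :: "('i::finite, 'p::ab_group_add, 'h::ab_group_add) km_datum"
    and V :: "(('i, 'p) uq, 'v, 'n) module_scheme" +
  fixes v :: 'v and L :: "('i, 'p) falg set"
  assumes v_closed: "v \<in> carrier V"
    and surj: "carrier V = range (\<lambda>x. uq_class D x \<odot>\<^bsub>V\<^esub> v)"
    and kernel: "uq_class D x \<odot>\<^bsub>V\<^esub> v = \<zero>\<^bsub>V\<^esub> \<longleftrightarrow> x \<in> L"
begin

definition act :: "('i, 'p) falg \<Rightarrow> 'v" where "act x = uq_class D x \<odot>\<^bsub>V\<^esub> v"

lemma carrier_act: "carrier V = range act"
  unfolding surj by (simp add: act_def)

lemma uq_closed: "uq_class D x \<in> carrier (Uq D)"
  by (simp add: carrier_Uq)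

lemma act_closed: "act x \<in> carrier V"
  by (simp add: carrier_act)

lemma act_add: "act (x + y) = act x \<oplus>\<^bsub>V\<^esub> act y"
  by (simp add: act_def uq_class_add smult_l_distr uq_closed v_closed)

lemma smult_act: "uq_class D y \<odot>\<^bsub>V\<^esub> act x = act (y * x)"
  by (simp add: act_def uq_class_mult smult_assoc1 uq_closed v_closed)

lemma act_eq_0_iff: "act x = \<zero>\<^bsub>V\<^esub> \<longleftrightarrow> x \<in> L"
  by (simp add: act_def kernel)

lemma act_eq_iff: "act x = act y \<longleftrightarrow> x - y \<in> L"
proof -
  have "act x = act (x - y) \<oplus>\<^bsub>V\<^esub> act y" by (simp flip: act_add)
  then have "act x = act y \<longleftrightarrow> act (x - y) = \<zero>\<^bsub>V\<^esub>"
    using act_closed[of y] act_closed[of "x - y"] M.add.r_cancel_one by auto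
  then show ?thesis by (simp add: act_eq_0_iff)
qed

lemma left_ideal_L: "left_ideal L"
  unfolding left_ideal_def
proof safe
  have "act 0 \<oplus>\<^bsub>V\<^esub> act 0 = act 0" by (simp flip: act_add)
  then show "0 \<in> L"
    using act_closed[of 0] M.add.r_cancel_one by (simp flip: act_eq_0_iff)
next
  fix x y assume "x \<in> L" "y \<in> L"
  then show "x + y \<in> L" by (simp add: act_add flip: act_eq_0_iff)
next
  fix x y assume x: "x \<in> L"
  \<comment> \<open>Multiples of zero are zero because zero is its own double, so the image is
    additively idempotent.\<close>
  have "act (y * x) \<oplus>\<^bsub>V\<^esub> act (y * x) = uq_class D y \<odot>\<^bsub>V\<^esub> (act x \<oplus>\<^bsub>V\<^esub> act x)"
    by (simp add: smult_r_distr uq_closed act_closed smult_act)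
  also have "act x \<oplus>\<^bsub>V\<^esub> act x = act x" using x by (simp flip: act_eq_0_iff)
  finally show "y * x \<in> L"
    using act_closed[of "y * x"] M.add.r_cancel_one by (simp add: smult_act flip: act_eq_0_iff)
qed

lemma relator_ideal_L: "relator_ideal D \<subseteq> L"
proof
  fix x assume "x \<in> relator_ideal D"
  then have "uq_class D x = uq_class D 0" by (simp add: uq_class_eq_iff)
  then have "act x = act 0" by (simp add: act_def)
  then show "x \<in> L" by (simp add: act_eq_iff)
qed

lemma uq_ideal_L: "km_data D \<Longrightarrow> uq_ideal D L"
  using left_ideal_L relator_ideal_props(2) relator_ideal_L
  by unfold_locales (auto simp: left_ideal_def)

text \<open>One half of the correspondence between submodules of \<open>V\<close> and left ideals
  above \<open>L\<close>; \<open>L \<subseteq> T\<close> is what makes membership independent of the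
  chosen preimage.\<close>

lemma submodule_act:
  assumes T: "left_ideal T" "L \<subseteq> T"
  shows "submodule (act ` T) (Uq D) V" "act x \<in> act ` T \<longleftrightarrow> x \<in> T"
proof -
  have "subgroup (act ` T) (add_monoid V)"
  proof (rule M.add.subgroupI)
    show "act ` T \<subseteq> carrier V" using act_closed by auto
    show "act ` T \<noteq> {}" using left_idealD(1)[OF T(1)] by auto
    fix y assume "y \<in> act ` T"
    then obtain x where x: "x \<in> T" "y = act x" by auto
    have "act (- x) \<oplus>\<^bsub>V\<^esub> act x = \<zero>\<^bsub>V\<^esub>"
      using left_idealD(1)[OF left_ideal_L] by (simp add: act_eq_0_iff flip: act_add)
    then have "\<ominus>\<^bsub>V\<^esub> y = act (- x)" using x(2) act_closed by (simp add: M.minus_equality)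
    moreover have "- x \<in> T" using left_idealD(3)[OF T(1) x(1), of "- 1"] by simp
    ultimately show "\<ominus>\<^bsub>V\<^esub> y \<in> act ` T" by simp
    fix z assume "z \<in> act ` T"
    then obtain x' where "x' \<in> T" "z = act x'" by auto
    then show "y \<oplus>\<^bsub>V\<^esub> z \<in> act ` T"
      using x left_idealD(2)[OF T(1)] by (auto simp flip: act_add)
  qed
  then show "submodule (act ` T) (Uq D) V"
    by (intro submodule.intro submodule_axioms.intro)
      (auto simp: carrier_Uq smult_act left_idealD(3)[OF T(1)])
  show "act x \<in> act ` T \<longleftrightarrow> x \<in> T"
  proof
    assume "act x \<in> act ` T"
    then obtain y where "y \<in> T" "x - y \<in> L" by (auto simp: act_eq_iff)
    then show "x \<in> T" using left_idealD(2)[OF T(1), of "x - y" y] T(2) by auto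
  qed simp
qed

lemma left_ideal_of_submodule:
  assumes "submodule N (Uq D) V"
  shows "left_ideal {x. act x \<in> N}" "L \<subseteq> {x. act x \<in> N}" "N = act ` {x. act x \<in> N}"
proof -
  interpret N: submodule N "Uq D" V by fact
  have 0: "\<zero>\<^bsub>V\<^esub> \<in> N" using N.one_closed by simp
  show L: "L \<subseteq> {x. act x \<in> N}" using 0 by (auto simp flip: act_eq_0_iff)
  then show "left_ideal {x. act x \<in> N}"
    using left_idealD(1)[OF left_ideal_L] N.m_closed N.smult_closed[OF uq_closed]
    by (auto simp: left_ideal_def act_add simp flip: smult_act)
  show "N = act ` {x. act x \<in> N}"
    using N.subset by (auto simp: carrier_act)
qed

lemma gen_submodule_act: "gen_submodule (Uq D) V (act ` S) = act ` lideal (L \<union> S)"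
proof
  have "left_ideal (lideal (L \<union> S))" "L \<subseteq> lideal (L \<union> S)" "S \<subseteq> lideal (L \<union> S)"
    using left_ideal_lideal lideal_subset[of "L \<union> S"] by blast+
  then show "gen_submodule (Uq D) V (act ` S) \<subseteq> act ` lideal (L \<union> S)"
    unfolding gen_submodule_def using submodule_act(1) by (intro Inter_lower) blast
  show "act ` lideal (L \<union> S) \<subseteq> gen_submodule (Uq D) V (act ` S)"
    unfolding gen_submodule_def
  proof (intro Inter_greatest)
    fix N assume "N \<in> {N. submodule N (Uq D) V \<and> act ` S \<subseteq> N}"
    then have N: "submodule N (Uq D) V" "act ` S \<subseteq> N" by auto
    have "lideal (L \<union> S) \<subseteq> {x. act x \<in> N}"
      using left_ideal_of_submodule(1,2)[OF N(1)] N(2) by (intro lideal_minimal) auto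
    then show "act ` lideal (L \<union> S) \<subseteq> N" by auto
  qed
qed

lemma presentation_quot:
  assumes N: "submodule N (Uq D) V"
  shows "presentation D (quot_module V N) (N +>\<^bsub>V\<^esub> v) {x. act x \<in> N}"
proof -
  interpret N: submodule N "Uq D" V by fact
  interpret A: abelian_subgroup N V
    by (rule abelian_subgroupI3) (auto intro: additive_subgroup.intro N.subgroup_axioms M.abelian_group_axioms)
  let ?Q = "quot_module V N"
  have carrier: "carrier ?Q = (\<lambda>x. N +>\<^bsub>V\<^esub> x) ` carrier V"
    by (auto simp: quot_module_def A_RCOSETS_def RCOSETS_def a_r_coset_def)
  have add: "(N +>\<^bsub>V\<^esub> x) \<oplus>\<^bsub>?Q\<^esub> (N +>\<^bsub>V\<^esub> y) = N +>\<^bsub>V\<^esub> (x \<oplus>\<^bsub>V\<^esub> y)"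
    if "x \<in> carrier V" "y \<in> carrier V" for x y
    using A.a_rcos_sum[OF that] by (simp add: quot_module_def)
  \<comment> \<open>\<open>quot_module\<close> multiplies a coset by a union over its elements; the
    union collapses once all representatives are seen to give the same coset.\<close>
  have smult: "r \<odot>\<^bsub>?Q\<^esub> (N +>\<^bsub>V\<^esub> y) = N +>\<^bsub>V\<^esub> (r \<odot>\<^bsub>V\<^esub> y)"
    if r: "r \<in> carrier (Uq D)" and y: "y \<in> carrier V" for r y
  proof -
    have "N +>\<^bsub>V\<^esub> (r \<odot>\<^bsub>V\<^esub> x) = N +>\<^bsub>V\<^esub> (r \<odot>\<^bsub>V\<^esub> y)" if x: "x \<in> N +>\<^bsub>V\<^esub> y" for x
    proof -
      obtain n where n: "n \<in> N" "x = n \<oplus>\<^bsub>V\<^esub> y" using x by (auto simp: a_r_coset_def r_coset_def)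
      then have "r \<odot>\<^bsub>V\<^esub> x = r \<odot>\<^bsub>V\<^esub> n \<oplus>\<^bsub>V\<^esub> r \<odot>\<^bsub>V\<^esub> y"
        using r y N.subset by (auto simp: smult_r_distr)
      then have "r \<odot>\<^bsub>V\<^esub> x \<in> N +>\<^bsub>V\<^esub> (r \<odot>\<^bsub>V\<^esub> y)"
        using N.smult_closed[OF r n(1)] by (auto simp: a_r_coset_def r_coset_def)
      then show ?thesis
        using A.a_repr_independence'[of "r \<odot>\<^bsub>V\<^esub> x" "r \<odot>\<^bsub>V\<^esub> y"] r y by simp
    qed
    then have "(\<Union>x\<in>N +>\<^bsub>V\<^esub> y. N +>\<^bsub>V\<^esub> (r \<odot>\<^bsub>V\<^esub> x)) = (\<Union>x\<in>N +>\<^bsub>V\<^esub> y. N +>\<^bsub>V\<^esub> (r \<odot>\<^bsub>V\<^esub> y))"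
      by (rule SUP_cong[OF HOL.refl])
    also have "\<dots> = N +>\<^bsub>V\<^esub> (r \<odot>\<^bsub>V\<^esub> y)"
      using A.a_rcos_self[OF y] by (subst UN_constant) auto
    finally show ?thesis by (simp add: quot_module_def)
  qed
  have zero_coset: "\<zero>\<^bsub>?Q\<^esub> = N +>\<^bsub>V\<^esub> \<zero>\<^bsub>V\<^esub>"
    using A.a_rcos_self[of "\<zero>\<^bsub>V\<^esub>"] A.a_rcos_const[of "\<zero>\<^bsub>V\<^esub>"] by (simp add: quot_module_def)
  have "abelian_group ?Q"
  proof (rule abelian_groupI)
    fix C assume "C \<in> carrier ?Q"
    then obtain x where x: "x \<in> carrier V" "C = N +>\<^bsub>V\<^esub> x" by (auto simp: carrier)
    then show "\<exists>B\<in>carrier ?Q. B \<oplus>\<^bsub>?Q\<^esub> C = \<zero>\<^bsub>?Q\<^esub>"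
      by (intro bexI[of _ "N +>\<^bsub>V\<^esub> (\<ominus>\<^bsub>V\<^esub> x)"]) (auto simp: add zero_coset carrier M.l_neg)
  qed (auto simp: carrier add zero_coset M.a_ac)
  then have lm: "left_module (Uq D) ?Q"
    using ring_Uq
    by (intro left_module.intro left_module_axioms.intro)
      (auto simp: carrier add smult smult_l_distr smult_r_distr smult_assoc1)
  have zero: "\<zero>\<^bsub>?Q\<^esub> = N" by (simp add: quot_module_def)
  have coset: "N +>\<^bsub>V\<^esub> x = N \<longleftrightarrow> x \<in> N" if "x \<in> carrier V" for x
    using A.a_rcos_self[OF that] A.a_rcos_const by auto
  have act: "uq_class D x \<odot>\<^bsub>?Q\<^esub> (N +>\<^bsub>V\<^esub> v) = N +>\<^bsub>V\<^esub> act x" for x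
    using smult[OF uq_closed v_closed] by (simp add: act_def)
  have range: "carrier ?Q = range (\<lambda>x. N +>\<^bsub>V\<^esub> act x)"
    by (simp add: carrier carrier_act image_image)
  have closed: "N +>\<^bsub>V\<^esub> v \<in> carrier ?Q"
    by (simp add: carrier v_closed)
  show "presentation D ?Q (N +>\<^bsub>V\<^esub> v) {x. act x \<in> N}"
    by (intro presentation.intro presentation_axioms.intro lm closed)
      (simp_all add: act range zero coset act_closed)
qed

lemma wt_space_act:
  "wt_space D V mu = act ` {x. \<forall>h. gen (GK h) * x - scalar (mu (gexp h)) * x \<in> L}"
proof -
  have "UK D h \<odot>\<^bsub>V\<^esub> act x = Uscal D (mu (gexp h)) \<odot>\<^bsub>V\<^esub> act x \<longleftrightarrow> gen (GK h) * x - scalar (mu (gexp h)) * x \<in> L" for h x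
    by (simp add: UK_def Uscal_def smult_act act_eq_iff)
  then show ?thesis by (auto simp: wt_space_def carrier_act)
qed

end

lemma presentation_regular:
  "presentation D (regular_module (Uq D)) \<one>\<^bsub>Uq D\<^esub> (relator_ideal D)"
  "presentation.act D (regular_module (Uq D)) \<one>\<^bsub>Uq D\<^esub> x = uq_class D x"
proof -
  interpret U: ring "Uq D" by (rule ring_Uq)
  let ?M = "regular_module (Uq D)"
  have "abelian_group ?M"
    by (rule abelian_groupI) (auto simp: regular_module_def U.a_ac intro: bexI[of _ "\<ominus>\<^bsub>Uq D\<^esub> _"] U.l_neg)
  then have lm: "left_module (Uq D) ?M"
    by (intro left_module.intro left_module_axioms.intro ring_Uq)
      (auto simp: regular_module_def U.l_distr U.r_distr U.m_assoc)
  have c: "uq_class D x \<in> carrier (Uq D)" for x by (simp add: carrier_Uq)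
  have "uq_class D x = \<zero>\<^bsub>Uq D\<^esub> \<longleftrightarrow> x \<in> relator_ideal D" for x
  proof -
    have "uq_class D 0 \<oplus>\<^bsub>Uq D\<^esub> uq_class D 0 = uq_class D 0" by (simp flip: uq_class_add)
    then have "uq_class D 0 = \<zero>\<^bsub>Uq D\<^esub>" using c[of 0] U.add.r_cancel_one by simp
    then show ?thesis using uq_class_eq_iff[of D x 0] by simp
  qed
  moreover have "\<one>\<^bsub>Uq D\<^esub> \<in> range (uq_class D)" using uq_class_1 by (metis rangeI)
  ultimately show "presentation D ?M \<one>\<^bsub>Uq D\<^esub> (relator_ideal D)"
    using lm c by (intro presentation.intro presentation_axioms.intro)
      (auto simp: regular_module_def carrier_Uq)
  then show "presentation.act D ?M \<one>\<^bsub>Uq D\<^esub> x = uq_class D x"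
    using c by (simp add: presentation.act_def regular_module_def)
qed

section \<open>Weights and integrability of modules\<close>

lemma linear_ext_gexp [simp]: "linear_ext f (gexp h) = f h"
  by (simp add: linear_ext_def gexp_def)

lemma linear_ext_superset:
  assumes "finite A" "Poly_Mapping.keys x \<subseteq> A"
  shows "linear_ext f x = (\<Sum>h\<in>A. Poly_Mapping.lookup x h * f h)"
  unfolding linear_ext_def using assms
  by (intro sum.mono_neutral_left) (auto simp: in_keys_iff)

lemma linear_ext_add: "linear_ext f (x + y) = linear_ext f x + linear_ext f y"
proof -
  let ?A = "Poly_Mapping.keys x \<union> Poly_Mapping.keys y"
  have "Poly_Mapping.keys (x + y) \<subseteq> ?A" by (rule keys_add)
  then show ?thesis
    by (simp add: linear_ext_superset[of ?A] lookup_add distrib_right sum.distrib)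
qed

lemma linear_ext_single: "linear_ext f (Poly_Mapping.single h c) = c * f h"
  by (subst linear_ext_superset[of "{h}"]) auto

lemma linear_ext_mem_weights:
  fixes f :: "'p::ab_group_add \<Rightarrow> kq"
  assumes "f 0 = 1" "\<And>h h'. f (h + h') = f h * f h'"
  shows "linear_ext f \<in> weights"
proof -
  have zero: "linear_ext f 0 = 0" by (simp add: linear_ext_def)
  have mult: "linear_ext f (x * y) = linear_ext f x * linear_ext f y" for x y
  proof (induction x rule: poly_mapping_sum_induct)
    case (single u b)
    show ?case
    proof (induction y rule: poly_mapping_sum_induct)
      case (single w c)
      then show ?case by (simp add: mult_single linear_ext_single assms(2) mult_ac)
    qed (simp_all add: zero linear_ext_add distrib_left)
  qed (simp_all add: zero linear_ext_add distrib_right)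
  have scalar: "linear_ext f (scalar c) = c" for c
    by (simp add: scalar_def linear_ext_single assms(1))
  show ?thesis
    unfolding weights_def using scalar[of 1] scalar by (auto simp: linear_ext_add mult)
qed

lemma weights_eq_linear_ext:
  assumes "mu \<in> weights" shows "mu = linear_ext (\<lambda>h. mu (gexp h))"
proof
  fix x
  have mu: "mu (x + y) = mu x + mu y" "mu (scalar c * x) = c * mu x" for x y c
    using assms unfolding weights_def by blast+
  show "mu x = linear_ext (\<lambda>h. mu (gexp h)) x"
  proof (induction x rule: poly_mapping_sum_induct)
    case zero
    show ?case using mu(2)[of 0 0] by (simp add: linear_ext_def)
  next
    case (single k c)
    have "Poly_Mapping.single k c = scalar c * gexp k"
      by (simp add: scalar_def gexp_def mult_single)
    then have "mu (Poly_Mapping.single k c) = c * mu (gexp k)" using mu(2) by simp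
    then show ?case by (simp add: linear_ext_single)
  qed (simp add: mu(1) linear_ext_add)
qed

lemma (in km) uq_ideal_of_left_ideal:
  assumes "left_ideal T" "relator_ideal D \<subseteq> T" shows "uq_ideal D T"
  using assms relator_ideal_props(2) by unfold_locales (auto simp: left_ideal_def)

lemma (in uq_ideal) left_ideal_L: "left_ideal L"
  by (simp add: left_ideal_def L_0 L_add L_mult)

lemma (in hw_ideal) chi_weights: "linear_ext (chi \<nu>) \<in> weights"
proof (rule linear_ext_mem_weights)
  show "chi \<nu> 0 = 1"
    by (simp add: chi_def pairing_0[OF lam] pairing_0[OF root_weight])
  fix h h'
  have "pairing D (h + h') lam - (\<Sum>j\<in>UNIV. \<nu> j * alpha (h + h') j) =
     (pairing D h lam - (\<Sum>j\<in>UNIV. \<nu> j * alpha h j)) + (pairing D h' lam - (\<Sum>j\<in>UNIV. \<nu> j * alpha h' j))"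
    by (simp add: pairing_add[OF lam] pairing_add[OF root_weight] distrib_left sum.distrib)
  then show "chi \<nu> (h + h') = chi \<nu> h * chi \<nu> h'"
    by (simp only: chi_def power_int_add qq_neq_0 simp_thms)
qed

lemma (in hw_ideal) linear_ext_chi_inj: "inj (\<lambda>\<nu>. linear_ext (chi \<nu>))"
  by (rule injI) (metis chi_inj ext linear_ext_gexp)

lemma image_setcompr: "{f y | y. y \<in> {g n | n. True}} = range (\<lambda>n. f (g n))"
  by blast

lemma (in hw_ideal) wt_cone_eq:
  "wt_cone D J (integral_wt D lam) = (\<lambda>\<nu>. linear_ext (chi \<nu>)) ` cone J"
proof -
  \<comment> \<open>Coefficients outside \<open>J\<close> are set to 0, so that sums over
    \<open>J\<close> become sums over all indices as in \<open>chi\<close>.\<close>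
  define N where "N n = (\<lambda>i. if i \<in> J then int (n i) else 0)" for n :: "'i \<Rightarrow> nat"
  have "wt_mult (integral_wt D (\<lambda>x. - (\<Sum>j\<in>J. of_nat (n j) * root D j x))) (integral_wt D lam) = linear_ext (chi (N n))" for n
  proof -
    have "qq powi pairing D h (\<lambda>x. - (\<Sum>j\<in>J. of_nat (n j) * root D j x)) * qq powi pairing D h lam = chi (N n) h" for h
    proof -
      define s where "s = (\<Sum>j\<in>J. int (n j) * alpha h j)"
      have e: "(\<Sum>j\<in>J. of_nat (n j) * root D j (emb D h)) = (of_int s :: complex)"
        by (simp add: s_def pairing_eq[OF root_weight])
      have "pairing D h (\<lambda>x. - (\<Sum>j\<in>J. of_nat (n j) * root D j x)) = \<lfloor>Re (- (of_int s))\<rfloor>"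
        by (simp only: pairing_def e)
      also have "\<dots> = - (\<Sum>j\<in>J. int (n j) * alpha h j)"
        by (simp add: s_def[symmetric])
      also have "(\<Sum>j\<in>J. int (n j) * alpha h j) = (\<Sum>j\<in>UNIV. N n j * alpha h j)"
        by (intro sum.mono_neutral_cong_left) (auto simp: N_def)
      finally show ?thesis by (simp add: chi_def power_int_diff power_int_minus divide_inverse)
    qed
    then show ?thesis by (simp add: wt_mult_def integral_wt_def)
  qed
  note eq = this
  have "wt_cone D J (integral_wt D lam) =
      range (\<lambda>n. wt_mult (integral_wt D (\<lambda>x. - (\<Sum>j\<in>J. of_nat (n j) * root D j x))) (integral_wt D lam))"
    unfolding wt_cone_def nonneg_span_def by (rule image_setcompr)
  then have "wt_cone D J (integral_wt D lam) = range (\<lambda>n. linear_ext (chi (N n)))"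
    by (simp only: eq)
  moreover have "range N = cone J"
  proof
    show "range N \<subseteq> cone J" by (auto simp: N_def cone_def)
    show "cone J \<subseteq> range N"
    proof
      fix \<nu> assume "\<nu> \<in> cone J"
      then have "\<nu> = N (\<lambda>i. nat (\<nu> i))" by (auto simp: N_def cone_def)
      then show "\<nu> \<in> range N" by blast
    qed
  qed
  ultimately show ?thesis by (metis image_image)
qed

locale hw_presentation = presentation D V v L + hw_ideal D L lam
  for D :: "('i::finite, 'p::ab_group_add, 'h::ab_group_add) km_datum"
    and V :: "(('i, 'p) uq, 'v, 'n) module_scheme" and v L lam
begin

lemma wt_space_wspace: "wt_space D V mu = act ` wspace (\<lambda>h. mu (gexp h))"
  unfolding wt_space_act by (simp add: wspace_def eqv_def)

lemma wt_eq: "wt D V = (\<lambda>\<nu>. linear_ext (chi \<nu>)) ` wts"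
proof
  show "wt D V \<subseteq> (\<lambda>\<nu>. linear_ext (chi \<nu>)) ` wts"
  proof
    fix mu assume "mu \<in> wt D V"
    then have mu: "mu \<in> weights" "wt_space D V mu \<noteq> {\<zero>\<^bsub>V\<^esub>}" by (auto simp: wt_def)
    have "0 \<in> wspace (\<lambda>h. mu (gexp h))" by (rule wspace_0)
    then have "act 0 \<in> wt_space D V mu" unfolding wt_space_wspace by (rule imageI)
    then have "\<zero>\<^bsub>V\<^esub> \<in> wt_space D V mu" using L_0 act_eq_0_iff by metis
    then obtain x where "x \<in> wspace (\<lambda>h. mu (gexp h))" "act x \<noteq> \<zero>\<^bsub>V\<^esub>"
      using mu(2) unfolding wt_space_wspace by blast
    then obtain \<nu> where "\<nu> \<in> wts" "(\<lambda>h. mu (gexp h)) = chi \<nu>"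
      using wspace_notin act_eq_0_iff by blast
    then show "mu \<in> (\<lambda>\<nu>. linear_ext (chi \<nu>)) ` wts"
      using weights_eq_linear_ext[OF mu(1)] by auto
  qed
  show "(\<lambda>\<nu>. linear_ext (chi \<nu>)) ` wts \<subseteq> wt D V"
  proof clarify
    fix \<nu> assume "\<nu> \<in> wts"
    then obtain w where "fw w \<in> W \<nu>" "fw w \<notin> L" by (rule wts_obtain)
    then have "act (fw w) \<in> wt_space D V (linear_ext (chi \<nu>))" "act (fw w) \<noteq> \<zero>\<^bsub>V\<^esub>"
      by (auto simp: wt_space_wspace act_eq_0_iff)
    then show "linear_ext (chi \<nu>) \<in> wt D V" using chi_weights by (auto simp: wt_def)
  qed
qed

lemma top_space: "wt_space D V (integral_wt D lam) = range (\<lambda>c. act (scalar c))"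
proof -
  have "(\<lambda>h. integral_wt D lam (gexp h)) = chi (\<lambda>_. 0)"
    by (rule ext) (simp add: integral_wt_def chi_def)
  then have "wt_space D V (integral_wt D lam) = act ` W (\<lambda>_. 0)"
    by (simp only: wt_space_wspace)
  also have "\<dots> = range (\<lambda>c. act (scalar c))"
  proof safe
    fix x assume "x \<in> W (\<lambda>_. 0)"
    then obtain c where "x \<doteq> scalar c" using W_zero by blast
    then have "act x = act (scalar c)" by (simp add: eqv_def act_eq_iff)
    then show "act x \<in> range (\<lambda>c. act (scalar c))" by simp
  next
    fix c :: kq
    show "act (scalar c) \<in> act ` W (\<lambda>_. 0)" using wspace_scalar[OF one_W, of c] by simp
  qed
  finally show ?thesis .
qed

lemma F_pow_top_space:
  "{(UF D i [^]\<^bsub>Uq D\<^esub> n) \<odot>\<^bsub>V\<^esub> w | (n::nat) w. w \<in> wt_space D V (integral_wt D lam)} =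
    {act (scalar c * F i ^ n) | n c. True}"
proof -
  have "(UF D i [^]\<^bsub>Uq D\<^esub> n) \<odot>\<^bsub>V\<^esub> act (scalar c) = act (scalar c * F i ^ n)" for n c
    by (simp add: UF_def smult_act scalar_commute flip: uq_class_power)
  then show ?thesis unfolding top_space by (auto simp: Collect_conj_eq) (metis rangeI)+
qed

lemma lin_span_subset: "S \<subseteq> lin_span D V B \<Longrightarrow> lin_span D V S \<subseteq> lin_span D V B"
  unfolding lin_span_def by blast

lemma subset_lin_span: "S \<subseteq> lin_span D V S"
  unfolding lin_span_def by blast

text \<open>Distinct powers of f_i have distinct weights, so in a linear relation the component of
  weight m consists of f_i^m alone.\<close>

lemma nilpotent_of_relation:
  assumes "F i ^ m \<doteq> (\<Sum>n<m. scalar (c n) * F i ^ n)" shows "F i ^ m \<in> L"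
proof -
  have pow: "F i ^ n = fw (replicate n i)" for n
    by (induction n) simp_all
  define T where "T = (\<lambda>n. replicate n i) ` {..<m}"
  have "inj_on (\<lambda>n. replicate n i) {..<m}" by (auto simp: inj_on_def)
  then have "(\<Sum>n<m. scalar (c n) * F i ^ n) = (\<Sum>w\<in>T. scalar (c (length w)) * fw w)"
    by (simp add: T_def sum.reindex pow)
  with assms have "F i ^ m \<doteq> (\<Sum>w\<in>T. scalar (c (length w)) * fw w)" by simp
  moreover have "F i ^ m \<in> W (cnt (replicate m i))" unfolding pow by (rule fw_W)
  ultimately have "F i ^ m \<doteq> (\<Sum>w\<in>{w \<in> T. chi (cnt w) = chi (cnt (replicate m i))}. scalar (c (length w)) * fw w)"
    by (intro wspace_component) (simp_all add: T_def)
  moreover have "{w \<in> T. chi (cnt w) = chi (cnt (replicate m i))} = {}"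
  proof -
    have "cnt (replicate n i) \<noteq> cnt (replicate m i)" if "n < m" for n
    proof
      assume "cnt (replicate n i) = cnt (replicate m i)"
      moreover have "cnt (replicate k i) i = int k" for k by (induction k) (simp_all add: cnt_def)
      ultimately have "int n = int m" by metis
      then show False using that by simp
    qed
    then show ?thesis using chi_inj by (auto simp: T_def)
  qed
  ultimately have "F i ^ m \<doteq> 0" by (simp only: sum.empty)
  then show ?thesis by (simp only: eqv_0_iff)
qed

text \<open>If f_i^n vanishes, the lower powers span. Conversely a finite spanning set lies in the
  span of the first m powers for some m, so f_i^m is a combination of lower powers and vanishes by
  \<open>nilpotent_of_relation\<close>.\<close>

lemma integrability_iff:
  "i \<in> integrability D V (integral_wt D lam) \<longleftrightarrow> (\<exists>n. F i ^ n \<in> L)"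
proof
  define S where "S = {act (scalar c * F i ^ n) | n c. True}"
  have int: "i \<in> integrability D V (integral_wt D lam) \<longleftrightarrow>
      (\<exists>B\<subseteq>carrier V. finite B \<and> lin_span D V S = lin_span D V B)"
    unfolding integrability_def mem_Collect_eq F_pow_top_space S_def[symmetric] ..
  {
    assume "\<exists>n. F i ^ n \<in> L"
    then obtain N where N: "F i ^ N \<in> L" by blast
    define B where "B = (\<lambda>n. act (F i ^ n)) ` {..<N}"
    have "S \<subseteq> lin_span D V B"
      unfolding lin_span_def S_def
    proof clarify
      fix n c W'
      assume W': "subgroup W' (add_monoid V)" "\<forall>c. \<forall>w\<in>W'. Uscal D c \<odot>\<^bsub>V\<^esub> w \<in> W'" "B \<subseteq> W'"
      show "act (scalar c * F i ^ n) \<in> W'"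
      proof (cases "n < N")
        case True
        then have "Uscal D c \<odot>\<^bsub>V\<^esub> act (F i ^ n) \<in> W'" using W'(2,3) by (auto simp: B_def)
        then show ?thesis by (simp add: Uscal_def smult_act)
      next
        case False
        then have "F i ^ n * 1 \<in> L" using N F_pow_mono[of i N 1 n] by simp
        then have "scalar c * F i ^ n \<in> L" by (simp add: L_mult)
        then have "act (scalar c * F i ^ n) = \<zero>\<^bsub>V\<^esub>" by (simp add: act_eq_0_iff)
        then show ?thesis using subgroup.one_closed[OF W'(1)] by simp
      qed
    qed
    moreover have "B \<subseteq> S"
    proof
      fix b assume "b \<in> B"
      then obtain n where "b = act (scalar 1 * F i ^ n)" by (auto simp: B_def)
      then show "b \<in> S" unfolding S_def by blast
    qed
    then have "B \<subseteq> lin_span D V S" using subset_lin_span by blast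
    ultimately have "lin_span D V S = lin_span D V B" using lin_span_subset by blast
    moreover have "B \<subseteq> carrier V" "finite B" using act_closed by (auto simp: B_def)
    ultimately show "i \<in> integrability D V (integral_wt D lam)" unfolding int by blast
  }
  assume "i \<in> integrability D V (integral_wt D lam)"
  then obtain B where B: "B \<subseteq> carrier V" "finite B" "lin_span D V S = lin_span D V B"
    unfolding int by blast
  \<comment> \<open>The spans of the first m powers form an increasing chain exhausting the span of
    \<open>S\<close>, so the finite set \<open>B\<close> is contained in one of them.\<close>
  define P where "P m = {act (\<Sum>n<m. scalar (c n) * F i ^ n) | c. True}" for m
  have PI: "act (\<Sum>n<m. scalar (c n) * F i ^ n) \<in> P m" for c m
    unfolding P_def by (rule CollectI) (intro exI[of _ c] conjI HOL.refl TrueI)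
  have P_mono: "P m \<subseteq> P m'" if "m \<le> m'" for m m'
  proof
    fix y assume "y \<in> P m"
    then obtain c where c: "y = act (\<Sum>n<m. scalar (c n) * F i ^ n)" by (auto simp: P_def)
    have "(\<Sum>n<m. scalar (c n) * F i ^ n) = (\<Sum>n<m'. scalar (if n < m then c n else 0) * F i ^ n)"
      using that by (intro sum.mono_neutral_cong_left) auto
    then show "y \<in> P m'" unfolding c by (simp only: PI)
  qed
  have P_add: "y \<oplus>\<^bsub>V\<^esub> z \<in> P m" if yz: "y \<in> P m" "z \<in> P m" for y z m
  proof -
    obtain b c where "y = act (\<Sum>n<m. scalar (b n) * F i ^ n)" "z = act (\<Sum>n<m. scalar (c n) * F i ^ n)"
      using yz by (auto simp: P_def)
    then have "y \<oplus>\<^bsub>V\<^esub> z = act (\<Sum>n<m. scalar (b n + c n) * F i ^ n)"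
      by (simp add: scalar_add distrib_right sum.distrib flip: act_add)
    then show ?thesis by (simp only: PI)
  qed
  have P_scal: "uq_class D (scalar b) \<odot>\<^bsub>V\<^esub> y \<in> P m" if y: "y \<in> P m" for b y m
  proof -
    obtain c where "y = act (\<Sum>n<m. scalar (c n) * F i ^ n)" using y by (auto simp: P_def)
    then have "uq_class D (scalar b) \<odot>\<^bsub>V\<^esub> y = act (\<Sum>n<m. scalar (b * c n) * F i ^ n)"
      by (simp add: smult_act sum_distrib_left scalar_mult mult.assoc)
    then show ?thesis by (simp only: PI)
  qed
  have P_closed: "P m \<subseteq> carrier V" for m using act_closed by (auto simp: P_def)
  have P_neg: "\<ominus>\<^bsub>V\<^esub> y \<in> P m" if y: "y \<in> P m" for y m
  proof -
    obtain x where x: "y = act x" using y by (auto simp: P_def)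
    have "act (scalar (- 1) * x) \<oplus>\<^bsub>V\<^esub> act x = \<zero>\<^bsub>V\<^esub>"
      by (simp add: scalar_minus act_eq_0_iff L_0 flip: act_add)
    then have "\<ominus>\<^bsub>V\<^esub> y = act (scalar (- 1) * x)" using x act_closed by (simp add: M.minus_equality)
    then show ?thesis using P_scal[OF y, of "- 1"] by (simp add: x smult_act)
  qed
  have P_0: "\<zero>\<^bsub>V\<^esub> \<in> P m" for m
  proof -
    have "act (\<Sum>n<m. scalar 0 * F i ^ n) = \<zero>\<^bsub>V\<^esub>" by (simp add: act_eq_0_iff L_0)
    then show ?thesis using PI[of "\<lambda>_. 0" m] by (simp only:)
  qed
  have sub: "subgroup (P m) (add_monoid V)" for m
    using P_0[of m] by (intro M.add.subgroupI P_closed P_neg P_add) auto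
  have span_P: "lin_span D V Y \<subseteq> P m" if "Y \<subseteq> P m" for Y m
    unfolding lin_span_def using that sub P_scal by (intro Inter_lower) (auto simp: Uscal_def)
  let ?U = "\<Union>m. P m"
  have U_add: "y \<oplus>\<^bsub>V\<^esub> z \<in> ?U" if yz: "y \<in> ?U" "z \<in> ?U" for y z
  proof -
    obtain m m' where "y \<in> P m" "z \<in> P m'" using yz by blast
    then have "y \<in> P (max m m')" "z \<in> P (max m m')" using P_mono[of m "max m m'"] P_mono[of m' "max m m'"] by auto
    then show ?thesis using P_add by blast
  qed
  have U_scal: "Uscal D b \<odot>\<^bsub>V\<^esub> y \<in> ?U" if "y \<in> ?U" for b y
    using that P_scal unfolding Uscal_def by blast
  have "subgroup ?U (add_monoid V)"
  proof (rule M.add.subgroupI)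
    show "?U \<subseteq> carrier V" using P_closed by blast
    show "?U \<noteq> {}" using P_0 by blast
    show "\<ominus>\<^bsub>V\<^esub> y \<in> ?U" if "y \<in> ?U" for y using that P_neg by blast
  qed (rule U_add)
  moreover have "S \<subseteq> ?U"
  proof
    fix y assume "y \<in> S"
    then obtain n c where y: "y = act (scalar c * F i ^ n)" by (auto simp: S_def)
    have "(\<Sum>k<Suc n. scalar (if k = n then c else 0) * F i ^ k) = scalar c * F i ^ n"
      by simp
    then have "y \<in> P (Suc n)" using PI[of "\<lambda>k. if k = n then c else 0" "Suc n"] unfolding y by (simp only:)
    then show "y \<in> ?U" by blast
  qed
  ultimately have "lin_span D V S \<subseteq> ?U"
    unfolding lin_span_def using U_scal by (intro Inter_lower) blast
  then have B_U: "B \<subseteq> ?U" using subset_lin_span[of B] B(3) by blast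
  have "\<exists>m. B \<subseteq> P m"
    using B(2) B_U
  proof (induction B rule: finite_induct)
    case (insert b B)
    then obtain m m' where "B \<subseteq> P m" "b \<in> P m'" by auto
    then have "insert b B \<subseteq> P (max m m')" using P_mono[of m "max m m'"] P_mono[of m' "max m m'"] by auto
    then show ?case by blast
  qed simp
  then obtain m where "B \<subseteq> P m" by blast
  then have "lin_span D V S \<subseteq> P m" using span_P B(3) by simp
  moreover have "act (scalar 1 * F i ^ m) \<in> S" unfolding S_def by blast
  ultimately have "act (F i ^ m) \<in> P m" using subset_lin_span by auto
  then obtain c where "act (F i ^ m) = act (\<Sum>n<m. scalar (c n) * F i ^ n)" by (auto simp: P_def)
  then have "F i ^ m \<doteq> (\<Sum>n<m. scalar (c n) * F i ^ n)" by (simp add: act_eq_iff eqv_def)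
  then show "\<exists>n. F i ^ n \<in> L" using nilpotent_of_relation by blast
qed

end

section \<open>Verma, parabolic Verma and simple modules\<close>

lemma (in presentation) presentation_quot_gen:
  "\<exists>u. presentation D (quot_module V (gen_submodule (Uq D) V (act ` S))) u (lideal (L \<union> S))"
proof -
  have T: "left_ideal (lideal (L \<union> S))" "L \<subseteq> lideal (L \<union> S)"
    using left_ideal_lideal lideal_subset[of "L \<union> S"] by blast+
  have "{x. act x \<in> act ` lideal (L \<union> S)} = lideal (L \<union> S)"
    using submodule_act(2)[OF T] by simp
  then show ?thesis
    using presentation_quot[OF submodule_act(1)[OF T]] unfolding gen_submodule_act by auto
qed

lemma presentation_of_generator:
  assumes lm: "left_module (Uq D) V" and v: "v \<in> carrier V" and gen: "gen_submodule (Uq D) V {v} = carrier V"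
  shows "presentation D V v {x. uq_class D x \<odot>\<^bsub>V\<^esub> v = \<zero>\<^bsub>V\<^esub>}"
proof -
  interpret left_module "Uq D" V by (rule lm)
  have c: "uq_class D x \<in> carrier (Uq D)" for x by (simp add: carrier_Uq)
  let ?f = "\<lambda>x. uq_class D x \<odot>\<^bsub>V\<^esub> v"
  have closed: "?f x \<in> carrier V" for x using c v by simp
  have add: "?f (x + y) = ?f x \<oplus>\<^bsub>V\<^esub> ?f y" for x y
    using c v by (simp add: uq_class_add smult_l_distr)
  have zero: "?f 0 = \<zero>\<^bsub>V\<^esub>"
    using add[of 0 0] closed[of 0] M.add.r_cancel_one[of "?f 0" "?f 0"] by simp
  have "subgroup (range ?f) (add_monoid V)"
  proof (rule M.add.subgroupI)
    show "range ?f \<subseteq> carrier V" using closed by auto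
    show "range ?f \<noteq> {}" by simp
    fix y assume "y \<in> range ?f"
    then obtain x where x: "y = ?f x" by auto
    have "?f (- x) \<oplus>\<^bsub>V\<^esub> ?f x = \<zero>\<^bsub>V\<^esub>" by (simp only: add[symmetric] ab_left_minus zero)
    then have "\<ominus>\<^bsub>V\<^esub> y = ?f (- x)" unfolding x using closed by (intro M.minus_equality)
    then show "\<ominus>\<^bsub>V\<^esub> y \<in> range ?f" by simp
    fix z assume "z \<in> range ?f"
    then obtain x' where "z = ?f x'" by auto
    then have "y \<oplus>\<^bsub>V\<^esub> z = ?f (x + x')" unfolding x by (simp only: add)
    then show "y \<oplus>\<^bsub>V\<^esub> z \<in> range ?f" by simp
  qed
  moreover have "r \<odot>\<^bsub>V\<^esub> y \<in> range ?f" if r: "r \<in> carrier (Uq D)" and y: "y \<in> range ?f" for r y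
  proof -
    obtain s x where "r = uq_class D s" "y = ?f x" using r y by (auto simp: carrier_Uq)
    then have "r \<odot>\<^bsub>V\<^esub> y = ?f (s * x)" using c v by (simp add: uq_class_mult smult_assoc1)
    then show ?thesis by simp
  qed
  ultimately have "submodule (range ?f) (Uq D) V"
    by (intro submodule.intro submodule_axioms.intro)
  moreover have "v \<in> range ?f"
  proof (rule range_eqI)
    show "v = ?f 1" using v by (simp add: uq_class_1)
  qed
  ultimately have "carrier V \<subseteq> range ?f"
    unfolding gen[symmetric] gen_submodule_def by (intro Inter_lower) simp
  then have "carrier V = range ?f" using closed by auto
  then show ?thesis
    by (intro presentation.intro presentation_axioms.intro lm v) simp_all
qed

section \<open>Ideals of the Verma, parabolic and simple modules\<close>

definition verma_rels ::
    "('i::finite, 'p::ab_group_add, 'h::ab_group_add) km_datum \<Rightarrow> ('h \<Rightarrow> complex) \<Rightarrow> ('i, 'p) falg set" where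
  "verma_rels D lam = range (\<lambda>i. gen (GE i)) \<union> range (\<lambda>h. gen (GK h) - scalar (qq powi pairing D h lam))"

definition verma_ideal ::
    "('i::finite, 'p::ab_group_add, 'h::ab_group_add) km_datum \<Rightarrow> ('h \<Rightarrow> complex) \<Rightarrow> ('i, 'p) falg set" where
  "verma_ideal D lam = lideal (relator_ideal D \<union> verma_rels D lam)"

lemma presentation_verma: "\<exists>u. presentation D (verma D (integral_wt D lam)) u (verma_ideal D lam)"
proof -
  interpret R: presentation D "regular_module (Uq D)" "\<one>\<^bsub>Uq D\<^esub>" "relator_ideal D"
    by (rule presentation_regular)
  have "range (UE D) \<union> range (\<lambda>h. UK D h \<ominus>\<^bsub>Uq D\<^esub> Uscal D (integral_wt D lam (gexp h))) = R.act ` verma_rels D lam"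
    by (auto simp: presentation_regular verma_rels_def UE_def UK_def Uscal_def uq_class_minus integral_wt_def image_Un image_image)
  then show ?thesis
    using R.presentation_quot_gen[of "verma_rels D lam"] by (simp add: verma_def verma_ideal_def)
qed

lemma (in km) hw_ideal_verma_ideal:
  assumes "lam \<in> weight_lattice D" shows "hw_ideal D (verma_ideal D lam) lam"
proof -
  have sub: "relator_ideal D \<union> verma_rels D lam \<subseteq> verma_ideal D lam"
    unfolding verma_ideal_def by (rule lideal_subset)
  then have "uq_ideal D (verma_ideal D lam)"
    by (intro uq_ideal_of_left_ideal) (auto simp: verma_ideal_def left_ideal_lideal)
  then show ?thesis
    using assms sub by (intro hw_ideal.intro hw_ideal_axioms.intro) (auto simp: verma_rels_def)
qed

lemma (in hw_ideal) verma_ideal_subset: "verma_ideal D lam \<subseteq> L"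
  unfolding verma_ideal_def verma_rels_def
  using relator_ideal_subset[OF uq_ideal_axioms] L_E L_K
  by (intro lideal_minimal left_ideal_L) auto

lemma (in hw_ideal) hw_ideal_of_left_ideal:
  assumes "left_ideal T" "L \<subseteq> T" shows "hw_ideal D T lam"
proof -
  have "uq_ideal D T"
    using assms relator_ideal_subset[OF uq_ideal_axioms] by (intro uq_ideal_of_left_ideal) auto
  then show ?thesis
    using assms(2) lam L_E L_K by (intro hw_ideal.intro hw_ideal_axioms.intro) auto
qed

text \<open>The scalars \<open>c\<close> appear because the parabolic module is defined with the
  whole highest weight space, which \<open>top_space\<close> identifies with the multiples of the
  generator.\<close>

definition parabolic_rels ::
    "('i::finite, 'p::ab_group_add, 'h::ab_group_add) km_datum \<Rightarrow> ('h \<Rightarrow> complex) \<Rightarrow> 'i set \<Rightarrow> ('i, 'p) falg set" where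
  "parabolic_rels D lam J =
     {scalar c * gen (GF j) ^ (nat (pairing D (coroot D j) lam) + 1) | c j. j \<in> J}"

definition parabolic_ideal ::
    "('i::finite, 'p::ab_group_add, 'h::ab_group_add) km_datum \<Rightarrow> ('h \<Rightarrow> complex) \<Rightarrow> 'i set \<Rightarrow> ('i, 'p) falg set" where
  "parabolic_ideal D lam J = lideal (verma_ideal D lam \<union> parabolic_rels D lam J)"

lemma (in km) presentation_parabolic:
  assumes "lam \<in> weight_lattice D"
  shows "\<exists>u. presentation D (parabolic_verma D lam J) u (parabolic_ideal D lam J)"
proof -
  obtain u where "presentation D (verma D (integral_wt D lam)) u (verma_ideal D lam)"
    using presentation_verma by blast
  then interpret M: hw_presentation D "verma D (integral_wt D lam)" u "verma_ideal D lam" lam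
    using hw_ideal_verma_ideal[OF assms] by (simp add: hw_presentation_def)
  have smult: "(UF D j [^]\<^bsub>Uq D\<^esub> (n::nat)) \<odot>\<^bsub>verma D (integral_wt D lam)\<^esub> M.act (scalar c) = M.act (scalar c * gen (GF j) ^ n)" for j n c
    by (simp add: UF_def M.smult_act scalar_commute flip: uq_class_power)
  have "{(UF D j [^]\<^bsub>Uq D\<^esub> (nat (pairing D (coroot D j) lam) + 1)) \<odot>\<^bsub>verma D (integral_wt D lam)\<^esub> v | j v.
             j \<in> J \<and> v \<in> wt_space D (verma D (integral_wt D lam)) (integral_wt D lam)} = M.act ` parabolic_rels D lam J"
    (is "?l = ?r")
  proof
    show "?l \<subseteq> ?r"
    proof
      fix x assume "x \<in> ?l"
      then obtain j c where "j \<in> J" "x = (UF D j [^]\<^bsub>Uq D\<^esub> (nat (pairing D (coroot D j) lam) + 1)) \<odot>\<^bsub>verma D (integral_wt D lam)\<^esub> M.act (scalar c)"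
        unfolding M.top_space by blast
      then show "x \<in> ?r" unfolding smult parabolic_rels_def by blast
    qed
    show "?r \<subseteq> ?l"
    proof
      fix x assume "x \<in> ?r"
      then obtain j c where "j \<in> J" "x = M.act (scalar c * gen (GF j) ^ (nat (pairing D (coroot D j) lam) + 1))"
        unfolding parabolic_rels_def by blast
      then show "x \<in> ?l" unfolding M.top_space smult[symmetric] by blast
    qed
  qed
  then show ?thesis
    using M.presentation_quot_gen[of "parabolic_rels D lam J"]
    by (simp add: parabolic_verma_def Let_def parabolic_ideal_def)
qed

lemma (in hw_ideal) parabolic_ideal_subset:
  assumes "\<And>j. j \<in> J \<Longrightarrow> F j ^ Suc (nat (hwt j)) \<in> L"
  shows "parabolic_ideal D lam J \<subseteq> L"
  unfolding parabolic_ideal_def parabolic_rels_def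
  using verma_ideal_subset assms by (intro lideal_minimal left_ideal_L) (auto intro: L_mult simp del: power_Suc)

lemma (in km) hw_ideal_parabolic_ideal:
  assumes "lam \<in> weight_lattice D"
  shows "hw_ideal D (parabolic_ideal D lam J) lam"
    and "j \<in> J \<Longrightarrow> gen (GF j) ^ Suc (nat (pairing D (coroot D j) lam)) \<in> parabolic_ideal D lam J"
proof -
  interpret M: hw_ideal D "verma_ideal D lam" lam by (rule hw_ideal_verma_ideal[OF assms])
  have sub: "verma_ideal D lam \<union> parabolic_rels D lam J \<subseteq> parabolic_ideal D lam J"
    unfolding parabolic_ideal_def by (rule lideal_subset)
  then show "hw_ideal D (parabolic_ideal D lam J) lam"
    by (intro M.hw_ideal_of_left_ideal) (auto simp: parabolic_ideal_def left_ideal_lideal)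
  assume "j \<in> J"
  then have "scalar 1 * gen (GF j) ^ (nat (pairing D (coroot D j) lam) + 1) \<in> parabolic_rels D lam J"
    unfolding parabolic_rels_def by blast
  then show "gen (GF j) ^ Suc (nat (pairing D (coroot D j) lam)) \<in> parabolic_ideal D lam J"
    using sub by auto
qed

text \<open>The image of \<open>maxN\<close> is a proper submodule and contains all others, so it is
  the union of the proper submodules.\<close>

lemma (in km) presentation_simple_hw:
  assumes "lam \<in> weight_lattice D" "1 \<notin> verma_ideal D lam"
  shows "\<exists>u. presentation D (simple_hw D (integral_wt D lam)) u (hw_ideal.maxN (verma_ideal D lam))"
proof -
  obtain u where "presentation D (verma D (integral_wt D lam)) u (verma_ideal D lam)"
    using presentation_verma by blast
  then interpret M: hw_presentation D "verma D (integral_wt D lam)" u "verma_ideal D lam" lam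
    using hw_ideal_verma_ideal[OF assms(1)] by (simp add: hw_presentation_def)
  interpret N: hw_ideal D M.maxN lam by (rule M.hw_ideal_maxN)
  let ?V = "verma D (integral_wt D lam)"
  have proper: "submodule (M.act ` M.maxN) (Uq D) ?V" "M.act ` M.maxN \<noteq> carrier ?V"
  proof -
    note sub = M.submodule_act[OF N.left_ideal_L M.L_subset_maxN]
    show "submodule (M.act ` M.maxN) (Uq D) ?V" by (rule sub(1))
    have "M.act 1 \<notin> M.act ` M.maxN" using sub(2) M.one_maxN[OF assms(2)] by simp
    then show "M.act ` M.maxN \<noteq> carrier ?V" using M.act_closed[of 1] by metis
  qed
  have "N \<subseteq> M.act ` M.maxN" if N: "submodule N (Uq D) ?V" "N \<noteq> carrier ?V" for N
  proof -
    let ?T = "{x. M.act x \<in> N}"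
    note T = M.left_ideal_of_submodule[OF N(1)]
    have "1 \<notin> ?T"
    proof
      assume "1 \<in> ?T"
      then have "x * 1 \<in> ?T" for x by (rule left_idealD(3)[OF T(1)])
      then have "?T = UNIV" by auto
      then show False using T(3) N(2) M.carrier_act by simp
    qed
    then have "?T \<subseteq> M.maxN"
      by (intro M.maxN_maximal M.hw_ideal_of_left_ideal T(1,2))
    then show ?thesis by (subst T(3)) (rule image_mono)
  qed
  then have "\<Union>{N. submodule N (Uq D) ?V \<and> N \<noteq> carrier ?V} = M.act ` M.maxN"
    using proper by blast
  moreover have "lideal (verma_ideal D lam \<union> M.maxN) = M.maxN"
    using M.L_subset_maxN lideal_subset[of "verma_ideal D lam \<union> M.maxN"]
      lideal_minimal[OF N.left_ideal_L, of "verma_ideal D lam \<union> M.maxN"] by blast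
  ultimately show ?thesis
    using M.presentation_quot_gen[of M.maxN] by (simp add: simple_hw_def)
qed

text \<open>If the power \<open>Suc (nat (hwt i))\<close> survived, it would be a vector killed by
  e_i with negative pairing -hwt - 2, so no power of f_i could kill it, against nilpotency.\<close>

lemma (in hw_ideal) nilpotent_singular:
  assumes "1 \<notin> L" "F i ^ n \<in> L" shows "F i ^ Suc (nat (hwt i)) \<in> L"
proof (rule ccontr)
  let ?m = "Suc (nat (hwt i))" and ?\<nu> = "(\<lambda>_. 0)(i := 0 + int (Suc (nat (hwt i))))"
  assume notin: "F i ^ ?m \<notin> L"
  have hwt: "0 \<le> hwt i" using assms by (rule hwt_nonneg)
  have W: "F i ^ ?m \<in> W ?\<nu>" using W_F_pow[OF one_W, of i ?m] by simp
  have "wpair i ?\<nu> = hwt i - 2 * int ?m"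
    using wpair_fun_upd[of i "\<lambda>_. 0" "int ?m"] by (simp only: wpair_0)
  then have "wpair i ?\<nu> < 0" using hwt by simp
  then have "F i ^ n * F i ^ ?m \<notin> L"
    by (intro highest_string_notin[OF W E_F_pow_singular[OF hwt] notin]) simp
  moreover have "F i ^ n * F i ^ ?m = F i ^ ?m * F i ^ n"
    by (simp only: power_add[symmetric] add.commute)
  ultimately show False using L_mult[OF assms(2)] by simp
qed

lemma (in hw_presentation) simple_imp_maxN:
  assumes "simple_module (Uq D) V" "1 \<notin> L" shows "maxN = L"
proof -
  interpret N: hw_ideal D maxN lam by (rule hw_ideal_maxN)
  note sub = submodule_act[OF N.left_ideal_L L_subset_maxN]
  have "act ` maxN = {\<zero>\<^bsub>V\<^esub>} \<or> act ` maxN = carrier V"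
    using assms(1) sub(1) by (simp add: simple_module_def)
  moreover have "act 1 \<notin> act ` maxN" using sub(2) one_maxN[OF assms(2)] by simp
  ultimately have "act ` maxN = {\<zero>\<^bsub>V\<^esub>}" using act_closed by metis
  then have "maxN \<subseteq> L" using act_eq_0_iff by auto
  then show ?thesis using L_subset_maxN by blast
qed

lemma (in hw_ideal) cone_mono: "J \<subseteq> J' \<Longrightarrow> cone J \<subseteq> cone J'"
  by (auto simp: cone_def)

text \<open>With at most one index, the cone contains only multiples of a single root, each
  represented by a power of f_i.\<close>

lemma (in hw_ideal) cone_small:
  assumes "1 \<notin> L" "card J \<le> 1" "\<And>i n. i \<in> J \<Longrightarrow> F i ^ n \<notin> L"
  shows "cone J \<subseteq> wts"
proof
  fix \<nu> assume \<nu>: "\<nu> \<in> cone J"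
  have pow: "F i ^ n = fw (replicate n i)" for i n by (induction n) simp_all
  show "\<nu> \<in> wts"
  proof (cases "J = {}")
    case True
    then have "\<nu> = cnt []" using \<nu> by (auto simp: cone_def cnt_Nil)
    moreover have "fw [] \<notin> L" using assms(1) by simp
    ultimately show ?thesis unfolding wts_def by blast
  next
    case False
    then have "card J = 1" using assms(2) by (simp add: le_Suc_eq)
    then obtain i where J: "J = {i}" by (auto simp: card_1_singleton_iff)
    have cnt: "cnt (replicate n i) = (\<lambda>j. if j = i then int n else 0)" for n
      by (rule ext, induction n) (auto simp: cnt_def)
    have "\<nu> = cnt (replicate (nat (\<nu> i)) i)"
      unfolding cnt using \<nu> by (auto simp: cone_def J)
    moreover have "fw (replicate (nat (\<nu> i)) i) \<notin> L"
      using assms(3)[of i "nat (\<nu> i)"] by (simp add: pow J)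
    ultimately show ?thesis unfolding wts_def by blast
  qed
qed

text \<open>\<open>pideal J\<close> is a highest weight ideal containing the parabolic relations,
  hence contains the parabolic ideal; a word outside the former is outside the latter.\<close>

lemma (in km) cone_parabolic:
  assumes lam: "lam \<in> weight_lattice D" and J: "\<And>j. j \<in> J \<Longrightarrow> 0 \<le> pairing D (coroot D j) lam"
  shows "hw_ideal.cone (- J) \<subseteq> hw_ideal.wts (parabolic_ideal D lam J)"
proof -
  interpret R: verma_rep D lam by unfold_locales (rule lam)
  interpret P: hw_ideal D "parabolic_ideal D lam J" lam by (rule hw_ideal_parabolic_ideal[OF lam])
  interpret Z: hw_ideal D "R.pideal J" lam by (rule R.hw_ideal_pideal[OF J])
  have sub: "parabolic_ideal D lam J \<subseteq> R.pideal J"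
    by (rule Z.parabolic_ideal_subset) (rule R.F_pow_pideal)
  show ?thesis
  proof
    fix \<nu> assume \<nu>: "\<nu> \<in> P.cone (- J)"
    then obtain w where w: "P.cnt w = \<nu>" using P.cnt_surj[of \<nu>] by (auto simp: P.cone_def)
    have "x \<notin> J" if "x \<in> set w" for x
    proof -
      have "0 < \<nu> x" using that P.cnt_pos_iff[of w x] by (simp add: w)
      moreover have "x \<in> J \<Longrightarrow> \<nu> x = 0" using \<nu> by (simp add: P.cone_def)
      ultimately show ?thesis by auto
    qed
    then have "set w \<inter> J = {}" by blast
    then have "P.fw w \<notin> R.pideal J" unfolding P.fw_def by (rule R.F_word_notin_pideal)
    then show "\<nu> \<in> P.wts" using sub w by (auto simp: P.wts_def)
  qed
qed

theorem theorem9p5: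
  fixes D :: "('i::finite, 'p::ab_group_add, 'h::ab_group_add) km_datum"
    and V :: "(('i, 'p) uq, 'v) module"
    and lam :: "'h \<Rightarrow> complex" and lam_q :: "'p weight"
  assumes "km_data D"
    and "lam \<in> weight_lattice D" and "lam_q = integral_wt D lam"
    and "highest_weight_module D V lam_q"
  shows "(wt D V = wt D (parabolic_verma D lam (integrability D V lam_q)) \<longleftrightarrow>
            wt_J D V lam_q (I_p D V lam_q) = wt_cone D (I_p D V lam_q) lam_q)
       \<and> (simple_module (Uq D) V \<or> card (I_p D V lam_q) \<le> 1 \<longrightarrow>
            wt D V = wt D (parabolic_verma D lam (integrability D V lam_q)))"
proof -
  interpret km D by unfold_locales (rule assms(1))
  note lam = assms(2)
  obtain v where v: "left_module (Uq D) V" "v \<in> wt_space D V lam_q" "v \<noteq> \<zero>\<^bsub>V\<^esub>"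
    "\<And>i. UE D i \<odot>\<^bsub>V\<^esub> v = \<zero>\<^bsub>V\<^esub>" "gen_submodule (Uq D) V {v} = carrier V"
    using assms(4) by (auto simp: highest_weight_module_def)
  have vc: "v \<in> carrier V" using v(2) by (simp add: wt_space_def)
  define L where "L = {x. uq_class D x \<odot>\<^bsub>V\<^esub> v = \<zero>\<^bsub>V\<^esub>}"
  interpret P: presentation D V v L
    unfolding L_def by (rule presentation_of_generator[OF v(1) vc v(5)])
  have act_1: "P.act 1 = v" using vc by (simp add: P.act_def uq_class_1)
  have "gen (GK h) - scalar (qq powi pairing D h lam) \<in> L" for h
  proof -
    have "P.act (gen (GK h)) = P.act (scalar (qq powi pairing D h lam))"
      using v(2) by (simp add: wt_space_def P.act_def UK_def Uscal_def assms(3) integral_wt_def)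
    then show ?thesis by (simp add: P.act_eq_iff)
  qed
  moreover have "gen (GE i) \<in> L" for i using v(4)[of i] by (simp add: L_def UE_def)
  ultimately interpret P: hw_presentation D V v L lam
    using P.presentation_axioms P.uq_ideal_L[OF assms(1)] lam
    by (intro hw_presentation.intro hw_ideal.intro hw_ideal_axioms.intro) auto
  have one: "1 \<notin> L" using act_1 v(3) P.act_eq_0_iff by metis
  define I where "I = integrability D V lam_q"
  have I_iff: "i \<in> I \<longleftrightarrow> (\<exists>n. P.F i ^ n \<in> L)" for i
    unfolding I_def assms(3) by (rule P.integrability_iff)
  have I_nonneg: "0 \<le> P.hwt i" if "i \<in> I" for i
    using that P.hwt_nonneg[OF one] by (auto simp: I_iff)
  have I_nilp: "P.F i ^ Suc (nat (P.hwt i)) \<in> L" if "i \<in> I" for i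
    using that P.nilpotent_singular[OF one] by (auto simp: I_iff simp del: power_Suc)

  \<comment> \<open>The Verma module is nonzero because it maps onto \<open>V\<close>.\<close>
  have verma_proper: "1 \<notin> verma_ideal D lam" using one P.verma_ideal_subset by blast
  interpret M: hw_ideal D "verma_ideal D lam" lam by (rule hw_ideal_verma_ideal[OF lam])
  obtain s where "presentation D (simple_hw D (integral_wt D lam)) s M.maxN"
    using presentation_simple_hw[OF lam verma_proper] by blast
  then interpret S: hw_presentation D "simple_hw D (integral_wt D lam)" s M.maxN lam
    using M.hw_ideal_maxN by (simp add: hw_presentation_def)
  have Ip: "I_p D V lam_q = {i. 0 \<le> P.hwt i} - I"
    unfolding I_p_def I_def[symmetric]
    using S.integrability_iff M.nilpotent_maxN_iff[OF verma_proper] by (auto simp: assms(3))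
  \<comment> \<open>Indices in \<open>I\<close> have nonnegative pairing, so the complement of
    \<open>I\<close> splits into \<open>I_p\<close> and the indices on which even the simple module
    is not integrable.\<close>
  have compl: "- I = I_p D V lam_q \<union> {i. P.hwt i < 0}"
    using I_nonneg by (force simp: Ip)

  obtain u where "presentation D (parabolic_verma D lam I) u (parabolic_ideal D lam I)"
    using presentation_parabolic[OF lam] by blast
  then interpret Q: hw_presentation D "parabolic_verma D lam I" u "parabolic_ideal D lam I" lam
    using hw_ideal_parabolic_ideal(1)[OF lam] by (simp add: hw_presentation_def)
  have "parabolic_ideal D lam I \<subseteq> L" by (rule P.parabolic_ideal_subset) (rule I_nilp)
  then have sub: "P.wts \<subseteq> Q.wts" by (auto simp: P.wts_def Q.wts_def)

  have eq_iff: "wt D V = wt D (parabolic_verma D lam I) \<longleftrightarrow> P.wts = Q.wts"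
    unfolding P.wt_eq Q.wt_eq by (rule inj_image_eq_iff[OF P.linear_ext_chi_inj])
  have cone_iff: "wt_J D V lam_q (I_p D V lam_q) = wt_cone D (I_p D V lam_q) lam_q \<longleftrightarrow> P.cone (I_p D V lam_q) \<subseteq> P.wts"
    unfolding wt_J_def assms(3) P.wt_cone_eq P.wt_eq
    by (simp add: image_Int[OF P.linear_ext_chi_inj, symmetric] inj_image_eq_iff[OF P.linear_ext_chi_inj]) blast
  have transfer: "P.wts = Q.wts" if "P.cone (I_p D V lam_q) \<subseteq> P.wts"
  proof -
    have "P.cone (- I) \<subseteq> P.wts" unfolding compl by (rule P.cone_wts[OF one that])
    then have "Q.wts \<subseteq> P.wts"
      by (intro P.weight_transfer[OF Q.hw_ideal_axioms hw_ideal_parabolic_ideal(2)[OF lam]])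
    then show ?thesis using sub by blast
  qed
  have "P.cone (I_p D V lam_q) \<subseteq> P.wts" if "P.wts = Q.wts"
  proof -
    have "P.cone (I_p D V lam_q) \<subseteq> P.cone (- I)" by (rule P.cone_mono) (auto simp: Ip)
    also have "\<dots> \<subseteq> Q.wts" by (rule cone_parabolic[OF lam I_nonneg])
    finally show ?thesis by (simp add: that)
  qed
  moreover have "P.cone (I_p D V lam_q) \<subseteq> P.wts" if "simple_module (Uq D) V \<or> card (I_p D V lam_q) \<le> 1"
  proof (rule P.cone_small[OF one])
    show "card (I_p D V lam_q) \<le> 1"
    proof (cases "simple_module (Uq D) V")
      case True
      \<comment> \<open>For simple \<open>V\<close> both integrabilities are governed by the same
        ideal, so \<open>I_p\<close> is empty and the small cone case applies.\<close>
      then have "P.maxN = L" using one by (rule P.simple_imp_maxN)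
      then have "I_p D V lam_q = {}"
        using P.nilpotent_maxN_iff[OF one] by (auto simp: Ip I_iff)
      then show ?thesis by simp
    qed (use that in simp)
    show "P.F i ^ n \<notin> L" if "i \<in> I_p D V lam_q" for i n
      using that by (auto simp: Ip I_iff)
  qed
  ultimately show ?thesis
    unfolding I_def[symmetric] eq_iff cone_iff using transfer by blast
qed

end
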